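(* Let $m\ge 1$, $M\ge 2$, and let $Z_1,\dots,Z_M$ be $\mathcal{L}_{\mathbb R}((A))$-valued random variables. Assume that $Z_1,\dots,Z_M$ satisfy the following: (i) $Z_i=j_mZ_i$ for $i=1,\dots,M$; (ii) $E\left[\|j_mZ_i\|_2\right]<\infty$ for $i=1,\dots,M$; (iii) for every $s\in(0,1]$ and any $a>0$, $$E\left[\exp\left(a\sum_{j=1}^M\left\|\Phi(\Psi_s(Z_j))\right\|_{C^{m+1}}\right)\right]<\infty .$$ Then for $p\in[1,\infty)$ and arbitrary $g_1,\dots,g_M\in\mathcal{IS}(m)$, there exists a positive constant $C_{m,M}$ such that $$\left\|\sup_{x\in\mathbb R^N}\Big|g_1(\Phi(\Psi_s(Z_1)))\circ\cdots\circ g_M(\Phi(\Psi_s(Z_M)))(x)-\exp\Big(\Phi\big(\Psi_s\big(j_m\log(\exp(Z_M)\exp(Z_{M-1})\cdots\exp(Z_1))\big)\big)\Big)(x)\Big|\right\|_{L^p}\le C_{m,M}\,s^{(m+1)/2}$$ for $s\in(0,1]$, where $C_{m,M}$ depends only on $m$ and $M$. Here, for functions $f$ and $g$, $f\circ g(x)$ denotes $f(g(x))$.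
   Context: $N,d\ge1$ are integers. $C_b^\infty(\mathbb R^N;\mathbb R^N)$ is the set of infinitely differentiable maps $\mathbb R^N\to\mathbb R^N$ whose derivatives are all bounded (order zero included). Vector fields $V_0,\dots,V_d\in C_b^\infty(\mathbb R^N;\mathbb R^N)$ are fixed; $V=(V^1,\dots,V^N)$ acts on functions by $Vf=\sum_j V^j\partial f/\partial x_j$, and a vector field is identified with this first-order operator. Words and series: $A=\{v_0,\dots,v_d\}$ is an alphabet, $A^*$ the set of words over $A$ (including the empty word $1$). For $u=v_{i_1}\cdots v_{i_n}$, $|u|=n$ and $\|u\|=|u|+\mathrm{card}\{k: i_k=0\}$. $\mathbb R\langle A\rangle$ is the free associative algebra (non-commutative polynomials) and $\mathbb R\langle\langle A\rangle\rangle$ the algebra of formal series $P=\sum_{w\in A^*}(P,w)w$, with the product topology (and its Borel $\sigma$-algebra). $\mathcal L_{\mathbb R}(A)$ is the smallest linear subspace of $\mathbb R\langle A\rangle$ containing $A$ and closed under $[x,y]=xy-yx$; $\mathcal L_{\mathbb R}((A))$ is the set of formal series all of whose homogeneous components lie in $\mathcal L_{\mathbb R}(A)$. $j_m(\sum a_ww)=\sum_{\|w\|\le m}a_ww$. For polynomials, $\|P\|_2=(\sum_w (P,w)^2)^{1/2}$. $\exp(P)=\sum_{k\ge0}P^k/k!$ if $(P,1)=0$ and $\log(Q)=\sum_{k\ge1}(-1)^{k-1}(Q-1)^k/k$ if $(Q,1)=1$. $\Psi_s(\sum_w a_ww)=\sum_w s^{\|w\|/2}a_ww$ for $s>0$.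 $\Phi$ is the algebra homomorphism from $\mathbb R\langle A\rangle$ to smooth differential operators on $\mathbb R^N$ with $\Phi(1)=\mathrm{Id}$, $\Phi(v_{i_1}\cdots v_{i_n})=V_{i_1}\cdots V_{i_n}$ (composition); it maps Lie polynomials to vector fields. For a vector field $W\in C_b^\infty(\mathbb R^N;\mathbb R^N)$, $\exp(W)(x)$ is the value at time $1$ of the solution of $dz_t/dt=W(z_t)$, $z_0=x$. $\|W\|_{C^n}=\sum_{i=0}^n\|W^{(i)}\|$, where $\|W^{(0)}\|=\sup_x|W(x)|$ and $\|W^{(i)}\|=\sup\{|W^{(i)}_{(x)}(U_1,\dots,U_i)|: x\in\mathbb R^N, |U_k|=1\}$, $W^{(i)}$ being the $i$th total differential. $\mathcal{IS}(m)$ (integration schemes of order $m$) is the set of maps $g$ from $C_b^\infty(\mathbb R^N;\mathbb R^N)$ to the set of maps $\mathbb R^N\to\mathbb R^N$ for which there is a constant $C_m>0$ with $\sup_x|g(W)(x)-\exp(W)(x)|\le C_m\|W\|_{C^{m+1}}^{m+1}$ for all $W\in C_b^\infty(\mathbb R^N;\mathbb R^N)$.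
   Formalization: The constant is uniform in s but may depend on the vector fields, the Z_i, p and the g_i, not only on m and M: taking Z_1=v_1, other Z_i=0, g_1(W)=exp(W)+K‖W‖^{m+1}e, other g_i=exp gives an error growing with K, so dependence on m and M alone is false. *)

theory Defs
  imports "HOL-Probability.Probability"
begin

section \<open>Words, polynomials and formal series\<close>

text \<open>The number of letters enters as a type: a finite type \<open>'d\<close> with \<open>d\<close> elements stands for
  \<open>{1, \<dots>, d}\<close>, the letter \<open>v\<^sub>0\<close> is \<^term>\<open>None\<close> and \<open>v\<^sub>i\<close> is \<open>Some i\<close>. A series is the family of
  its coefficients, so that the topology which the library puts on a function type is the
  product topology.\<close>

type_synonym 'd letter = "'d option"
type_synonym 'd word = "'d letter list"
type_synonym 'd series = "'d word \<Rightarrow> real"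

definition wdeg :: "'d word \<Rightarrow> nat" where
  "wdeg w = length w + length (filter (\<lambda>a. a = None) w)"

definition support :: "'d series \<Rightarrow> 'd word set" where
  "support P = {w. P w \<noteq> 0}"

definition monomial :: "'d word \<Rightarrow> 'd series" where
  "monomial u = (\<lambda>w. if w = u then 1 else 0)"

definition s_one :: "'d series" where
  "s_one = monomial []"

definition s_mult :: "'d series \<Rightarrow> 'd series \<Rightarrow> 'd series" where
  "s_mult P Q = (\<lambda>w. \<Sum>k\<le>length w. P (take k w) * Q (drop k w))"

primrec s_power :: "'d series \<Rightarrow> nat \<Rightarrow> 'd series" where
  "s_power P 0 = s_one"
| "s_power P (Suc k) = s_mult P (s_power P k)"

definition s_bracket :: "'d series \<Rightarrow> 'd series \<Rightarrow> 'd series" where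
  "s_bracket P Q = (\<lambda>w. s_mult P Q w - s_mult Q P w)"

text \<open>If \<open>P\<close> and \<open>Q - 1\<close> have no constant term, the following two sums are finite
  for each word.\<close>

definition s_exp :: "'d series \<Rightarrow> 'd series" where
  "s_exp P = (\<lambda>w. \<Sum>k. s_power P k w / fact k)"

definition s_log :: "'d series \<Rightarrow> 'd series" where
  "s_log Q = (\<lambda>w. \<Sum>k. (-1) ^ k * s_power (\<lambda>u. Q u - s_one u) (Suc k) w / real (Suc k))"

primrec exp_product :: "(nat \<Rightarrow> 'd series) \<Rightarrow> nat \<Rightarrow> 'd series" where
  "exp_product Z 0 = s_one"
| "exp_product Z (Suc k) = s_mult (s_exp (Z (Suc k))) (exp_product Z k)"

definition trunc :: "nat \<Rightarrow> 'd series \<Rightarrow> 'd series" where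
  "trunc m P = (\<lambda>w. if wdeg w \<le> m then P w else 0)"

definition rescale :: "real \<Rightarrow> 'd series \<Rightarrow> 'd series" where
  "rescale s P = (\<lambda>w. s powr (real (wdeg w) / 2) * P w)"

text \<open>Euclidean norm of the coefficients of a polynomial.\<close>

definition norm2 :: "'d series \<Rightarrow> real" where
  "norm2 P = sqrt (\<Sum>w\<in>support P. (P w)\<^sup>2)"

inductive_set lie_polynomials :: "'d series set" where
  letter: "monomial [a] \<in> lie_polynomials"
| zero: "(\<lambda>w. 0) \<in> lie_polynomials"
| add: "P \<in> lie_polynomials \<Longrightarrow> Q \<in> lie_polynomials \<Longrightarrow> (\<lambda>w. P w + Q w) \<in> lie_polynomials"
| scale: "P \<in> lie_polynomials \<Longrightarrow> (\<lambda>w. c * P w) \<in> lie_polynomials"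
| bracket: "P \<in> lie_polynomials \<Longrightarrow> Q \<in> lie_polynomials \<Longrightarrow> s_bracket P Q \<in> lie_polynomials"

definition hom_component :: "nat \<Rightarrow> 'd series \<Rightarrow> 'd series" where
  "hom_component n P = (\<lambda>w. if length w = n then P w else 0)"

definition lie_series :: "'d series set" where
  "lie_series = {P. \<forall>n. hom_component n P \<in> lie_polynomials}"


section \<open>Smooth functions and vector fields\<close>

text \<open>\<open>tdiff W [U\<^sub>1, \<dots>, U\<^sub>i] x\<close> is the \<open>i\<close>-th total differential of \<open>W\<close> at \<open>x\<close>, applied to
  \<open>U\<^sub>1, \<dots>, U\<^sub>i\<close>.\<close>

primrec tdiff ::
  "('a::real_normed_vector \<Rightarrow> 'b::real_normed_vector) \<Rightarrow> 'a list \<Rightarrow> 'a \<Rightarrow> 'b" where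
  "tdiff W [] = W"
| "tdiff W (U # Us) = (\<lambda>x. frechet_derivative (tdiff W Us) (at x) U)"

definition smooth :: "('a::real_normed_vector \<Rightarrow> 'b::real_normed_vector) \<Rightarrow> bool" where
  "smooth W \<longleftrightarrow> (\<forall>Us x. tdiff W Us differentiable (at x))"

definition unit_tuples :: "nat \<Rightarrow> 'a::real_normed_vector list set" where
  "unit_tuples i = {Us. length Us = i \<and> (\<forall>U\<in>set Us. norm U = 1)}"

definition Cb_infinity :: "(real^'n \<Rightarrow> real^'n) set" where
  "Cb_infinity = {W. smooth W \<and>
     (\<forall>i. bounded {tdiff W Us x | Us x. Us \<in> unit_tuples i})}"

text \<open>The suprema are suprema of bounded sets of reals when \<^term>\<open>W \<in> Cb_infinity\<close>, the only
  case in which the norms are meant to be used.\<close>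

definition diff_norm :: "nat \<Rightarrow> (real^'n \<Rightarrow> real^'n) \<Rightarrow> real" where
  "diff_norm i W = (SUP (x, Us) \<in> UNIV \<times> unit_tuples i. norm (tdiff W Us x))"

definition C_norm :: "nat \<Rightarrow> (real^'n \<Rightarrow> real^'n) \<Rightarrow> real" where
  "C_norm n W = (\<Sum>i\<le>n. diff_norm i W)"

definition vf_apply :: "(real^'n \<Rightarrow> real^'n) \<Rightarrow> (real^'n \<Rightarrow> real) \<Rightarrow> real^'n \<Rightarrow> real" where
  "vf_apply W f = (\<lambda>x. \<Sum>j\<in>UNIV. W x $ j * frechet_derivative f (at x) (axis j 1))"

definition vf_exp :: "(real^'n \<Rightarrow> real^'n) \<Rightarrow> real^'n \<Rightarrow> real^'n" where
  "vf_exp W x = (THE y. \<exists>z. z 0 = x \<and> z 1 = y \<and>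
     (\<forall>t\<in>{0..1}. (z has_vector_derivative W (z t)) (at t within {0..1})))"

text \<open>Polynomials are the series with finite support; only for them is \<open>Phi_op\<close> meaningful.\<close>

primrec word_op ::
  "('d letter \<Rightarrow> real^'n \<Rightarrow> real^'n) \<Rightarrow> 'd word \<Rightarrow> (real^'n \<Rightarrow> real) \<Rightarrow> real^'n \<Rightarrow> real" where
  "word_op V [] f = f"
| "word_op V (a # w) f = vf_apply (V a) (word_op V w f)"

definition Phi_op ::
  "('d letter \<Rightarrow> real^'n \<Rightarrow> real^'n) \<Rightarrow> 'd series \<Rightarrow> (real^'n \<Rightarrow> real) \<Rightarrow> real^'n \<Rightarrow> real" where
  "Phi_op V P f = (\<lambda>x. \<Sum>w\<in>support P. P w * word_op V w f x)"

text \<open>The identification of a first-order operator without constant term with the vector field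
  that defines it.\<close>

definition vf_of_op :: "((real^'n \<Rightarrow> real) \<Rightarrow> real^'n \<Rightarrow> real) \<Rightarrow> real^'n \<Rightarrow> real^'n" where
  "vf_of_op D = (THE W. \<forall>f. smooth f \<longrightarrow> D f = vf_apply W f)"

definition Phi :: "('d letter \<Rightarrow> real^'n \<Rightarrow> real^'n) \<Rightarrow> 'd series \<Rightarrow> real^'n \<Rightarrow> real^'n" where
  "Phi V P = vf_of_op (Phi_op V P)"

lemma frechet_derivative_coordinate:
  "frechet_derivative (\<lambda>y::real^'n. y $ j) (at x) = (\<lambda>y. y $ j)"
  by (rule frechet_derivative_at [symmetric])
    (rule bounded_linear.has_derivative [OF bounded_linear_vec_nth has_derivative_ident])

lemma tdiff_coordinate_1: "tdiff (\<lambda>y::real^'n. y $ j) [U] = (\<lambda>x. U $ j)"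
  by (simp add: frechet_derivative_coordinate)

lemma tdiff_coordinate_ge_2:
  "tdiff (\<lambda>y::real^'n. y $ j) (U # T # Us) = (\<lambda>x. 0)"
  by (induction Us arbitrary: U T) (simp_all add: frechet_derivative_coordinate)

lemma smooth_coordinate: "smooth (\<lambda>y::real^'n. y $ j)"
  unfolding smooth_def
proof (intro allI)
  fix Us :: "(real^'n) list" and x :: "real^'n"
  have "(\<lambda>y::real^'n. y $ j) differentiable (at x)"
    using bounded_linear.has_derivative [OF bounded_linear_vec_nth has_derivative_ident]
    by (auto simp: differentiable_def)
  then show "tdiff (\<lambda>y::real^'n. y $ j) Us differentiable (at x)"
    by (cases Us rule: remdups_adj.cases)
      (simp_all only: tdiff.simps(1) tdiff_coordinate_1 tdiff_coordinate_ge_2 differentiable_const)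
qed

lemma vf_apply_coordinate: "vf_apply W (\<lambda>y. y $ j) = (\<lambda>x. W x $ j)"
  by (auto simp: vf_apply_def frechet_derivative_coordinate axis_def if_distrib cong: if_cong)

lemma vf_of_op_eqI:
  assumes "\<And>f. smooth f \<Longrightarrow> D f = vf_apply W f"
  shows "vf_of_op D = W"
  unfolding vf_of_op_def
proof (rule the_equality)
  show "\<forall>f. smooth f \<longrightarrow> D f = vf_apply W f"
    using assms by blast
next
  fix W'
  assume "\<forall>f. smooth f \<longrightarrow> D f = vf_apply W' f"
  then have "vf_apply W' (\<lambda>y. y $ j) = vf_apply W (\<lambda>y. y $ j)" for j
    using assms smooth_coordinate by metis
  then have "W' x $ j = W x $ j" for x j
    by (simp add: vf_apply_coordinate fun_eq_iff)
  then show "W' = W"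
    by (simp add: fun_eq_iff vec_eq_iff)
qed

lemma Phi_letter: "Phi V (monomial [a]) = V a"
  unfolding Phi_def
  by (rule vf_of_op_eqI) (simp add: Phi_op_def support_def monomial_def)


section \<open>Integration schemes\<close>

definition integration_schemes ::
  "nat \<Rightarrow> ((real^'n \<Rightarrow> real^'n) \<Rightarrow> real^'n \<Rightarrow> real^'n) set" where
  "integration_schemes m = {g. \<exists>C>0. \<forall>W\<in>Cb_infinity.
     (SUP x. ennreal (norm (g W x - vf_exp W x))) \<le> ennreal (C * C_norm (m + 1) W ^ (m + 1))}"

text \<open>\<open>F\<^sub>1 \<circ> \<cdots> \<circ> F\<^sub>k\<close>\<close>

primrec composition :: "(nat \<Rightarrow> 'a \<Rightarrow> 'a) \<Rightarrow> nat \<Rightarrow> 'a \<Rightarrow> 'a" where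
  "composition F 0 = id"
| "composition F (Suc k) = composition F k \<circ> F (Suc k)"


section \<open>The \<open>L\<^sup>p\<close> norm\<close>

definition ennreal_powr :: "ennreal \<Rightarrow> real \<Rightarrow> ennreal" where
  "ennreal_powr a p = (if a = \<infinity> then \<infinity> else ennreal (enn2real a powr p))"

text \<open>An integration scheme is an arbitrary map on vector fields, so the error of a composition
  of schemes evaluated at random vector fields need not be measurable. The \<open>L\<^sup>p\<close> norm is therefore
  defined with the upper integral. (The library's nonnegative integral of a non-measurable
  function is a lower integral.) It is the usual norm for measurable functions.\<close>

definition Lp_norm :: "'w measure \<Rightarrow> real \<Rightarrow> ('w \<Rightarrow> ennreal) \<Rightarrow> ennreal" where
  "Lp_norm Q p f =
     (INF h\<in>{h \<in> borel_measurable Q. \<forall>\<omega>\<in>space Q. f \<omega> \<le> h \<omega>}.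
        ennreal_powr (\<integral>\<^sup>+\<omega>. ennreal_powr (h \<omega>) p \<partial>Q) (1 / p))"

lemma ennreal_powr_mono: "a \<le> b \<Longrightarrow> 0 \<le> p \<Longrightarrow> ennreal_powr a p \<le> ennreal_powr b p"
  by (auto simp: ennreal_powr_def top_unique less_top intro!: ennreal_leI powr_mono2 enn2real_mono)

lemma Lp_norm_measurable:
  assumes "f \<in> borel_measurable Q" and "p > 0"
  shows "Lp_norm Q p f = ennreal_powr (\<integral>\<^sup>+\<omega>. ennreal_powr (f \<omega>) p \<partial>Q) (1 / p)"
  unfolding Lp_norm_def
  by (intro antisym INF_lower INF_greatest)
    (use assms in \<open>auto intro!: ennreal_powr_mono nn_integral_mono\<close>)

end

theory Submission
  imports Defs "HOL-Computational_Algebra.Formal_Power_Series" "HOL-Computational_Algebra.Polynomial"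
begin

unbundle no fps_syntax

text \<open>A vector field \<open>\<Phi>(P)\<close> generates a flow with \<open>f (exp(\<Phi>(P)) x) \<approx> \<Phi>(exp P) f x\<close>, so that
  \<open>exp(\<Phi>(Z\<^sub>1)) \<circ> \<cdots> \<circ> exp(\<Phi>(Z\<^sub>M))\<close> is approximated by the operator
  \<open>\<Phi>(exp(Z\<^sub>M) \<cdots> exp(Z\<^sub>1))\<close>, and so is the flow of the logarithm of this product. After rescaling, the
  errors consist of terms of weight larger than \<open>m\<close>, which is the factor \<open>s powr ((m + 1) / 2)\<close>. The logarithm
  is a Lie series because group-like series have primitive logarithms and primitive polynomials are
  Lie polynomials; hence its image is a vector field. All errors are polynomials in the norms of the
  vector fields \<open>\<Phi>\<close>(component of weight \<open>k\<close> of \<open>Z\<^sub>i\<close>), up to the Lipschitz constants of the flows, which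
  are exponentials of these norms. The hypothesis for several values of \<open>s\<close> separates the
  components of different weight, so their norms have all exponential moments.\<close>

section \<open>The algebra of series\<close>

text \<open>A map F acts on test functions by pullback, f -> f o F, which reverses products: the
  innermost flow of the composition becomes the outermost operator. This is why exp(Z_M) stands on
  the left. The test functions are the coordinates; their values are unbounded, so the estimates at
  a point x use \<open>y $ j - x $ j\<close>.

  The main obstacle is the number of derivatives. A product of two truncated factors contains
  weights up to 2m, while only derivatives up to order m + 1 are controlled. The remedy is that the
  left factor is a Lie polynomial: whatever its weight, it acts as a vector field and takes a single
  derivative of what the right factor, of weight at most m, produces
  (\<open>Phi_op_product_bound\<close>).

  The other obstacle is uniformity in s: (iii) gives a moment for each s separately, without a
  common bound. Once the weights are separated, one random variable K bounds the unscaled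
  components, and the error is at most E exp(a K) s^((m+1)/2) with E and a free of s. This majorant
  is measurable, which settles the upper integral.\<close>

lemma wdeg_simps [simp]:
  "wdeg [] = 0"
  "wdeg (a # w) = (if a = None then 2 else 1) + wdeg w"
  "wdeg (u @ v) = wdeg u + wdeg v"
  by (simp_all add: wdeg_def)

lemma wdeg_take_drop: "wdeg (take k w) + wdeg (drop k w) = wdeg w"
  by (metis append_take_drop_id wdeg_simps(3))

lemma length_le_wdeg: "length w \<le> wdeg w"
  by (simp add: wdeg_def)

lemma wdeg_shuffles: "w \<in> shuffles u v \<Longrightarrow> wdeg w = wdeg u + wdeg v"
  by (induction u v arbitrary: w rule: shuffles.induct) (auto split: if_splits)

lemma finite_words_wdeg: "finite {w :: 'd::finite word. wdeg w \<le> m}"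
proof (rule finite_subset)
  show "{w :: 'd word. wdeg w \<le> m} \<subseteq> {w. set w \<subseteq> UNIV \<and> length w \<le> m}"
    using length_le_wdeg order_trans by blast
qed (rule finite_lists_length_le, simp)

lemma s_mult_Nil [simp]: "s_mult P Q [] = P [] * Q []"
  by (simp add: s_mult_def)

text \<open>A cut of \<open>a # w\<close> leaves a left piece that is empty or starts with
  \<open>a\<close>. This recursion changes the left factor, so the inductions on words below keep
  \<open>P\<close> arbitrary.\<close>

lemma s_mult_Cons: "s_mult P Q (a # w) = P [] * Q (a # w) + s_mult (\<lambda>u. P (a # u)) Q w"
  by (simp add: s_mult_def sum.atMost_Suc_shift del: sum.atMost_Suc)

lemma s_mult_add_left: "s_mult (\<lambda>w. P w + P' w) Q = (\<lambda>w. s_mult P Q w + s_mult P' Q w)"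
  by (simp add: s_mult_def fun_eq_iff distrib_right sum.distrib)

lemma s_mult_add_right: "s_mult P (\<lambda>w. Q w + Q' w) = (\<lambda>w. s_mult P Q w + s_mult P Q' w)"
  by (simp add: s_mult_def fun_eq_iff distrib_left sum.distrib)

lemma s_mult_scale_left: "s_mult (\<lambda>w. c * P w) Q = (\<lambda>w. c * s_mult P Q w)"
  by (simp add: s_mult_def fun_eq_iff sum_distrib_left mult_ac)

lemma s_mult_scale_right: "s_mult P (\<lambda>w. c * Q w) = (\<lambda>w. c * s_mult P Q w)"
  by (simp add: s_mult_def fun_eq_iff sum_distrib_left mult_ac)

lemma s_mult_sum_right: "s_mult P (\<lambda>w. \<Sum>i\<in>I. Q i w) = (\<lambda>w. \<Sum>i\<in>I. s_mult P (Q i) w)"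
  by (simp add: s_mult_def fun_eq_iff sum_distrib_left sum.swap [of _ I])

lemma s_one_Nil [simp]: "s_one [] = 1"
  and s_one_Cons [simp]: "s_one (a # w) = 0"
  by (simp_all add: s_one_def monomial_def)

lemma s_mult_zero_left [simp]: "s_mult (\<lambda>w. 0) Q = (\<lambda>w. 0)"
  by (simp add: s_mult_def)

lemma s_mult_one_left [simp]: "s_mult s_one Q = Q"
proof
  fix w show "s_mult s_one Q w = Q w"
    by (cases w) (simp_all add: s_mult_Cons)
qed

lemma s_mult_one_right [simp]: "s_mult P s_one = P"
proof
  fix w show "s_mult P s_one w = P w"
    by (induction w arbitrary: P) (simp_all add: s_mult_Cons)
qed

lemma s_mult_assoc: "s_mult (s_mult P Q) R = s_mult P (s_mult Q R)"
proof
  fix w show "s_mult (s_mult P Q) R w = s_mult P (s_mult Q R) w"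
    by (induction w arbitrary: P)
      (simp_all add: s_mult_Cons s_mult_add_left s_mult_scale_left algebra_simps)
qed

lemma s_mult_letter_left: "s_mult (monomial [a]) Q (b # w) = (if a = b then Q w else 0)"
proof -
  have *: "(\<lambda>u. monomial [a] (b # u)) = (if a = b then s_one else (\<lambda>u. 0))"
    by (auto simp: fun_eq_iff monomial_def s_one_def)
  show ?thesis
    by (simp add: s_mult_Cons *) (simp add: monomial_def)
qed

lemma s_mult_letter_right: "s_mult P (monomial [a]) (w @ [b]) = (if a = b then P w else 0)"
  by (induction w arbitrary: P)
    (auto simp: s_mult_Cons monomial_def)

lemma s_power_add: "s_power P (i + j) = s_mult (s_power P i) (s_power P j)"
  by (induction i) (simp_all add: s_mult_assoc)

text \<open>To contribute, each of the k factors must take at least one letter of w.\<close>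

lemma s_power_eq_0:
  assumes "P [] = 0" "length w < k"
  shows "s_power P k w = 0"
  using assms(2)
proof (induction k arbitrary: w)
  case (Suc k)
  have "P (take i w) * s_power P k (drop i w) = 0" if "i \<le> length w" for i
    using Suc assms(1) that by (cases "i = 0") auto
  then have "(\<Sum>i\<le>length w. P (take i w) * s_power P k (drop i w)) = 0"
    by (intro sum.neutral) blast
  then show ?case
    by (simp add: s_mult_def)
qed simp

section \<open>Substitution into formal power series in one variable\<close>

definition s_subst :: "real fps \<Rightarrow> 'd series \<Rightarrow> 'd series" where
  "s_subst F P = (\<lambda>w. \<Sum>k\<le>length w. fps_nth F k * s_power P k w)"

text \<open>Powers beyond the length of w vanish at w, so every cut-off from the length on gives
  F(P) there. A common cut-off for all pieces of a word lets identities in one variable pass to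
  non-commuting letters.\<close>

lemma s_subst_eq:
  assumes "P [] = 0" "length w \<le> n"
  shows "s_subst F P w = (\<Sum>k\<le>n. fps_nth F k * s_power P k w)"
  unfolding s_subst_def using assms s_power_eq_0[of P w]
  by (intro sum.mono_neutral_left) auto

lemma s_subst_mult:
  assumes "P [] = 0"
  shows "s_subst (F * H) P = s_mult (s_subst F P) (s_subst H P)"
proof
  fix w :: "'a word"
  let ?n = "length w"
  have "s_mult (s_subst F P) (s_subst H P) w = (\<Sum>k\<le>?n. (\<Sum>i\<le>?n. fps_nth F i * s_power P i (take k w)) *
      (\<Sum>j\<le>?n. fps_nth H j * s_power P j (drop k w)))"
    unfolding s_mult_def by (intro sum.cong refl) (subst (1 2) s_subst_eq[where n = ?n], auto simp: assms)
  also have "\<dots> = (\<Sum>k\<le>?n. \<Sum>i\<le>?n. \<Sum>j\<le>?n. fps_nth F i * fps_nth H j *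
      (s_power P i (take k w) * s_power P j (drop k w)))"
    by (simp add: sum_product mult_ac)
  also have "\<dots> = (\<Sum>i\<le>?n. \<Sum>k\<le>?n. \<Sum>j\<le>?n. fps_nth F i * fps_nth H j *
      (s_power P i (take k w) * s_power P j (drop k w)))"
    by (rule sum.swap)
  also have "\<dots> = (\<Sum>i\<le>?n. \<Sum>j\<le>?n. \<Sum>k\<le>?n. fps_nth F i * fps_nth H j *
      (s_power P i (take k w) * s_power P j (drop k w)))"
    by (intro sum.cong refl sum.swap)
  also have "\<dots> = (\<Sum>i\<le>?n. \<Sum>j\<le>?n. fps_nth F i * fps_nth H j * s_power P (i + j) w)"
    by (simp add: s_power_add s_mult_def sum_distrib_left)
  also have "\<dots> = (\<Sum>(i,j)\<in>{..?n} \<times> {..?n}. fps_nth F i * fps_nth H j * s_power P (i + j) w)"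
    by (simp add: sum.cartesian_product)
  \<comment> \<open>The square shrinks to the triangle: a power above the length of w vanishes at
    w.\<close>
  also have "\<dots> = (\<Sum>(i,j)\<in>{(i,j). i + j \<le> ?n}. fps_nth F i * fps_nth H j * s_power P (i + j) w)"
    using s_power_eq_0[of P w] assms by (intro sum.mono_neutral_right) (auto, meson not_le)
  also have "\<dots> = (\<Sum>k\<le>?n. \<Sum>i\<le>k. fps_nth F i * fps_nth H (k - i) * s_power P k w)"
    unfolding sum.triangle_reindex_eq by (intro sum.cong refl) auto
  also have "\<dots> = s_subst (F * H) P w"
    by (simp add: s_subst_def fps_mult_nth sum_distrib_right atLeast0AtMost)
  finally show "s_subst (F * H) P w = s_mult (s_subst F P) (s_subst H P) w" ..
qed

lemma s_subst_1 [simp]: "s_subst 1 P = s_one"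
proof
  fix w
  have "s_subst 1 P w = (\<Sum>k\<le>length w. if k = 0 then s_power P k w else 0)"
    unfolding s_subst_def by (intro sum.cong) auto
  then show "s_subst 1 P w = s_one w"
    by (simp add: sum.delta)
qed

lemma s_subst_power:
  assumes "P [] = 0"
  shows "s_subst (F ^ n) P = s_power (s_subst F P) n"
  by (induction n) (simp_all add: s_subst_mult[of P, OF assms])

lemma s_subst_compose:
  assumes P: "P [] = 0" and H: "fps_nth H 0 = 0"
  shows "s_subst F (s_subst H P) = s_subst (F oo H) P"
proof
  fix w :: "'a word"
  let ?n = "length w"
  have "s_subst F (s_subst H P) w = (\<Sum>k\<le>?n. fps_nth F k * (\<Sum>j\<le>?n. fps_nth (H ^ k) j * s_power P j w))"
  proof -
    have "s_power (s_subst H P) k w = (\<Sum>j\<le>?n. fps_nth (H ^ k) j * s_power P j w)" for k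
      by (simp add: s_subst_power[of P, OF P, symmetric]) (simp add: s_subst_def)
    then show ?thesis
      by (simp add: s_subst_def[of F])
  qed
  also have "\<dots> = (\<Sum>j\<le>?n. (\<Sum>k\<le>?n. fps_nth F k * fps_nth (H ^ k) j) * s_power P j w)"
    unfolding sum_distrib_left sum_distrib_right by (subst sum.swap) (simp add: mult_ac)
  also have "\<dots> = (\<Sum>j\<le>?n. fps_nth (F oo H) j * s_power P j w)"
  proof (intro sum.cong refl arg_cong2[where f = "(*)"])
    fix j assume "j \<in> {..?n}"
    \<comment> \<open>\<open>fps_compose\<close> stops at k = j; larger k add nothing because H^k
      starts in degree k.\<close>
    then show "(\<Sum>k\<le>?n. fps_nth F k * fps_nth (H ^ k) j) = fps_nth (F oo H) j"
      unfolding fps_compose_nth using startsby_zero_power_prefix[OF H]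
      by (intro sum.mono_neutral_right) auto
  qed
  finally show "s_subst F (s_subst H P) w = s_subst (F oo H) P w"
    by (simp add: s_subst_def)
qed

lemma s_exp_eq_s_subst:
  assumes "P [] = 0"
  shows "s_exp P = s_subst (fps_exp 1) P"
proof
  fix w
  have "s_exp P w = (\<Sum>k\<le>length w. s_power P k w / fact k)"
    unfolding s_exp_def using s_power_eq_0[of P, OF assms, of w] by (intro suminf_finite) auto
  then show "s_exp P w = s_subst (fps_exp 1) P w"
    by (simp add: s_subst_def)
qed

lemma s_log_eq_s_subst:
  assumes "Q [] = 1"
  shows "s_log Q = s_subst (fps_ln 1) (\<lambda>w. Q w - s_one w)"
proof
  fix w
  let ?Q = "\<lambda>w. Q w - s_one w"
  have 0: "?Q [] = 0"
    by (simp add: assms)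
  have "s_log Q w = (\<Sum>k\<le>length w. (-1) ^ k * s_power ?Q (Suc k) w / real (Suc k))"
    unfolding s_log_def
    by (intro suminf_finite) (auto simp: s_power_eq_0[of ?Q, OF 0] simp del: s_power.simps)
  \<comment> \<open>The sum in \<open>s_log\<close> starts at the first power; the added index 0 has
    coefficient 0 in \<open>fps_ln 1\<close>.\<close>
  also have "\<dots> = (\<Sum>k\<le>Suc (length w). fps_nth (fps_ln 1) k * s_power ?Q k w)"
    by (simp add: sum.atMost_Suc_shift fps_ln_nth del: s_power.simps sum.atMost_Suc)
  also have "\<dots> = s_subst (fps_ln 1) ?Q w"
    using 0 by (subst s_subst_eq[where n = "Suc (length w)"]) auto
  finally show "s_log Q w = s_subst (fps_ln 1) ?Q w" .
qed

lemma s_subst_one_plus_X: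
  assumes "P [] = 0"
  shows "s_subst (1 + fps_X) P = (\<lambda>w. s_one w + P w)"
proof
  fix w
  have "s_subst (1 + fps_X) P w = (\<Sum>k\<le>Suc (length w). fps_nth (1 + fps_X) k * s_power P k w)"
    by (rule s_subst_eq) (simp_all add: assms)
  also have "\<dots> = s_one w + P w"
    by (subst sum.mono_neutral_right[of _ "{..1}"]) (auto simp: fps_X_def)
  finally show "s_subst (1 + fps_X) P w = s_one w + P w" .
qed

lemma s_log_Nil: "Q [] = 1 \<Longrightarrow> s_log Q [] = 0"
  by (simp add: s_log_eq_s_subst s_subst_def)

text \<open>\<open>fps_ln 1\<close> expands ln(1 + X) and is the compositional inverse of
  \<open>fps_exp 1 - 1\<close>. The identity exp(ln(1 + X)) = 1 + X is evaluated at X = Q -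
  1.\<close>

lemma s_exp_s_log:
  assumes "Q [] = 1"
  shows "s_exp (s_log Q) = Q"
proof -
  let ?Q = "\<lambda>w. Q w - s_one w"
  have 0: "?Q [] = 0"
    by (simp add: assms)
  have "fps_exp 1 oo fps_ln 1 = ((1 + fps_X) :: real fps)"
  proof -
    have "(fps_exp 1 - 1) oo fps_ln 1 = (fps_X :: real fps)"
      using fps_inv_fps_exp_compose(2)[of "1::real"] by (simp add: fps_ln_fps_exp_inv)
    then show ?thesis
      by (simp add: fps_compose_sub_distrib algebra_simps)
  qed
  then have "s_exp (s_log Q) = s_subst (1 + fps_X) ?Q"
    using 0 s_log_Nil[of Q, OF assms]
    by (simp add: s_exp_eq_s_subst s_log_eq_s_subst[of Q, OF assms] s_subst_compose)
  then show ?thesis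
    by (simp add: s_subst_one_plus_X[of ?Q, OF 0])
qed

section \<open>Shuffles, primitive and group-like series\<close>

text \<open>\<open>sh P u v\<close> sums \<open>P\<close> over the shuffles of \<open>u\<close> and \<open>v\<close> with multiplicity: it is the
  \<open>(u, v)\<close>-coefficient of the coproduct of \<open>P\<close> for which letters are primitive.\<close>

fun sh :: "'d series \<Rightarrow> 'd word \<Rightarrow> 'd word \<Rightarrow> real" where
  "sh P [] v = P v"
| "sh P (a # u) [] = P (a # u)"
| "sh P (a # u) (b # v) = sh (\<lambda>w. P (a # w)) u (b # v) + sh (\<lambda>w. P (b # w)) (a # u) v"

lemma sh_Nil_right [simp]: "sh P u [] = P u"
  by (cases u) simp_all

text \<open>Shuffles preserve length and weight, so a series may be replaced by one that agrees with
  it only on words of the relevant size.\<close>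

lemma sh_cong: "(\<And>w. w \<in> shuffles u v \<Longrightarrow> P w = Q w) \<Longrightarrow> sh P u v = sh Q u v"
proof (induction P u v arbitrary: Q rule: sh.induct)
  case (3 P a u b v)
  have "sh (\<lambda>w. P (a # w)) u (b # v) = sh (\<lambda>w. Q (a # w)) u (b # v)"
    by (rule 3) (simp add: 3)
  moreover have "sh (\<lambda>w. P (b # w)) (a # u) v = sh (\<lambda>w. Q (b # w)) (a # u) v"
    by (rule 3) (simp add: 3)
  ultimately show ?case
    by simp
qed simp_all

lemma sh_add: "sh (\<lambda>w. P w + Q w) u v = sh P u v + sh Q u v"
  by (induction P u v arbitrary: Q rule: sh.induct) simp_all

lemma sh_scale: "sh (\<lambda>w. c * P w) u v = c * sh P u v"
  by (induction P u v rule: sh.induct) (simp_all add: algebra_simps)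

lemma sh_zero [simp]: "sh (\<lambda>w. 0) u v = 0"
  using sh_scale[of 0 "\<lambda>w. 0" u v] by simp

lemma sh_sum: "sh (\<lambda>w. \<Sum>i\<in>I. P i w) u v = (\<Sum>i\<in>I. sh (P i) u v)"
  by (induction I rule: infinite_finite_induct) (simp_all add: sh_add)

text \<open>Multiplicativity of the coproduct: a cut of a shuffle of u and v cuts u and v, and each
  side is a shuffle of the corresponding pieces.\<close>

lemma sh_mult:
  "sh (s_mult P Q) u v =
    (\<Sum>i\<le>length u. \<Sum>j\<le>length v. sh P (take i u) (take j v) * sh Q (drop i u) (drop j v))"
proof (induction P u v rule: sh.induct)
  case (1 P v)
  then show ?case by (simp add: s_mult_def)
next
  case (2 P a u)
  show ?case by (simp add: s_mult_def)
next
  case (3 P a u b v)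
  let ?Pa = "\<lambda>w. P (a # w)" and ?Pb = "\<lambda>w. P (b # w)"
  \<comment> \<open>\<open>T\<close> is the summand of the claim. \<open>A\<close> and
    \<open>B\<close> are the summands after the left piece of the shuffle has lost its first letter,
    taken from \<open>a # u\<close> or from \<open>b # v\<close>. By the recursion of
    \<open>sh\<close>, \<open>T\<close> is a sum of both kinds inside the index rectangle; on its
    edges only one kind occurs.\<close>
  define A where "A i j = sh ?Pa (take i u) (take j (b # v)) * sh Q (drop i u) (drop j (b # v))" for i j
  define B where "B i j = sh ?Pb (take i (a # u)) (take j v) * sh Q (drop i (a # u)) (drop j v)" for i j
  define T where "T i j = sh P (take i (a # u)) (take j (b # v)) * sh Q (drop i (a # u)) (drop j (b # v))" for i j
  let ?m = "length u" and ?n = "length v"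
  have T00: "T 0 0 = P [] * sh Q (a # u) (b # v)"
    by (simp add: T_def)
  have T0: "T 0 (Suc j) = B 0 j" "T (Suc i) 0 = A i 0" for i j
    by (simp_all add: T_def A_def B_def)
  have TS: "T (Suc i) (Suc j) = A i (Suc j) + B (Suc i) j" for i j
    by (simp add: T_def A_def B_def algebra_simps)
  have "sh (s_mult P Q) (a # u) (b # v) = P [] * sh Q (a # u) (b # v) +
      (\<Sum>i\<le>?m. \<Sum>j\<le>Suc ?n. A i j) + (\<Sum>i\<le>Suc ?m. \<Sum>j\<le>?n. B i j)"
    using 3 by (simp add: s_mult_Cons sh_add sh_scale A_def B_def algebra_simps
        del: sum.atMost_Suc)
  also have "\<dots> = (\<Sum>i\<le>Suc ?m. \<Sum>j\<le>Suc ?n. T i j)"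
    unfolding sum.atMost_Suc_shift[of _ ?m] sum.atMost_Suc_shift[of _ ?n]
    by (simp add: T00 T0 TS sum.distrib)
  finally show ?case
    by (simp add: T_def del: sum.atMost_Suc)
qed

definition primitive :: "'d series \<Rightarrow> bool" where
  "primitive P \<longleftrightarrow> (\<forall>u v. sh P u v = s_one u * P v + P u * s_one v)"

text \<open>The condition at the empty word excludes only the zero series.\<close>

definition grouplike :: "'d series \<Rightarrow> bool" where
  "grouplike G \<longleftrightarrow> G [] = 1 \<and> (\<forall>u v. sh G u v = G u * G v)"

lemma primitive_Nil: "primitive P \<Longrightarrow> P [] = 0"
  unfolding primitive_def using sh.simps(1)[of P "[]"] s_one_Nil by (metis add_cancel_right_left mult.left_neutral mult.right_neutral)

text \<open>The coproduct of P Q is that of Q multiplied by 1 (x) P + P (x) 1, so P acts on one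
  tensor factor at a time.\<close>

lemma sh_mult_primitive:
  assumes "primitive P"
  shows "sh (s_mult P Q) u v = s_mult P (sh Q u) v + s_mult P (\<lambda>u'. sh Q u' v) u"
proof -
  have 1: "(\<Sum>i\<le>length w. s_one (take i w) * f i) = f 0" for w :: "'a word" and f :: "nat \<Rightarrow> real"
    by (cases w) (simp_all add: sum.atMost_Suc_shift del: sum.atMost_Suc)
  have "sh (s_mult P Q) u v =
      (\<Sum>i\<le>length u. s_one (take i u) * (\<Sum>j\<le>length v. P (take j v) * sh Q (drop i u) (drop j v))) +
      (\<Sum>i\<le>length u. \<Sum>j\<le>length v. s_one (take j v) * (P (take i u) * sh Q (drop i u) (drop j v)))"
    using assms unfolding sh_mult primitive_def
    by (simp add: algebra_simps sum.distrib sum_distrib_left)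
  then show ?thesis
    by (simp only: 1) (simp add: s_mult_def)
qed

lemma primitive_add: "primitive P \<Longrightarrow> primitive Q \<Longrightarrow> primitive (\<lambda>w. P w + Q w)"
  by (simp add: primitive_def sh_add algebra_simps)

lemma primitive_scale: "primitive P \<Longrightarrow> primitive (\<lambda>w. c * P w)"
  by (simp add: primitive_def sh_scale algebra_simps)

lemma primitive_sum: "(\<And>i. i \<in> I \<Longrightarrow> primitive (P i)) \<Longrightarrow> primitive (\<lambda>w. \<Sum>i\<in>I. P i w)"
  by (simp add: primitive_def sh_sum sum.distrib sum_distrib_left sum_distrib_right)

text \<open>A shuffle of two non-empty words has at least two letters.\<close>

lemma primitive_letter: "primitive (monomial [a])"
proof -
  have "sh (monomial [a]) u v = 0" if "u \<noteq> []" "v \<noteq> []" for u v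
  proof -
    have "monomial [a] w = 0" if "w \<in> shuffles u v" for w
      using length_shuffles[OF that] \<open>u \<noteq> []\<close> \<open>v \<noteq> []\<close> by (cases u; cases v) (auto simp: monomial_def)
    then show ?thesis
      using sh_cong[of u v "monomial [a]" "\<lambda>w. 0"] by simp
  qed
  then have "sh (monomial [a]) u v = s_one u * monomial [a] v + monomial [a] u * s_one v" for u v
    by (cases "u = []"; cases "v = []") (simp_all add: s_one_def monomial_def)
  then show ?thesis
    by (simp add: primitive_def)
qed

text \<open>The mixed terms \<open>P v * Q u + P u * Q v\<close> in the coproduct of P Q are
  symmetric in P and Q and cancel in the bracket.\<close>

lemma primitive_bracket:
  assumes P: "primitive P" and Q: "primitive Q"
  shows "primitive (s_bracket P Q)"
proof -
  have *: "sh (s_mult P Q) u v = s_one u * s_mult P Q v + P v * Q u + P u * Q v + s_mult P Q u * s_one v"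
    if "primitive P" "primitive Q" for P Q :: "'a series" and u v
  proof -
    have "sh Q u = (\<lambda>w. s_one u * Q w + Q u * s_one w)"
        "(\<lambda>w. sh Q w v) = (\<lambda>w. Q v * s_one w + s_one v * Q w)"
      using that(2) by (simp_all add: primitive_def fun_eq_iff)
    then show ?thesis
      by (simp add: sh_mult_primitive[OF that(1)] s_mult_add_right s_mult_scale_right)
  qed
  have "s_bracket P Q = (\<lambda>w. s_mult P Q w + (-1) * s_mult Q P w)"
    by (simp add: s_bracket_def)
  then have "sh (s_bracket P Q) u v = sh (s_mult P Q) u v + (-1) * sh (s_mult Q P) u v" for u v
    by (simp only: sh_add sh_scale)
  then show ?thesis
    by (simp add: primitive_def *[OF P Q] *[OF Q P]) (simp add: s_bracket_def algebra_simps)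
qed

lemma primitive_lie_polynomials: "P \<in> lie_polynomials \<Longrightarrow> primitive P"
  by (induction rule: lie_polynomials.induct)
    (auto intro: primitive_letter primitive_add primitive_scale primitive_bracket simp: primitive_def[of "\<lambda>w. 0"])

text \<open>The coproduct preserves the weight.\<close>

lemma primitive_filter_wdeg:
  assumes "primitive P"
  shows "primitive (\<lambda>w. if A (wdeg w) then P w else 0)"
proof -
  have "sh (\<lambda>w. if A (wdeg w) then P w else 0) u v =
      s_one u * (if A (wdeg v) then P v else 0) + (if A (wdeg u) then P u else 0) * s_one v" for u v
  proof -
    have "sh (\<lambda>w. if A (wdeg w) then P w else 0) u v =
        sh (\<lambda>w. (if A (wdeg u + wdeg v) then 1 else 0) * P w) u v"
      by (rule sh_cong) (simp add: wdeg_shuffles)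
    also have "\<dots> = (if A (wdeg u + wdeg v) then s_one u * P v + P u * s_one v else 0)"
      using assms by (simp add: sh_scale primitive_def)
    finally show ?thesis
      by (cases u; cases v) (auto simp: primitive_Nil[OF assms])
  qed
  then show ?thesis
    by (simp add: primitive_def)
qed

lemma primitive_lie_series:
  assumes "P \<in> lie_series" "finite (support P)"
  shows "primitive P"
proof -
  define n where "n = Max (insert 0 (length ` support P))"
  have n: "length w \<le> n" if "P w \<noteq> 0" for w
    unfolding n_def using assms(2) that by (intro Max_ge) (auto simp: support_def)
  have "P w = (\<Sum>k\<le>n. hom_component k P w)" for w
    using n[of w] by (auto simp: hom_component_def)
  then have "P = (\<lambda>w. \<Sum>k\<le>n. hom_component k P w)"
    by blast
  moreover have "primitive (\<lambda>w. \<Sum>k\<le>n. hom_component k P w)"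
    using assms(1) by (intro primitive_sum primitive_lie_polynomials) (simp add: lie_series_def)
  ultimately show ?thesis
    by simp
qed

section \<open>Group-like series\<close>

lemma grouplike_one: "grouplike (s_one :: 'd series)"
proof -
  have "sh s_one u v = 0" if "u \<noteq> [] \<or> v \<noteq> []" for u v :: "'d word"
  proof -
    have "s_one w = 0" if "w \<in> shuffles u v" for w
      using length_shuffles[OF that] \<open>u \<noteq> [] \<or> v \<noteq> []\<close> by (cases w) auto
    then show ?thesis
      using sh_cong[of u v s_one "\<lambda>w. 0"] by simp
  qed
  then have "sh s_one u v = s_one u * s_one v" for u v :: "'d word"
    by (cases u; cases v) auto
  then show ?thesis
    by (simp add: grouplike_def)
qed

lemma grouplike_mult:
  assumes "grouplike G" "grouplike H"
  shows "grouplike (s_mult G H)"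
  using assms unfolding grouplike_def sh_mult
  by (auto simp: s_mult_def sum_product mult_ac)

lemma grouplike_power: "grouplike G \<Longrightarrow> grouplike (s_power G n)"
  by (induction n) (simp_all add: grouplike_one grouplike_mult)

text \<open>The divided powers p_n = P^n / n! obey the binomial law: the coproduct of p_n is the sum
  of p_k (x) p_(n-k). The induction multiplies by P, using P p_n = (n + 1) p_(n+1). P acts on either
  tensor factor, and the resulting coefficients n + 1 - k and k add up to n + 1.\<close>

lemma grouplike_exp:
  assumes P: "primitive P"
  shows "grouplike (s_exp P)"
proof -
  define p where "p n w = s_power P n w / fact n" for n w
  have P0: "P [] = 0"
    using P by (rule primitive_Nil)
  have p_Suc: "s_mult P (p n) = (\<lambda>w. real (Suc n) * p (Suc n) w)" for n
  proof -
    have "p n = (\<lambda>w. (1 / fact n) * s_power P n w)"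
      by (simp add: p_def fun_eq_iff)
    then show ?thesis
      by (simp only: s_mult_scale_right) (simp add: p_def fun_eq_iff del: of_nat_Suc)
  qed
  have p0: "p 0 = s_one"
    by (simp add: p_def fun_eq_iff)
  have sh_p: "sh (p n) u v = (\<Sum>k\<le>n. p k u * p (n - k) v)" for n u v
  proof (induction n arbitrary: u v)
    case 0
    then show ?case using grouplike_one[where ?'d = 'a] by (simp add: p0 grouplike_def)
  next
    case (Suc n)
    let ?c = "\<lambda>k. p k u * p (Suc n - k) v"
    have "real (Suc n) * sh (p (Suc n)) u v = sh (s_mult P (p n)) u v"
      by (simp only: p_Suc sh_scale)
    also have "\<dots> = (\<Sum>k\<le>n. p k u * s_mult P (p (n - k)) v) + (\<Sum>k\<le>n. s_mult P (p k) u * p (n - k) v)"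
    proof -
      have *: "sh (p n) u = (\<lambda>w. \<Sum>k\<le>n. p k u * p (n - k) w)"
        "(\<lambda>w. sh (p n) w v) = (\<lambda>w. \<Sum>k\<le>n. p (n - k) v * p k w)"
        by (simp_all add: Suc fun_eq_iff mult.commute)
      show ?thesis
        by (simp only: sh_mult_primitive[OF P] * s_mult_sum_right s_mult_scale_right)
          (simp add: mult.commute)
    qed
    also have "(\<Sum>k\<le>n. p k u * s_mult P (p (n - k)) v) = (\<Sum>k\<le>Suc n. real (Suc n - k) * ?c k)"
      by (simp add: p_Suc Suc_diff_le algebra_simps)
    also have "(\<Sum>k\<le>n. s_mult P (p k) u * p (n - k) v) = (\<Sum>k\<le>Suc n. real k * ?c k)"
      by (simp add: sum.atMost_Suc_shift p_Suc mult_ac del: sum.atMost_Suc)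
    also have "(\<Sum>k\<le>Suc n. real (Suc n - k) * ?c k) + (\<Sum>k\<le>Suc n. real k * ?c k) =
        real (Suc n) * (\<Sum>k\<le>Suc n. ?c k)"
      unfolding sum.distrib[symmetric] sum_distrib_left
      by (intro sum.cong refl) (auto simp: of_nat_diff algebra_simps)
    finally show ?case
      using mult_left_cancel[of "real (Suc n)"] of_nat_neq_0 by blast
  qed
  have exp_eq: "s_exp P w = (\<Sum>k\<le>N. p k w)" if "length w \<le> N" for w N
    using that by (simp add: s_exp_eq_s_subst s_subst_eq[of P, OF P0 that] P0 p_def)
  have "sh (s_exp P) u v = s_exp P u * s_exp P v" for u v
  proof -
    let ?N = "length u + length v"
    have "sh (s_exp P) u v = sh (\<lambda>w. \<Sum>n\<le>?N. p n w) u v"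
      by (rule sh_cong) (auto intro!: exp_eq dest: length_shuffles)
    also have "\<dots> = (\<Sum>n\<le>?N. \<Sum>k\<le>n. p k u * p (n - k) v)"
      by (simp add: sh_sum sh_p)
    also have "\<dots> = (\<Sum>(i,j)\<in>{(i,j). i + j \<le> ?N}. p i u * p j v)"
      by (simp add: sum.triangle_reindex_eq)
    \<comment> \<open>Outside the rectangle one power exceeds the length of its word and
      vanishes.\<close>
    also have "\<dots> = (\<Sum>(i,j)\<in>{..length u} \<times> {..length v}. p i u * p j v)"
    proof (rule sum.mono_neutral_right)
      show "finite {(i, j). i + j \<le> ?N}"
        by (rule finite_subset[of _ "{..?N} \<times> {..?N}"]) auto
      show "\<forall>i\<in>{(i, j). i + j \<le> ?N} - {..length u} \<times> {..length v}. (case i of (i, j) \<Rightarrow> p i u * p j v) = 0"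
        using s_power_eq_0[of P, OF P0] by (auto simp: p_def) (meson not_le)+
    qed auto
    also have "\<dots> = s_exp P u * s_exp P v"
      by (simp add: exp_eq[OF order_refl] sum_product sum.cartesian_product)
    finally show ?thesis .
  qed
  moreover have "s_exp P [] = 1"
    using exp_eq[of "[]" 0] by (simp add: p_def)
  ultimately show ?thesis
    by (simp add: grouplike_def)
qed

lemma grouplike_exp_product:
  "(\<And>i. i \<in> {1..k} \<Longrightarrow> primitive (Z i)) \<Longrightarrow> grouplike (exp_product Z k)"
  by (induction k) (auto intro!: grouplike_one grouplike_mult grouplike_exp)

section \<open>Logarithms of group-like series\<close>

definition gbinomial_poly :: "nat \<Rightarrow> real poly" where
  "gbinomial_poly k = smult (1 / fact k) (\<Prod>i<k. [:- real i, 1:])"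

lemma poly_gbinomial_poly: "poly (gbinomial_poly k) x = x gchoose k"
  by (simp add: gbinomial_poly_def gbinomial_prod_rev poly_prod atLeast0LessThan)

text \<open>(1 + X)^x = exp(x ln(1 + X)), and its part linear in x is ln(1 + X). In the proof the
  root 0 is split off; the roots 1, ..., n contribute (-1)^n n!, to be divided by (n + 1)!.\<close>

lemma coeff_gbinomial_poly:
  "coeff (gbinomial_poly k) 0 = (if k = 0 then 1 else 0)"
  "coeff (gbinomial_poly k) 1 = fps_nth (fps_ln 1) k"
proof -
  show "coeff (gbinomial_poly k) 0 = (if k = 0 then 1 else 0)"
    by (cases k) (simp_all add: poly_0_coeff_0[symmetric] poly_gbinomial_poly)
  show "coeff (gbinomial_poly k) 1 = fps_nth (fps_ln 1) k"
  proof (cases k)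
    case 0
    then show ?thesis by (simp add: gbinomial_poly_def)
  next
    case (Suc n)
    have "(\<Prod>i<Suc n. [:- real i, 1:]) = [:0, 1:] * (\<Prod>i<n. [:- real (Suc i), 1:])"
      by (simp add: prod.lessThan_Suc_shift del: prod.lessThan_Suc)
    then have "coeff (\<Prod>i<Suc n. [:- real i, 1:]) 1 = coeff (\<Prod>i<n. [:- real (Suc i), 1:]) 0"
      by simp
    also have "\<dots> = (-1) ^ n * fact n"
      by (induction n) (simp_all add: poly_0_coeff_0[symmetric] algebra_simps)
    finally show ?thesis
      by (simp add: gbinomial_poly_def Suc fps_ln_nth)
  qed
qed

text \<open>The powers \<open>G\<^sup>n = \<Sum>\<^sub>k (n choose k) (G - 1)\<^sup>k\<close> of a group-like series are group-like.
  Both sides of this condition are polynomials in \<open>n\<close>, and their linear coefficients say that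
  the logarithm is primitive.\<close>

lemma primitive_log:
  assumes G: "grouplike G"
  shows "primitive (s_log G)"
proof -
  define Q where "Q w = G w - s_one w" for w
  have Q0: "Q [] = 0"
    using G by (simp add: Q_def grouplike_def)
  have log: "s_log G = s_subst (fps_ln 1) Q"
    using G unfolding Q_def by (intro s_log_eq_s_subst) (simp add: grouplike_def)
  have pow: "s_power G n w = (\<Sum>k\<le>N. poly (gbinomial_poly k) (real n) * s_power Q k w)"
    if "length w \<le> N" for n w N
  proof -
    have "s_power G n = s_subst ((1 + fps_X) ^ n) Q"
      by (simp add: s_subst_power[of Q, OF Q0] s_subst_one_plus_X[of Q, OF Q0]) (simp add: Q_def)
    then show ?thesis
      using that by (simp add: s_subst_eq[of Q, OF Q0] poly_gbinomial_poly
          fps_binomial_of_nat[symmetric])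
  qed
  have "sh (s_log G) u v = s_one u * s_log G v + s_log G u * s_one v" for u v
  proof -
    let ?N = "length u + length v"
    \<comment> \<open>\<open>p F\<close> is a polynomial that at n equals the sum of (n choose k) F
      k. The choices of F below give coefficients of G^n and of its coproduct.\<close>
    define p where "p F = (\<Sum>k\<le>?N. smult (F k) (gbinomial_poly k))" for F
    let ?pu = "p (\<lambda>k. s_power Q k u)" and ?pv = "p (\<lambda>k. s_power Q k v)"
      and ?ps = "p (\<lambda>k. sh (s_power Q k) u v)"
    have poly_p: "poly (p F) x = (\<Sum>k\<le>?N. poly (gbinomial_poly k) x * F k)" for F x
      by (simp add: p_def poly_sum mult_ac)
    have "poly ?ps (real n) = poly (?pu * ?pv) (real n)" for n
    proof -
      have "poly ?ps (real n) = sh (\<lambda>w. \<Sum>k\<le>?N. poly (gbinomial_poly k) (real n) * s_power Q k w) u v"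
        by (simp add: sh_sum sh_scale poly_p)
      also have "\<dots> = sh (s_power G n) u v"
        by (rule sh_cong) (auto intro!: pow[symmetric] dest: length_shuffles)
      also have "\<dots> = s_power G n u * s_power G n v"
        using grouplike_power[OF G, of n] by (simp add: grouplike_def)
      also have "\<dots> = poly (?pu * ?pv) (real n)"
        by (simp add: poly_p pow[where N = ?N])
      finally show ?thesis .
    qed
    then have "range real \<subseteq> {x. poly (?ps - ?pu * ?pv) x = 0}"
      by auto
    then have "infinite {x. poly (?ps - ?pu * ?pv) x = 0}"
      using finite_subset infinite_UNIV_nat finite_imageD[of real UNIV] by (metis inj_of_nat)
    then have "?ps = ?pu * ?pv"
      using poly_roots_finite[of "?ps - ?pu * ?pv"] by auto
    then have "coeff ?ps 1 = coeff (?pu * ?pv) 1"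
      by simp
    also have "\<dots> = coeff ?pu 0 * coeff ?pv 1 + coeff ?pu 1 * coeff ?pv 0"
      by (simp add: coeff_mult)
    finally have *: "coeff ?ps 1 = coeff ?pu 0 * coeff ?pv 1 + coeff ?pu 1 * coeff ?pv 0" .
    \<comment> \<open>Only k = 0 has a constant coefficient, and \<open>s_power Q 0\<close> is
      \<open>s_one\<close>; the linear coefficients are those of the logarithm. The product rule for
      the linear coefficient of \<open>?pu * ?pv\<close> thus becomes primitivity.\<close>
    have c0: "coeff (p F) 0 = F 0" and c1: "coeff (p F) 1 = (\<Sum>k\<le>?N. fps_nth (fps_ln 1) k * F k)" for F
      by (simp_all add: p_def coeff_sum coeff_gbinomial_poly if_distrib sum.delta mult_ac cong: if_cong
          del: One_nat_def)
    have log_eq: "s_log G w = (\<Sum>k\<le>?N. fps_nth (fps_ln 1) k * s_power Q k w)" if "length w \<le> ?N" for w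
      unfolding log by (rule s_subst_eq[of Q, OF Q0 that])
    have "sh (s_log G) u v = sh (\<lambda>w. \<Sum>k\<le>?N. fps_nth (fps_ln 1) k * s_power Q k w) u v"
      by (rule sh_cong) (auto intro!: log_eq dest: length_shuffles)
    then show ?thesis
      using *[unfolded c0 c1] by (simp add: sh_sum sh_scale log_eq)
  qed
  then show ?thesis
    by (simp add: primitive_def)
qed

section \<open>Primitive polynomials are Lie polynomials\<close>

primrec lie_bracketing :: "'d word \<Rightarrow> 'd series" where
  "lie_bracketing [] = (\<lambda>w. 0)"
| "lie_bracketing (a # w) = (if w = [] then monomial [a] else s_bracket (monomial [a]) (lie_bracketing w))"

lemma lie_bracketing_in_lie_polynomials: "lie_bracketing w \<in> lie_polynomials"
  by (induction w) (auto intro: lie_polynomials.intros)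

lemma monomial_letter_Nil [simp]: "monomial [a] [] = 0"
  by (simp add: monomial_def)

lemma lie_bracketing_eq_0: "length x \<noteq> length w \<Longrightarrow> lie_bracketing w x = 0"
proof (induction w arbitrary: x)
  case (Cons a w)
  have "s_mult (monomial [a]) (lie_bracketing w) x = 0"
    using Cons by (cases x) (auto simp: s_mult_letter_left)
  moreover have "s_mult (lie_bracketing w) (monomial [a]) x = 0"
    using Cons by (cases x rule: rev_cases) (auto simp: s_mult_letter_right)
  ultimately show ?case
    using Cons.prems by (auto simp: s_bracket_def monomial_def)
qed simp

text \<open>For \<open>f = (\<lambda>i. 1)\<close> the following sum is the convolution of the identity with the antipode,
  and for \<open>f = id\<close> the convolution of the derivation \<open>w \<mapsto> |w| w\<close> with the antipode, which is
  right-normed bracketing (Dynkin's formula).\<close>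

definition antipode_conv :: "(nat \<Rightarrow> real) \<Rightarrow> 'd series \<Rightarrow> 'd word \<Rightarrow> real" where
  "antipode_conv f P x =
    (\<Sum>i\<le>length x. f i * (-1) ^ (length x - i) * sh P (take i x) (rev (drop i x)))"

text \<open>A shuffle of a prefix of x with the reversal of the rest starts with the first or with
  the last letter of x. Removing that letter leaves the same situation for \<open>tl x\<close>, with
  i shifted, or for \<open>butlast x\<close>, with the sign reversed.\<close>

lemma antipode_conv_rec:
  assumes "x \<noteq> []"
  shows "antipode_conv f P x = antipode_conv (\<lambda>i. f (Suc i)) (\<lambda>w. P (hd x # w)) (tl x)
    - antipode_conv f (\<lambda>w. P (last x # w)) (butlast x)"
proof -
  define n where "n = length x - 1"
  have len: "length x = Suc n"
    using assms by (cases x) (auto simp: n_def)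
  let ?Pa = "\<lambda>w. P (hd x # w)" and ?Pb = "\<lambda>w. P (last x # w)"
  define A where "A i = sh ?Pa (take i (tl x)) (rev (drop i (tl x)))" for i
  define B where "B i = sh ?Pb (take i (butlast x)) (rev (drop i (butlast x)))" for i
  define T where "T i = sh P (take i x) (rev (drop i x))" for i
  have T_Suc: "T (Suc i) = A i + B (Suc i)" if "i < n" for i
  proof -
    have "take (Suc i) x = hd x # take i (tl x)"
      using assms by (cases x) auto
    moreover have "rev (drop (Suc i) x) = last x # rev (drop (Suc i) (butlast x))"
    proof -
      have "drop (Suc i) x = drop (Suc i) (butlast x) @ [last x]"
        using that len by (subst (1) append_butlast_last_id[OF assms, symmetric]) (simp del: append_butlast_last_id)
      then show ?thesis by simp
    qed
    moreover have "take (Suc i) x = take (Suc i) (butlast x)"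
      using that len by (simp add: take_butlast)
    moreover have "rev (drop (Suc i) x) = rev (drop i (tl x))"
      by (simp add: drop_Suc)
    ultimately show ?thesis
      unfolding T_def A_def B_def by (metis sh.simps(3))
  qed
  \<comment> \<open>At the two ends one of the shuffled words is empty, and only one first letter is
    possible.\<close>
  have T_0: "T 0 = B 0"
    using assms by (cases x rule: rev_cases) (simp_all add: T_def B_def)
  have T_n: "T (Suc n) = A n"
    using assms len by (cases x) (simp_all add: T_def A_def)
  have "antipode_conv f P x = f 0 * (-1) ^ Suc n * T 0 + (\<Sum>i<n. f (Suc i) * (-1) ^ (n - i) * T (Suc i))
      + f (Suc n) * T (Suc n)"
  proof -
    define g where "g i = f i * (-1) ^ (Suc n - i) * T i" for i
    have "antipode_conv f P x = (\<Sum>i\<le>Suc n. g i)"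
      by (simp only: antipode_conv_def len g_def T_def)
    also have "\<dots> = g 0 + (\<Sum>i\<le>n. g (Suc i))"
      by (rule sum.atMost_Suc_shift)
    also have "(\<Sum>i\<le>n. g (Suc i)) = (\<Sum>i<n. g (Suc i)) + g (Suc n)"
      by (simp add: lessThan_Suc_atMost[symmetric])
    finally show ?thesis
      by (simp add: g_def)
  qed
  also have "\<dots> = ((\<Sum>i<n. f (Suc i) * (-1) ^ (n - i) * A i) + f (Suc n) * A n)
      + (f 0 * (-1) ^ Suc n * B 0 + (\<Sum>i<n. f (Suc i) * (-1) ^ (n - i) * B (Suc i)))"
    by (simp add: T_0 T_n T_Suc algebra_simps sum.distrib)
  also have "(\<Sum>i<n. f (Suc i) * (-1) ^ (n - i) * A i) + f (Suc n) * A n =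
      antipode_conv (\<lambda>i. f (Suc i)) ?Pa (tl x)"
    by (simp add: antipode_conv_def len A_def[symmetric] lessThan_Suc_atMost[symmetric])
  also have "f 0 * (-1) ^ Suc n * B 0 + (\<Sum>i<n. f (Suc i) * (-1) ^ (n - i) * B (Suc i)) =
      - antipode_conv f ?Pb (butlast x)"
  proof -
    have "antipode_conv f ?Pb (butlast x) = (\<Sum>i<Suc n. f i * (-1) ^ (n - i) * B i)"
      by (simp add: antipode_conv_def len B_def[symmetric] lessThan_Suc_atMost)
    also have "\<dots> = f 0 * (-1) ^ n * B 0 + (\<Sum>i<n. f (Suc i) * (-1) ^ (n - Suc i) * B (Suc i))"
      by (simp add: sum.lessThan_Suc_shift del: sum.lessThan_Suc)
    also have "(\<Sum>i<n. f (Suc i) * (-1) ^ (n - Suc i) * B (Suc i)) =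
        - (\<Sum>i<n. f (Suc i) * (-1) ^ (n - i) * B (Suc i))"
      unfolding sum_negf[symmetric] by (intro sum.cong refl) (simp add: Suc_diff_Suc[symmetric])
    finally show ?thesis by simp
  qed
  finally show ?thesis by simp
qed

text \<open>The identity convolved with the antipode is the counit, which vanishes on non-empty
  words. For one letter the two terms cancel; for longer words both terms of the recursion vanish by
  induction.\<close>

lemma antipode_conv_1:
  assumes "x \<noteq> []"
  shows "antipode_conv (\<lambda>i. 1) P x = 0"
  using assms
proof (induction "length x" arbitrary: P x)
  case (Suc n)
  show ?case
  proof (cases n)
    case 0
    with Suc(2) obtain a where "x = [a]"
      by (metis length_0_conv length_Suc_conv)
    then show ?thesis
      by (simp add: antipode_conv_def)
  next
    case (Suc k)
    then have "tl x \<noteq> []" "butlast x \<noteq> []"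
      using Suc.hyps(2) by (auto simp: tl_Nil butlast_conv_take length_Suc_conv)
    then show ?thesis
      using Suc.hyps Suc.prems by (simp add: antipode_conv_rec[OF Suc.prems])
  qed
qed simp

lemma Suc_length_words: "{w :: 'd word. length w = Suc n} = (\<lambda>(a, w). a # w) ` (UNIV \<times> {w. length w = n})"
  by (auto simp: length_Suc_conv image_iff)

text \<open>Both sides obey the same recursion: a bracket with a letter on the left compares this
  letter with the first letter of x and, with a minus sign, with the last one.\<close>

lemma dynkin:
  fixes P :: "'d::finite series"
  assumes "x \<noteq> []"
  shows "(\<Sum>w | length w = length x. P w * lie_bracketing w x) = antipode_conv real P x"
  using assms
proof (induction "length x" arbitrary: P x)
  case (Suc n)
  have fin: "finite {w :: 'd word. length w = k}" for k
    using finite_lists_length_eq[of "UNIV :: 'd letter set" k] by simp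
  show ?case
  proof (cases n)
    case 0
    with Suc(2) obtain a where x: "x = [a]"
      by (metis length_0_conv length_Suc_conv)
    have "(\<Sum>w | length w = length x. P w * lie_bracketing w x) = (\<Sum>w\<in>{[a]}. P w * lie_bracketing w x)"
      using fin[of 1] by (intro sum.mono_neutral_right) (auto simp: x length_Suc_conv monomial_def split: if_splits)
    then show ?thesis
      by (simp add: antipode_conv_def x monomial_def)
  next
    case (Suc k)
    have ne: "tl x \<noteq> []" "butlast x \<noteq> []" and len: "n = length (tl x)" "n = length (butlast x)"
      using Suc.hyps(2) Suc by (auto simp: tl_Nil butlast_conv_take length_Suc_conv)
    have lb: "lie_bracketing (a # w) x = (if a = hd x then lie_bracketing w (tl x) else 0)
        - (if a = last x then lie_bracketing w (butlast x) else 0)" if "length w = n" for a w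
    proof -
      have "s_mult (monomial [a]) (lie_bracketing w) x = (if a = hd x then lie_bracketing w (tl x) else 0)"
        using Suc.prems by (cases x) (simp_all add: s_mult_letter_left)
      moreover have "s_mult (lie_bracketing w) (monomial [a]) x = (if a = last x then lie_bracketing w (butlast x) else 0)"
        using Suc.prems by (cases x rule: rev_cases) (simp_all add: s_mult_letter_right)
      ultimately show ?thesis
        using that Suc by (auto simp: s_bracket_def)
    qed
    have "(\<Sum>w | length w = length x. P w * lie_bracketing w x) =
        (\<Sum>(a, w)\<in>UNIV \<times> {w. length w = n}. P (a # w) * lie_bracketing (a # w) x)"
      unfolding Suc.hyps(2)[symmetric] Suc_length_words
      by (subst sum.reindex) (auto simp: inj_on_def case_prod_unfold)
    also have "\<dots> = (\<Sum>a\<in>UNIV. \<Sum>w | length w = n. P (a # w) * lie_bracketing (a # w) x)"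
      by (simp add: sum.cartesian_product)
    also have "\<dots> = (\<Sum>a\<in>UNIV. (if a = hd x then \<Sum>w | length w = n. P (a # w) * lie_bracketing w (tl x) else 0)
        - (if a = last x then \<Sum>w | length w = n. P (a # w) * lie_bracketing w (butlast x) else 0))"
      by (intro sum.cong refl) (auto simp: lb right_diff_distrib sum_subtractf simp del: lie_bracketing.simps)
    also have "\<dots> = (\<Sum>w | length w = n. P (hd x # w) * lie_bracketing w (tl x))
        - (\<Sum>w | length w = n. P (last x # w) * lie_bracketing w (butlast x))"
      by (simp add: sum_subtractf sum.delta)
    also have "\<dots> = antipode_conv real (\<lambda>w. P (hd x # w)) (tl x) - antipode_conv real (\<lambda>w. P (last x # w)) (butlast x)"
      using Suc.hyps(1)[OF len(1) ne(1)] Suc.hyps(1)[OF len(2) ne(2)] len by simp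
    \<comment> \<open>The shift of i adds a convolution with constant weight 1, which vanishes since
      \<open>tl x\<close> is non-empty.\<close>
    also have "antipode_conv real (\<lambda>w. P (hd x # w)) (tl x) =
        antipode_conv (\<lambda>i. real (Suc i)) (\<lambda>w. P (hd x # w)) (tl x)"
    proof -
      have "antipode_conv (\<lambda>i. real (Suc i)) R y = antipode_conv real R y + antipode_conv (\<lambda>i. 1) R y" for R and y :: "'d word"
        by (simp add: antipode_conv_def algebra_simps sum.distrib)
      then show ?thesis
        by (simp add: antipode_conv_1[OF ne(1)])
    qed
    also have "\<dots> - antipode_conv real (\<lambda>w. P (last x # w)) (butlast x) = antipode_conv real P x"
      by (rule antipode_conv_rec[OF Suc.prems, symmetric])
    finally show ?thesis .
  qed
qed simp

lemma lie_polynomials_sum: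
  "finite I \<Longrightarrow> (\<And>i. i \<in> I \<Longrightarrow> P i \<in> lie_polynomials) \<Longrightarrow> (\<lambda>w. \<Sum>i\<in>I. P i w) \<in> lie_polynomials"
  by (induction I rule: finite_induct) (auto intro: lie_polynomials.intros)

text \<open>The Dynkin-Specht-Wever argument. For primitive P, shuffles of two non-empty words
  contribute 0 and the term i = 0 carries the weight 0, so the convolution at x is |x| times the
  coefficient of P.\<close>

lemma primitive_in_lie_polynomials:
  fixes P :: "'d::finite series"
  assumes P: "primitive P" and fin: "finite (support P)"
  shows "P \<in> lie_polynomials"
proof -
  \<comment> \<open>Division by the length is safe: \<open>P [] = 0\<close> keeps the empty word out
    of the support.\<close>
  have "P x = (\<Sum>w\<in>support P. (P w / real (length w)) * lie_bracketing w x)" for x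
  proof (cases "x = []")
    case True
    have "lie_bracketing w [] = 0" for w :: "'d word"
      using lie_bracketing_eq_0[of "[]" w] by (cases w) auto
    then show ?thesis
      using True primitive_Nil[OF P] by simp
  next
    case False
    let ?W = "{w :: 'd word. length w = length x}"
    have "antipode_conv real P x = (\<Sum>i\<le>length x. if i = length x then real i * P x else 0)"
      unfolding antipode_conv_def
    proof (intro sum.cong refl)
      fix i assume "i \<in> {..length x}"
      then show "real i * (-1) ^ (length x - i) * sh P (take i x) (rev (drop i x)) =
          (if i = length x then real i * P x else 0)"
        using P False by (cases "i = 0") (auto simp: primitive_def s_one_def monomial_def)
    qed
    then have "real (length x) * P x = (\<Sum>w\<in>?W. P w * lie_bracketing w x)"
      by (simp add: dynkin[OF False])
    also have "\<dots> = (\<Sum>w\<in>?W \<inter> support P. P w * lie_bracketing w x)"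
      using finite_lists_length_eq[of "UNIV :: 'd letter set" "length x"]
      by (intro sum.mono_neutral_right) (auto simp: support_def)
    also have "\<dots> = real (length x) * (\<Sum>w\<in>?W \<inter> support P. (P w / real (length w)) * lie_bracketing w x)"
      using False by (simp add: sum_distrib_left)
    also have "(\<Sum>w\<in>?W \<inter> support P. (P w / real (length w)) * lie_bracketing w x) =
        (\<Sum>w\<in>support P. (P w / real (length w)) * lie_bracketing w x)"
      using fin by (intro sum.mono_neutral_left) (auto, metis lie_bracketing_eq_0)
    finally show ?thesis
      using False by simp
  qed
  then have "P = (\<lambda>x. \<Sum>w\<in>support P. (P w / real (length w)) * lie_bracketing w x)"
    by blast
  also have "\<dots> \<in> lie_polynomials"
    by (intro lie_polynomials_sum fin lie_polynomials.scale lie_bracketing_in_lie_polynomials)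
  finally show ?thesis .
qed

section \<open>Smooth functions\<close>

lemma tdiff_append: "tdiff f (Us @ Vs) = tdiff (tdiff f Vs) Us"
  by (induction Us) simp_all

lemma smooth_tdiff: "smooth f \<Longrightarrow> smooth (tdiff f Us)"
  by (simp add: smooth_def tdiff_append[symmetric])

lemma smooth_has_derivative: "smooth f \<Longrightarrow> (f has_derivative frechet_derivative f (at x)) (at x)"
  unfolding smooth_def using frechet_derivative_works tdiff.simps(1) by metis

lemma tdiff_const: "Us \<noteq> [] \<Longrightarrow> tdiff (\<lambda>x. c) Us = (\<lambda>x. 0)"
proof (induction Us)
  case (Cons U Us)
  then show ?case
    by (cases "Us = []") simp_all
qed simp

lemma smooth_const: "smooth (\<lambda>x. c)"
  unfolding smooth_def
proof (intro allI)
  fix Us x show "tdiff (\<lambda>x. c) Us differentiable at x"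
    by (cases "Us = []") (simp_all add: tdiff_const)
qed

text \<open>The derivative of a product again contains both factors, so closure under products needs
  an induction on the order. Differentials up to order n are differentiable here, hence those of
  order n + 1 still exist, as \<open>tdiff_add_upto\<close> exploits.\<close>

definition smooth_upto ::
  "nat \<Rightarrow> ('a::real_normed_vector \<Rightarrow> 'b::real_normed_vector) \<Rightarrow> bool" where
  "smooth_upto n f \<longleftrightarrow> (\<forall>Us x. length Us \<le> n \<longrightarrow> tdiff f Us differentiable (at x))"

lemma smooth_iff_smooth_upto: "smooth f \<longleftrightarrow> (\<forall>n. smooth_upto n f)"
  by (auto simp: smooth_def smooth_upto_def)

text \<open>\<open>tdiff\<close> differentiates first along the last vector of the list, so the list
  is split at its end.\<close>

lemma smooth_upto_Suc:
  "smooth_upto (Suc n) f \<longleftrightarrow> smooth_upto 0 f \<and> (\<forall>U. smooth_upto n (tdiff f [U]))"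
proof -
  have "tdiff f Us differentiable at x"
    if "smooth_upto 0 f" "\<forall>U. smooth_upto n (tdiff f [U])" "length Us \<le> Suc n" for Us x
    using that
  proof (cases Us rule: rev_cases)
    case (snoc Vs U)
    then have "tdiff (tdiff f [U]) Vs differentiable at x"
      using that(2,3) by (simp add: smooth_upto_def del: tdiff.simps)
    then show ?thesis
      by (simp add: snoc tdiff_append)
  qed (simp add: smooth_upto_def)
  then show ?thesis
    by (auto simp: smooth_upto_def tdiff_append[symmetric] simp del: tdiff.simps)
qed

lemma smooth_upto_mono: "smooth_upto n f \<Longrightarrow> k \<le> n \<Longrightarrow> smooth_upto k f"
  by (simp add: smooth_upto_def)

lemma tdiff_add_upto:
  assumes "smooth_upto n f" "smooth_upto n g" "length Us \<le> Suc n"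
  shows "tdiff (\<lambda>x. f x + g x) Us = (\<lambda>x. tdiff f Us x + tdiff g Us x)"
  using assms(3)
proof (induction Us)
  case (Cons U Us)
  have "frechet_derivative (\<lambda>x. tdiff f Us x + tdiff g Us x) (at x) =
      (\<lambda>h. frechet_derivative (tdiff f Us) (at x) h + frechet_derivative (tdiff g Us) (at x) h)" for x
    using assms Cons.prems
    by (intro frechet_derivative_at[symmetric] has_derivative_add)
      (auto simp: smooth_upto_def frechet_derivative_works[symmetric])
  with Cons show ?case
    by simp
qed simp

lemma smooth_upto_add:
  assumes "smooth_upto n f" "smooth_upto n g"
  shows "smooth_upto n (\<lambda>x. f x + g x)"
  unfolding smooth_upto_def
proof (intro allI impI)
  fix Us :: "'a list" and x assume "length Us \<le> n"
  with assms show "tdiff (\<lambda>x. f x + g x) Us differentiable at x"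
    by (simp add: tdiff_add_upto[OF assms]) (simp add: smooth_upto_def)
qed

lemma tdiff_mult_1:
  fixes f g :: "'a::real_normed_vector \<Rightarrow> real"
  assumes "f differentiable at x" "g differentiable at x"
  shows "tdiff (\<lambda>x. f x * g x) [U] x = f x * tdiff g [U] x + tdiff f [U] x * g x"
proof -
  have "frechet_derivative (\<lambda>x. f x * g x) (at x) =
      (\<lambda>h. f x * frechet_derivative g (at x) h + frechet_derivative f (at x) h * g x)"
    using assms by (intro frechet_derivative_at[symmetric] has_derivative_mult)
      (auto simp: frechet_derivative_works[symmetric])
  then show ?thesis
    by simp
qed

lemma smooth_upto_mult:
  fixes f g :: "'a::real_normed_vector \<Rightarrow> real"
  assumes "smooth_upto n f" "smooth_upto n g"
  shows "smooth_upto n (\<lambda>x. f x * g x)"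
  using assms
proof (induction n arbitrary: f g)
  case 0
  then show ?case
    by (simp add: smooth_upto_def)
next
  case (Suc n)
  have "smooth_upto 0 f" "smooth_upto 0 g" "smooth_upto n f" "smooth_upto n g"
    using Suc.prems smooth_upto_mono by fastforce+
  note d = this
  have "smooth_upto n (tdiff (\<lambda>x. f x * g x) [U])" for U
  proof -
    have "tdiff (\<lambda>x. f x * g x) [U] = (\<lambda>x. f x * tdiff g [U] x + tdiff f [U] x * g x)"
      using d(1,2) by (intro ext tdiff_mult_1) (simp_all add: smooth_upto_def)
    then show ?thesis
      using Suc.prems d by (simp add: smooth_upto_Suc[of n] smooth_upto_add Suc.IH del: tdiff.simps)
  qed
  moreover have "smooth_upto 0 (\<lambda>x. f x * g x)"
    using d(1,2) by (simp add: smooth_upto_def)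
  ultimately show ?case
    unfolding smooth_upto_Suc[of n] by blast
qed

lemma tdiff_add:
  "smooth f \<Longrightarrow> smooth g \<Longrightarrow> tdiff (\<lambda>x. f x + g x) Us = (\<lambda>x. tdiff f Us x + tdiff g Us x)"
  by (rule tdiff_add_upto[of "length Us"]) (auto simp: smooth_iff_smooth_upto)

lemma smooth_add: "smooth f \<Longrightarrow> smooth g \<Longrightarrow> smooth (\<lambda>x. f x + g x)"
  by (simp add: smooth_iff_smooth_upto smooth_upto_add)

lemma smooth_mult:
  fixes f g :: "'a::real_normed_vector \<Rightarrow> real"
  shows "smooth f \<Longrightarrow> smooth g \<Longrightarrow> smooth (\<lambda>x. f x * g x)"
  by (simp add: smooth_iff_smooth_upto smooth_upto_mult)

lemma smooth_sum: "(\<And>i. i \<in> I \<Longrightarrow> smooth (f i)) \<Longrightarrow> smooth (\<lambda>x. \<Sum>i\<in>I. f i x)"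
  by (induction I rule: infinite_finite_induct) (auto intro: smooth_add smooth_const)

lemma tdiff_bounded_linear:
  assumes L: "bounded_linear L" and f: "smooth f"
  shows "tdiff (\<lambda>x. L (f x)) Us = (\<lambda>x. L (tdiff f Us x))"
proof (induction Us)
  case (Cons U Us)
  have "frechet_derivative (\<lambda>x. L (tdiff f Us x)) (at x) =
      (\<lambda>h. L (frechet_derivative (tdiff f Us) (at x) h))" for x
    by (intro frechet_derivative_at[symmetric] bounded_linear.has_derivative[OF L]
        smooth_has_derivative smooth_tdiff f)
  with Cons show ?case
    by simp
qed simp

lemma smooth_bounded_linear:
  assumes L: "bounded_linear L" and f: "smooth f"
  shows "smooth (\<lambda>x. L (f x))"
  unfolding smooth_def tdiff_bounded_linear[OF assms]
  using bounded_linear.has_derivative[OF L smooth_has_derivative[OF smooth_tdiff[OF f]]]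
  by (auto simp: differentiable_def)

lemma smooth_scale:
  fixes f :: "'a::real_normed_vector \<Rightarrow> real"
  shows "smooth f \<Longrightarrow> smooth (\<lambda>x. c * f x)"
  by (rule smooth_bounded_linear) (rule bounded_linear_mult_right)

lemma tdiff_scale:
  fixes f :: "'a::real_normed_vector \<Rightarrow> real"
  shows "smooth f \<Longrightarrow> tdiff (\<lambda>x. c * f x) Us = (\<lambda>x. c * tdiff f Us x)"
  by (rule tdiff_bounded_linear) (rule bounded_linear_mult_right)

lemma tdiff_sum:
  "(\<And>i. i \<in> I \<Longrightarrow> smooth (f i)) \<Longrightarrow> Us \<noteq> [] \<or> finite I \<Longrightarrow>
    tdiff (\<lambda>x. \<Sum>i\<in>I. f i x) Us = (\<lambda>x. \<Sum>i\<in>I. tdiff (f i) Us x)"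
proof (induction I rule: infinite_finite_induct)
  case empty
  then show ?case by (cases "Us = []") (simp_all add: tdiff_const)
next
  case (insert i I)
  then show ?case by (simp add: tdiff_add smooth_sum)
qed (simp add: tdiff_const)

lemma smooth_component: "smooth W \<Longrightarrow> smooth (\<lambda>x. W x $ j)"
  by (rule smooth_bounded_linear) (rule bounded_linear_vec_nth)

lemma tdiff_component: "smooth W \<Longrightarrow> tdiff (\<lambda>x. W x $ j) Us x = tdiff W Us x $ j"
  by (simp add: tdiff_bounded_linear[OF bounded_linear_vec_nth])

lemma smooth_vecI:
  fixes W :: "'a::real_normed_vector \<Rightarrow> real^'n"
  assumes "\<And>j. smooth (\<lambda>x. W x $ j)"
  shows "smooth W"
proof -
  have "smooth (\<lambda>x. \<Sum>j\<in>UNIV. (W x $ j) *\<^sub>R axis j (1::real))"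
    by (intro smooth_sum smooth_bounded_linear[OF bounded_linear_scaleR_left assms])
  also have "(\<lambda>x. \<Sum>j\<in>UNIV. (W x $ j) *\<^sub>R axis j (1::real)) = W"
    by (rule ext) (simp add: scalar_mult_eq_scaleR[symmetric] basis_expansion)
  finally show ?thesis .
qed

section \<open>Symmetry of second derivatives\<close>

lemma has_real_derivative_line:
  assumes "smooth f"
  shows "((\<lambda>s. f (y + s *\<^sub>R U)) has_real_derivative tdiff f [U] (y + s *\<^sub>R U)) (at s)"
proof -
  have "((\<lambda>s. f (y + s *\<^sub>R U)) has_derivative (\<lambda>h. frechet_derivative f (at (y + s *\<^sub>R U)) (h *\<^sub>R U))) (at s)"
    by (rule has_derivative_compose[OF _ smooth_has_derivative[OF assms]])
      (auto intro!: derivative_eq_intros)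
  moreover have "linear (frechet_derivative f (at (y + s *\<^sub>R U)))"
    using smooth_has_derivative[OF assms] has_derivative_linear by blast
  ultimately show ?thesis
    by (simp add: has_field_derivative_def linear_cmul mult_commute_abs)
qed

text \<open>The mean value theorem is applied twice: along U to the increment of f in direction
  \<open>h *\<^sub>R T\<close>, then along T to the derivative of f in direction U.\<close>

lemma second_difference:
  assumes f: "smooth f" and h: "h > 0"
  shows "\<exists>\<xi> \<eta>. \<xi> \<in> {0<..<h} \<and> \<eta> \<in> {0<..<h} \<and>
    f (x + h *\<^sub>R U + h *\<^sub>R T) - f (x + h *\<^sub>R U) - f (x + h *\<^sub>R T) + f x =
      h * h * tdiff f [T, U] (x + \<xi> *\<^sub>R U + \<eta> *\<^sub>R T)"
proof -
  have "\<exists>\<xi>>0. \<xi> < h \<and> (f (x + h *\<^sub>R T + h *\<^sub>R U) - f (x + h *\<^sub>R U)) - (f (x + h *\<^sub>R T + 0 *\<^sub>R U) - f (x + 0 *\<^sub>R U))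
      = (h - 0) * (tdiff f [U] (x + h *\<^sub>R T + \<xi> *\<^sub>R U) - tdiff f [U] (x + \<xi> *\<^sub>R U))"
    by (rule MVT2) (use h has_real_derivative_line[OF f] in \<open>auto intro!: DERIV_diff simp del: tdiff.simps\<close>)
  then obtain \<xi> where \<xi>: "0 < \<xi>" "\<xi> < h"
    "f (x + h *\<^sub>R T + h *\<^sub>R U) - f (x + h *\<^sub>R U) - f (x + h *\<^sub>R T) + f x
      = h * (tdiff f [U] (x + h *\<^sub>R T + \<xi> *\<^sub>R U) - tdiff f [U] (x + \<xi> *\<^sub>R U))"
    by (auto simp: algebra_simps simp del: tdiff.simps)
  have "\<exists>\<eta>>0. \<eta> < h \<and> tdiff f [U] (x + \<xi> *\<^sub>R U + h *\<^sub>R T) - tdiff f [U] (x + \<xi> *\<^sub>R U + 0 *\<^sub>R T)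
      = (h - 0) * tdiff (tdiff f [U]) [T] (x + \<xi> *\<^sub>R U + \<eta> *\<^sub>R T)"
    by (rule MVT2) (use h has_real_derivative_line[OF smooth_tdiff[OF f]] in \<open>auto simp del: tdiff.simps\<close>)
  then obtain \<eta> where \<eta>: "0 < \<eta>" "\<eta> < h"
    "tdiff f [U] (x + \<xi> *\<^sub>R U + h *\<^sub>R T) - tdiff f [U] (x + \<xi> *\<^sub>R U)
      = h * tdiff f [T, U] (x + \<xi> *\<^sub>R U + \<eta> *\<^sub>R T)"
    by auto
  have "f (x + h *\<^sub>R U + h *\<^sub>R T) - f (x + h *\<^sub>R U) - f (x + h *\<^sub>R T) + f x =
      h * h * tdiff f [T, U] (x + \<xi> *\<^sub>R U + \<eta> *\<^sub>R T)"
    using \<xi>(3) \<eta>(3) by (simp add: add.commute add.left_commute del: tdiff.simps)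
  with \<xi>(1,2) \<eta>(1,2) show ?thesis
    by (intro exI[of _ \<xi>] exI[of _ \<eta>]) simp
qed

text \<open>The second difference is symmetric in U and T, so the two mixed derivatives agree at
  points arbitrarily close to x; both are continuous.\<close>

lemma tdiff_commute:
  assumes f: "smooth f"
  shows "tdiff f [T, U] x = (tdiff f [U, T] x :: real)"
proof (rule ccontr)
  let ?A = "tdiff f [T, U]" and ?B = "tdiff f [U, T]"
  assume ne: "?A x \<noteq> ?B x"
  define e where "e = \<bar>?A x - ?B x\<bar> / 2"
  have e: "e > 0"
    using ne by (simp add: e_def del: tdiff.simps)
  have cont: "isCont ?A x" "isCont ?B x"
    using smooth_has_derivative[OF smooth_tdiff[OF f]] has_derivative_continuous by blast+
  obtain d where d: "d > 0" "\<And>y. dist y x < d \<Longrightarrow> dist (?A y) (?A x) < e"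
    "\<And>y. dist y x < d \<Longrightarrow> dist (?B y) (?B x) < e"
  proof -
    from cont e obtain d1 d2 where "d1 > 0" "\<And>y. dist y x < d1 \<Longrightarrow> dist (?A y) (?A x) < e"
      "d2 > 0" "\<And>y. dist y x < d2 \<Longrightarrow> dist (?B y) (?B x) < e"
      unfolding continuous_at_eps_delta by metis
    then show thesis
      by (intro that[of "min d1 d2"]) (auto simp del: tdiff.simps)
  qed
  \<comment> \<open>Makes both displacements together shorter than d; the 1 avoids division by zero
    if U = T = 0.\<close>
  define h where "h = d / (norm U + norm T + 1)"
  have pos: "norm U + norm T + 1 > 0"
    by (simp add: add_nonneg_pos)
  have h: "h > 0"
    using d(1) pos by (simp add: h_def)
  have near: "dist (x + \<xi> *\<^sub>R U + \<eta> *\<^sub>R T) x < d" if "\<xi> \<in> {0<..<h}" "\<eta> \<in> {0<..<h}" for \<xi> \<eta>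
  proof -
    have "dist (x + \<xi> *\<^sub>R U + \<eta> *\<^sub>R T) x = norm (\<xi> *\<^sub>R U + \<eta> *\<^sub>R T)"
      by (simp add: dist_norm algebra_simps)
    also have "\<dots> \<le> norm (\<xi> *\<^sub>R U) + norm (\<eta> *\<^sub>R T)"
      by (rule norm_triangle_ineq)
    also have "\<dots> \<le> h * norm U + h * norm T"
      using that by (intro add_mono) (auto intro!: mult_right_mono)
    also have "\<dots> < h * (norm U + norm T + 1)"
      using h by (simp add: algebra_simps)
    also have "\<dots> = d"
      using pos by (simp add: h_def)
    finally show ?thesis .
  qed
  obtain \<xi> \<eta> where 1: "\<xi> \<in> {0<..<h}" "\<eta> \<in> {0<..<h}"
    "f (x + h *\<^sub>R U + h *\<^sub>R T) - f (x + h *\<^sub>R U) - f (x + h *\<^sub>R T) + f x =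
      h * h * ?A (x + \<xi> *\<^sub>R U + \<eta> *\<^sub>R T)"
    using second_difference[OF f h] by metis
  obtain \<xi>' \<eta>' where 2: "\<xi>' \<in> {0<..<h}" "\<eta>' \<in> {0<..<h}"
    "f (x + h *\<^sub>R T + h *\<^sub>R U) - f (x + h *\<^sub>R T) - f (x + h *\<^sub>R U) + f x =
      h * h * ?B (x + \<xi>' *\<^sub>R T + \<eta>' *\<^sub>R U)"
    using second_difference[OF f h] by metis
  have "h * h * ?A (x + \<xi> *\<^sub>R U + \<eta> *\<^sub>R T) = h * h * ?B (x + \<eta>' *\<^sub>R U + \<xi>' *\<^sub>R T)"
  proof -
    have eqs: "x + h *\<^sub>R T + h *\<^sub>R U = x + h *\<^sub>R U + h *\<^sub>R T"
      "x + \<xi>' *\<^sub>R T + \<eta>' *\<^sub>R U = x + \<eta>' *\<^sub>R U + \<xi>' *\<^sub>R T"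
      by simp_all
    show ?thesis
      using 1(3) 2(3)[unfolded eqs] by linarith
  qed
  then have "?A (x + \<xi> *\<^sub>R U + \<eta> *\<^sub>R T) = ?B (x + \<eta>' *\<^sub>R U + \<xi>' *\<^sub>R T)"
    using h by (simp del: tdiff.simps)
  moreover have "dist (?A (x + \<xi> *\<^sub>R U + \<eta> *\<^sub>R T)) (?A x) < e"
    by (intro d near 1)
  moreover have "dist (?B (x + \<eta>' *\<^sub>R U + \<xi>' *\<^sub>R T)) (?B x) < e"
    by (intro d near 2)
  moreover have False if "p = q" "\<bar>p - a\<bar> < \<bar>a - b\<bar> / 2" "\<bar>q - b\<bar> < \<bar>a - b\<bar> / 2" for p q a b :: real
    using that by (auto simp: abs_if split: if_splits)
  ultimately show False
    unfolding e_def dist_real_def by blast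
qed

section \<open>Vector fields as differential operators\<close>

lemma vf_apply_alt: "vf_apply W f = (\<lambda>x. \<Sum>j\<in>UNIV. W x $ j * tdiff f [axis j 1] x)"
  by (simp add: vf_apply_def)

lemma smooth_vf_apply:
  assumes "smooth W" "smooth f"
  shows "smooth (vf_apply W f)"
  unfolding vf_apply_alt by (intro smooth_sum smooth_mult smooth_component smooth_tdiff assms)

lemma vf_apply_eq_derivative:
  assumes "smooth f"
  shows "vf_apply W f x = frechet_derivative f (at x) (W x)"
proof -
  have "linear (frechet_derivative f (at x))"
    using smooth_has_derivative[OF assms] has_derivative_linear by blast
  then have "frechet_derivative f (at x) (\<Sum>j\<in>UNIV. (W x $ j) *\<^sub>R axis j 1) = vf_apply W f x"
    by (simp add: linear_sum linear_cmul vf_apply_def)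
  then show ?thesis
    using basis_expansion[of "W x"] by (simp add: scalar_mult_eq_scaleR)
qed

lemma vf_apply_add:
  "smooth f \<Longrightarrow> smooth g \<Longrightarrow> vf_apply W (\<lambda>x. f x + g x) = (\<lambda>x. vf_apply W f x + vf_apply W g x)"
  unfolding vf_apply_alt by (simp add: tdiff_add sum.distrib distrib_left del: tdiff.simps)

lemma vf_apply_scale: "smooth f \<Longrightarrow> vf_apply W (\<lambda>x. c * f x) = (\<lambda>x. c * vf_apply W f x)"
  unfolding vf_apply_alt by (simp add: tdiff_scale sum_distrib_left mult_ac del: tdiff.simps)

lemma vf_apply_const [simp]: "vf_apply W (\<lambda>x. c) = (\<lambda>x. 0)"
  by (simp add: vf_apply_def)

lemma vf_apply_sum:
  "(\<And>i. i \<in> I \<Longrightarrow> smooth (f i)) \<Longrightarrow> vf_apply W (\<lambda>x. \<Sum>i\<in>I. f i x) = (\<lambda>x. \<Sum>i\<in>I. vf_apply W (f i) x)"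
  by (induction I rule: infinite_finite_induct) (simp_all add: vf_apply_add smooth_sum)

lemma vf_apply_mult:
  assumes "smooth f" "smooth g"
  shows "vf_apply W (\<lambda>x. f x * g x) = (\<lambda>x. f x * vf_apply W g x + vf_apply W f x * g x)"
proof -
  have "tdiff (\<lambda>x. f x * g x) [U] x = f x * tdiff g [U] x + tdiff f [U] x * g x" for U x
    using assms smooth_has_derivative by (intro tdiff_mult_1) (auto simp: differentiable_def)
  then show ?thesis
    unfolding vf_apply_alt
    by (simp add: distrib_left sum.distrib sum_distrib_left sum_distrib_right mult_ac del: tdiff.simps)
qed

text \<open>The second-order terms of the two compositions coincide by symmetry of second
  derivatives, and a first-order operator remains.\<close>

lemma vf_apply_bracket:
  fixes W W' :: "real^'n \<Rightarrow> real^'n"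
  assumes W: "smooth W" and W': "smooth W'" and f: "smooth f"
  shows "vf_apply W (vf_apply W' f) x - vf_apply W' (vf_apply W f) x =
    vf_apply (\<lambda>x. \<chi> j. vf_apply W (\<lambda>x. W' x $ j) x - vf_apply W' (\<lambda>x. W x $ j) x) f x"
proof -
  have *: "vf_apply W (vf_apply W' f) x = (\<Sum>j\<in>UNIV. \<Sum>i\<in>UNIV. W x $ i * W' x $ j * tdiff f [axis i 1, axis j 1] x) +
      (\<Sum>j\<in>UNIV. vf_apply W (\<lambda>x. W' x $ j) x * tdiff f [axis j 1] x)"
    if "smooth W" "smooth W'" for W W' :: "real^'n \<Rightarrow> real^'n"
  proof -
    have "vf_apply W (vf_apply W' f) x =
        (\<Sum>j\<in>UNIV. vf_apply W (\<lambda>x. W' x $ j * tdiff f [axis j 1] x) x)"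
      unfolding vf_apply_alt[of W' f]
      by (subst vf_apply_sum) (intro smooth_mult smooth_component smooth_tdiff that f, simp)
    also have "\<dots> = (\<Sum>j\<in>UNIV. W' x $ j * vf_apply W (tdiff f [axis j 1]) x +
        vf_apply W (\<lambda>x. W' x $ j) x * tdiff f [axis j 1] x)"
      by (simp add: vf_apply_mult smooth_component smooth_tdiff that f del: tdiff.simps)
    also have "\<dots> = (\<Sum>j\<in>UNIV. \<Sum>i\<in>UNIV. W x $ i * W' x $ j * tdiff f [axis i 1, axis j 1] x) +
        (\<Sum>j\<in>UNIV. vf_apply W (\<lambda>x. W' x $ j) x * tdiff f [axis j 1] x)"
      by (simp add: sum.distrib vf_apply_def[of W] sum_distrib_left mult_ac)
    finally show ?thesis .
  qed
  have "(\<Sum>j\<in>UNIV. \<Sum>i\<in>UNIV. W x $ i * W' x $ j * tdiff f [axis i 1, axis j 1] x) =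
      (\<Sum>j\<in>UNIV. \<Sum>i\<in>UNIV. W' x $ i * W x $ j * tdiff f [axis i 1, axis j 1] x)"
    by (subst sum.swap, subst tdiff_commute[OF f]) (simp add: mult_ac del: tdiff.simps)
  then show ?thesis
    unfolding *[OF W W'] *[OF W' W]
    by (simp add: vf_apply_alt[of _ f] left_diff_distrib sum_subtractf del: tdiff.simps)
qed

context
  fixes V :: "'d letter \<Rightarrow> real^'n \<Rightarrow> real^'n"
  assumes V: "\<And>a. smooth (V a)"
begin

lemma smooth_word_op: "smooth f \<Longrightarrow> smooth (word_op V w f)"
  by (induction w) (simp_all add: smooth_vf_apply V)

lemma smooth_Phi_op: "smooth f \<Longrightarrow> smooth (Phi_op V P f)"
  unfolding Phi_op_def by (intro smooth_sum smooth_scale smooth_word_op)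

lemma word_op_append: "word_op V (u @ v) f = word_op V u (word_op V v f)"
  by (induction u) simp_all

lemma word_op_sum:
  "(\<And>i. i \<in> I \<Longrightarrow> smooth (f i)) \<Longrightarrow>
    word_op V w (\<lambda>x. \<Sum>i\<in>I. c i * f i x) = (\<lambda>x. \<Sum>i\<in>I. c i * word_op V w (f i) x)"
  by (induction w) (simp_all add: vf_apply_sum vf_apply_scale smooth_scale smooth_word_op)

text \<open>Non-empty words annihilate constants. This permits centring the coordinates at the point
  of evaluation.\<close>

lemma word_op_shift:
  assumes "smooth f" "w \<noteq> []"
  shows "word_op V w (\<lambda>x. f x + c) = word_op V w f"
  using assms(2)
proof (induction w)
  case (Cons a w)
  show ?case
  proof (cases "w = []")
    case True
    then show ?thesis
      using vf_apply_add[OF assms(1) smooth_const, of "V a" c] by simp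
  next
    case False
    then show ?thesis
      using Cons.IH by simp
  qed
qed simp

end

section \<open>The homomorphism from polynomials to differential operators\<close>

lemma Phi_op_eq:
  assumes "finite S" "support P \<subseteq> S"
  shows "Phi_op V P f x = (\<Sum>w\<in>S. P w * word_op V w f x)"
  unfolding Phi_op_def using assms by (intro sum.mono_neutral_left) (auto simp: support_def)

lemma support_add: "support (\<lambda>w. P w + Q w) \<subseteq> support P \<union> support Q"
  and support_scale: "support (\<lambda>w. c * P w) \<subseteq> support P"
  by (auto simp: support_def)

lemma finite_support_add: "finite (support P) \<Longrightarrow> finite (support Q) \<Longrightarrow> finite (support (\<lambda>w. P w + Q w))"
  by (rule finite_subset[OF support_add]) simp

lemma finite_support_scale: "finite (support P) \<Longrightarrow> finite (support (\<lambda>w. c * P w))"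
  by (rule finite_subset[OF support_scale])

lemma support_s_mult: "support (s_mult P Q) \<subseteq> (\<lambda>p. fst p @ snd p) ` (support P \<times> support Q)"
proof
  fix w assume "w \<in> support (s_mult P Q)"
  then obtain k where "P (take k w) * Q (drop k w) \<noteq> 0"
    unfolding support_def s_mult_def using sum.not_neutral_contains_not_neutral by blast
  then show "w \<in> (\<lambda>p. fst p @ snd p) ` (support P \<times> support Q)"
    by (intro image_eqI[of _ _ "(take k w, drop k w)"]) (auto simp: support_def)
qed

lemma finite_support_s_mult: "finite (support P) \<Longrightarrow> finite (support Q) \<Longrightarrow> finite (support (s_mult P Q))"
  by (rule finite_subset[OF support_s_mult]) simp

lemma Phi_op_add:
  assumes "finite (support P)" "finite (support Q)"
  shows "Phi_op V (\<lambda>w. P w + Q w) f = (\<lambda>x. Phi_op V P f x + Phi_op V Q f x)"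
  using assms support_add[of P Q]
  by (simp add: fun_eq_iff Phi_op_eq[of "support P \<union> support Q"] distrib_right sum.distrib)

lemma Phi_op_scale: 
  assumes "finite (support P)"
  shows "Phi_op V (\<lambda>w. c * P w) f = (\<lambda>x. c * Phi_op V P f x)"
  using assms support_scale[of c P]
  by (simp add: fun_eq_iff Phi_op_eq[of "support P"] sum_distrib_left mult_ac)

lemma finite_support_zero: "finite (support (\<lambda>w. 0))"
  by (simp add: support_def)

lemma Phi_op_zero: "Phi_op V (\<lambda>w. 0) f = (\<lambda>x. 0)"
  by (simp add: Phi_op_def)

lemma finite_support_sum:
  "(\<And>i. i \<in> I \<Longrightarrow> finite (support (P i))) \<Longrightarrow> finite (support (\<lambda>w. \<Sum>i\<in>I. P i w))"
  by (induction I rule: infinite_finite_induct) (auto intro: finite_support_add finite_support_zero)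

lemma Phi_op_sum:
  "(\<And>i. i \<in> I \<Longrightarrow> finite (support (P i))) \<Longrightarrow>
    Phi_op V (\<lambda>w. \<Sum>i\<in>I. P i w) f = (\<lambda>x. \<Sum>i\<in>I. Phi_op V (P i) f x)"
  by (induction I rule: infinite_finite_induct) (simp_all add: Phi_op_zero Phi_op_add finite_support_sum)

lemma Phi_op_one:
  fixes V :: "'d letter \<Rightarrow> real^'n \<Rightarrow> real^'n"
  shows "Phi_op V s_one f = f"
proof -
  have "support (s_one :: 'd series) = {[]}"
    by (auto simp: support_def s_one_def monomial_def)
  then show ?thesis
    by (simp add: Phi_op_def)
qed

text \<open>A pair of words contributes to the coefficient of its concatenation, and concatenation
  becomes composition of operators. The double sum is grouped by the concatenated word.\<close>

lemma Phi_op_mult: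
  assumes V: "\<And>a. smooth (V a)" and f: "smooth f"
    and P: "finite (support P)" and Q: "finite (support Q)"
  shows "Phi_op V (s_mult P Q) f = Phi_op V P (Phi_op V Q f)"
proof
  fix x
  let ?S = "support P \<times> support Q"
  let ?R = "(\<lambda>p. fst p @ snd p) ` ?S"
  have fin: "finite ?S" "finite ?R"
    using P Q by auto
  have "Phi_op V (s_mult P Q) f x = (\<Sum>w\<in>?R. s_mult P Q w * word_op V w f x)"
    by (rule Phi_op_eq[OF fin(2) support_s_mult])
  also have "\<dots> = (\<Sum>w\<in>?R. \<Sum>p | p \<in> ?S \<and> fst p @ snd p = w. P (fst p) * Q (snd p) * word_op V (fst p @ snd p) f x)"
  proof (intro sum.cong refl)
    fix w
    have "s_mult P Q w = (\<Sum>p\<in>(\<lambda>k. (take k w, drop k w)) ` {..length w}. P (fst p) * Q (snd p))"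
      unfolding s_mult_def by (subst sum.reindex) (auto simp: inj_on_def dest: arg_cong[of _ _ length])
    also have "\<dots> = (\<Sum>p | p \<in> ?S \<and> fst p @ snd p = w. P (fst p) * Q (snd p))"
    proof (rule sum.mono_neutral_right)
      show "{p. p \<in> ?S \<and> fst p @ snd p = w} \<subseteq> (\<lambda>k. (take k w, drop k w)) ` {..length w}"
      proof safe
        fix u v
        show "(u, v) \<in> (\<lambda>k. (take k (fst (u, v) @ snd (u, v)), drop k (fst (u, v) @ snd (u, v)))) `
            {..length (fst (u, v) @ snd (u, v))}"
          by (rule image_eqI[of _ _ "length u"]) simp_all
      qed
    qed (auto simp: support_def)
    finally show "s_mult P Q w * word_op V w f x =
        (\<Sum>p | p \<in> ?S \<and> fst p @ snd p = w. P (fst p) * Q (snd p) * word_op V (fst p @ snd p) f x)"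
      by (auto simp: sum_distrib_right intro!: sum.cong)
  qed
  also have "\<dots> = (\<Sum>p\<in>?S. P (fst p) * Q (snd p) * word_op V (fst p @ snd p) f x)"
    by (rule sum.group[OF fin]) simp
  also have "\<dots> = (\<Sum>(u, v)\<in>?S. P u * Q v * word_op V (u @ v) f x)"
    by (simp add: case_prod_unfold)
  also have "\<dots> = Phi_op V P (Phi_op V Q f) x"
    unfolding Phi_op_def
    by (simp add: word_op_sum V smooth_word_op f word_op_append sum.cartesian_product[symmetric]
        sum_distrib_left mult_ac)
  finally show "Phi_op V (s_mult P Q) f x = Phi_op V P (Phi_op V Q f) x" .
qed

text \<open>Finiteness of the support belongs to the induction because the rules for
  \<open>Phi_op\<close> of sums and products hold for polynomials.\<close>

lemma lie_polynomial_vector_field: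
  fixes V :: "'d letter \<Rightarrow> real^'n \<Rightarrow> real^'n"
  assumes V: "\<And>a. smooth (V a)" and P: "P \<in> lie_polynomials"
  shows "finite (support P) \<and> (\<exists>W. smooth W \<and> (\<forall>f. smooth f \<longrightarrow> Phi_op V P f = vf_apply W f))"
  using P
proof (induction rule: lie_polynomials.induct)
  case (letter a)
  have "support (monomial [a]) = {[a]}"
    by (auto simp: support_def monomial_def)
  then show ?case
    using V[of a] by (auto simp: Phi_op_def monomial_def)
next
  case zero
  have "smooth (\<lambda>x::real^'n. 0::real^'n)" "\<forall>f. Phi_op V (\<lambda>w. 0) f = vf_apply (\<lambda>x. 0) f"
    by (simp_all add: smooth_const Phi_op_zero vf_apply_def fun_eq_iff)
  then show ?case
    using finite_support_zero by blast
next
  case (add P Q)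
  then obtain W W' where W: "smooth W" "\<forall>f. smooth f \<longrightarrow> Phi_op V P f = vf_apply W f"
    "smooth W'" "\<forall>f. smooth f \<longrightarrow> Phi_op V Q f = vf_apply W' f"
    by blast
  have "\<forall>f. smooth f \<longrightarrow> Phi_op V (\<lambda>w. P w + Q w) f = vf_apply (\<lambda>x. W x + W' x) f"
    using W add.IH by (simp add: Phi_op_add) (simp add: vf_apply_def distrib_right sum.distrib)
  with W(1,3) add.IH show ?case
    by (auto intro: finite_support_add smooth_add)
next
  case (scale P c)
  then obtain W where W: "smooth W" "\<forall>f. smooth f \<longrightarrow> Phi_op V P f = vf_apply W f"
    by blast
  have "\<forall>f. smooth f \<longrightarrow> Phi_op V (\<lambda>w. c * P w) f = vf_apply (\<lambda>x. c *\<^sub>R W x) f"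
    using W scale.IH by (simp add: Phi_op_scale) (simp add: vf_apply_def sum_distrib_left mult_ac)
  moreover have "smooth (\<lambda>x. c *\<^sub>R W x)"
    by (rule smooth_bounded_linear[OF bounded_linear_scaleR_right W(1)])
  ultimately show ?case
    using scale.IH by (auto intro: finite_support_scale)
next
  case (bracket P Q)
  then obtain W W' where W: "smooth W" "\<And>f. smooth f \<Longrightarrow> Phi_op V P f = vf_apply W f"
    "smooth W'" "\<And>f. smooth f \<Longrightarrow> Phi_op V Q f = vf_apply W' f"
    by blast
  have fin: "finite (support P)" "finite (support Q)"
    using bracket.IH by auto
  define U where "U = (\<lambda>x. \<chi> j. vf_apply W (\<lambda>x. W' x $ j) x - vf_apply W' (\<lambda>x. W x $ j) x)"
  have eq: "s_bracket P Q = (\<lambda>w. s_mult P Q w + (-1) * s_mult Q P w)"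
    by (simp add: s_bracket_def)
  have "Phi_op V (s_bracket P Q) f = vf_apply U f" if f: "smooth f" for f
  proof -
    have "Phi_op V (s_bracket P Q) f =
        (\<lambda>x. Phi_op V (s_mult P Q) f x + (-1) * Phi_op V (s_mult Q P) f x)"
      unfolding eq by (simp only: Phi_op_add Phi_op_scale finite_support_s_mult finite_support_scale fin)
    also have "\<dots> = vf_apply U f"
      by (simp add: fun_eq_iff U_def Phi_op_mult[of V, OF V f] fin W f smooth_vf_apply
          vf_apply_bracket[OF W(1,3) f, symmetric])
    finally show ?thesis .
  qed
  moreover have "smooth (\<lambda>x. vf_apply W (\<lambda>x. W' x $ j) x + (-1) * vf_apply W' (\<lambda>x. W x $ j) x)" for j
    by (intro smooth_add smooth_scale smooth_vf_apply smooth_component W)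
  then have "smooth U"
    unfolding U_def by (intro smooth_vecI) simp
  moreover have "finite (support (s_bracket P Q))"
    unfolding eq by (intro finite_support_add finite_support_scale finite_support_s_mult fin)
  ultimately show ?case
    by blast
qed

lemma Phi_lie_polynomial:
  fixes V :: "'d letter \<Rightarrow> real^'n \<Rightarrow> real^'n"
  assumes V: "\<And>a. smooth (V a)" and P: "P \<in> lie_polynomials"
  shows "finite (support P)" "smooth (Phi V P)"
    "smooth f \<Longrightarrow> Phi_op V P f = vf_apply (Phi V P) f"
    "Phi V P x $ j = Phi_op V P (\<lambda>y. y $ j) x"
proof -
  obtain W where W: "finite (support P)" "smooth W" "\<forall>f. smooth f \<longrightarrow> Phi_op V P f = vf_apply W f"
    using lie_polynomial_vector_field[of V, OF V P] by blast
  then have "Phi V P = W"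
    unfolding Phi_def by (intro vf_of_op_eqI) simp
  with W show "finite (support P)" "smooth (Phi V P)"
    "smooth f \<Longrightarrow> Phi_op V P f = vf_apply (Phi V P) f"
    "Phi V P x $ j = Phi_op V P (\<lambda>y. y $ j) x"
    by (simp_all add: smooth_coordinate vf_apply_coordinate)
qed

section \<open>Flows of Lipschitz vector fields\<close>

definition ode_solution :: "('a::real_normed_vector \<Rightarrow> 'a) \<Rightarrow> (real \<Rightarrow> 'a) \<Rightarrow> bool" where
  "ode_solution W z \<longleftrightarrow> (\<forall>t\<in>{0..1}. (z has_vector_derivative W (z t)) (at t within {0..1}))"

text \<open>A Gronwall argument: the squared distance times exp(- 2 L t) has non-positive
  derivative. The square makes the distance differentiable also where it is zero.\<close>

lemma ode_solution_stability:
  fixes W :: "'a::real_inner \<Rightarrow> 'a"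
  assumes L: "\<And>x y. norm (W x - W y) \<le> L * norm (x - y)"
    and z: "ode_solution W z" "ode_solution W z'"
  shows "norm (z 1 - z' 1) \<le> exp L * norm (z 0 - z' 0)"
proof -
  define w where "w t = z t - z' t" for t
  define \<phi> where "\<phi> t = (w t \<bullet> w t) * exp (- 2 * L * t)" for t
  have cont: "continuous_on {0..1} z" "continuous_on {0..1} z'"
    using z unfolding ode_solution_def
    by (auto simp: continuous_on_eq_continuous_within intro: has_vector_derivative_continuous)
  have "\<phi> 1 \<le> \<phi> 0"
  proof (rule DERIV_nonpos_imp_decreasing_open[where f = \<phi> and a = 0 and b = 1])
    fix t :: real assume t: "0 < t" "t < 1"
    then have "at t within {0..1} = at t"
      by (intro at_within_interior) simp
    with t z have d: "(z has_vector_derivative W (z t)) (at t)" "(z' has_vector_derivative W (z' t)) (at t)"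
      unfolding ode_solution_def by (metis atLeastAtMost_iff less_imp_le)+
    let ?v = "W (z t) - W (z' t)"
    have dw: "(w has_derivative (\<lambda>h. h *\<^sub>R ?v)) (at t)"
      using has_vector_derivative_diff[OF d] by (simp add: w_def[abs_def] has_vector_derivative_def)
    have "((\<lambda>t. w t \<bullet> w t) has_real_derivative 2 * (w t \<bullet> ?v)) (at t)"
    proof -
      have "(\<lambda>h. w t \<bullet> h *\<^sub>R ?v + h *\<^sub>R ?v \<bullet> w t) = (*) (2 * (w t \<bullet> ?v))"
        by (simp add: fun_eq_iff inner_commute)
      with has_derivative_inner[OF dw dw] show ?thesis
        by (simp only: has_field_derivative_def)
    qed
    then have "(\<phi> has_real_derivative 2 * (w t \<bullet> ?v) * exp (- 2 * L * t) + (w t \<bullet> w t) * (exp (- 2 * L * t) * (- 2 * L))) (at t)"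
      unfolding \<phi>_def by (auto intro!: derivative_eq_intros)
    moreover have "2 * (w t \<bullet> ?v) * exp (- 2 * L * t) + (w t \<bullet> w t) * (exp (- 2 * L * t) * (- 2 * L)) \<le> 0"
    proof -
      have "w t \<bullet> ?v \<le> norm (w t) * norm ?v"
        by (rule norm_cauchy_schwarz)
      also have "\<dots> \<le> norm (w t) * (L * norm (w t))"
        using L by (intro mult_left_mono) (auto simp: w_def)
      also have "\<dots> = L * (w t \<bullet> w t)"
        by (simp add: power2_norm_eq_inner[symmetric] power2_eq_square)
      finally have "2 * exp (- 2 * L * t) * (w t \<bullet> ?v - L * (w t \<bullet> w t)) \<le> 0"
        by (intro mult_nonneg_nonpos) auto
      then show ?thesis
        by (simp add: algebra_simps)
    qed
    ultimately show "\<exists>y. (\<phi> has_real_derivative y) (at t) \<and> y \<le> 0"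
      by blast
  next
    show "continuous_on {0..1} \<phi>"
      unfolding \<phi>_def w_def by (intro continuous_intros cont)
  qed simp
  then have "(norm (w 1))\<^sup>2 * exp (- 2 * L) \<le> (norm (w 0))\<^sup>2"
    by (simp add: \<phi>_def power2_norm_eq_inner)
  then have "(norm (w 1))\<^sup>2 \<le> (exp L * norm (w 0))\<^sup>2"
  proof -
    assume "(norm (w 1))\<^sup>2 * exp (- 2 * L) \<le> (norm (w 0))\<^sup>2"
    then have "(norm (w 1))\<^sup>2 * exp (- 2 * L) * exp (2 * L) \<le> (norm (w 0))\<^sup>2 * exp (2 * L)"
      by (intro mult_right_mono) auto
    moreover have "exp (- 2 * L) * exp (2 * L) = 1"
      by (simp add: exp_add[symmetric])
    ultimately have "(norm (w 1))\<^sup>2 \<le> (norm (w 0))\<^sup>2 * exp (2 * L)"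
      by (simp only: mult.assoc mult_1_right)
    then show ?thesis
      by (simp only: power_mult_distrib exp_double mult.commute[of "(exp L)\<^sup>2"])
  qed
  then show ?thesis
    using power2_le_imp_le[of "norm (w 1)" "exp L * norm (w 0)"] by (simp add: w_def)
qed

text \<open>Picard iteration for \<open>u t = e\<^sup>-\<^sup>2\<^sup>L\<^sup>t z t\<close> contracts the supremum norm by the factor \<open>1/2\<close>
  on the whole interval.\<close>

lemma ode_solution_exists:
  fixes W :: "'a::euclidean_space \<Rightarrow> 'a"
  assumes L: "L > 0" "\<And>x y. norm (W x - W y) \<le> L * norm (x - y)"
  shows "\<exists>z. z 0 = x \<and> ode_solution W z"
proof -
  \<comment> \<open>Clamping time to the unit interval turns the iterates into bounded continuous
    functions on the line, which form a complete space.\<close>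
  define c :: "real \<Rightarrow> real" where "c t = max 0 (min 1 t)" for t
  have c: "c t \<in> {0..1}" "continuous_on UNIV c" for t
    by (auto simp: c_def[abs_def] intro!: continuous_intros)
  have contW: "continuous_on S W" for S
  proof -
    have "L-lipschitz_on S W"
      using L by (auto simp: lipschitz_on_def dist_norm)
    then show ?thesis
      by (rule lipschitz_on_continuous_on)
  qed
  define F where "F u \<tau> = W (exp (2 * L * \<tau>) *\<^sub>R apply_bcontfun u \<tau>)" for u :: "real \<Rightarrow>\<^sub>C 'a" and \<tau>
  have contF: "continuous_on S (F u)" for u S
    unfolding F_def by (intro continuous_on_compose2[OF contW[of UNIV]] continuous_intros) auto
  have intF: "F u integrable_on {a..b}" for u a b
    by (rule integrable_continuous_real[OF contF])
  define G where "G u t = exp (- 2 * L * t) *\<^sub>R (x + integral {0..t} (F u))" for u t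
  have contG: "continuous_on {0..1} (G u)" for u
    unfolding G_def by (intro continuous_intros indefinite_integral_continuous_1 intF)
  define T where "T u = Bcontfun (\<lambda>t. G u (c t))" for u
  have T: "apply_bcontfun (T u) t = G u (c t)" for u t
  proof -
    have "continuous_on UNIV (\<lambda>t. G u (c t))"
      using c by (intro continuous_on_compose2[OF contG]) auto
    moreover have "bounded (range (\<lambda>t. G u (c t)))"
    proof (rule bounded_subset)
      show "bounded (G u ` {0..1})"
        by (intro compact_imp_bounded compact_continuous_image contG) simp
    qed (use c in auto)
    ultimately show ?thesis
      by (simp add: T_def Bcontfun_inverse bcontfun_def)
  qed
  have contraction: "dist (T u) (T v) \<le> 1 / 2 * dist u v" for u v
  proof (rule dist_bound)
    fix t
    let ?s = "c t" and ?D = "dist u v"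
    have s: "0 \<le> ?s"
      using c(1)[of t] by simp
    have "norm (F u \<tau> - F v \<tau>) \<le> L * (exp (2 * L * \<tau>) * ?D)" for \<tau>
    proof -
      have "norm (F u \<tau> - F v \<tau>) \<le> L * norm (exp (2 * L * \<tau>) *\<^sub>R apply_bcontfun u \<tau> - exp (2 * L * \<tau>) *\<^sub>R apply_bcontfun v \<tau>)"
        unfolding F_def by (rule L)
      also have "\<dots> = L * (exp (2 * L * \<tau>) * dist (apply_bcontfun u \<tau>) (apply_bcontfun v \<tau>))"
        by (simp add: dist_norm scaleR_diff_right[symmetric])
      also have "\<dots> \<le> L * (exp (2 * L * \<tau>) * ?D)"
        using L(1) dist_bounded by (intro mult_left_mono) auto
      finally show ?thesis .
    qed
    \<comment> \<open>Here the exponential weight pays off: L exp(2 L t) has the primitive exp(2 L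
      t) / 2, whence the factor 1/2.\<close>
    moreover have "((\<lambda>\<tau>. L * (exp (2 * L * \<tau>) * ?D)) has_integral
        (exp (2 * L * ?s) * ?D / 2 - exp (2 * L * 0) * ?D / 2)) {0..?s}"
      using L(1)
      by (intro fundamental_theorem_of_calculus s)
        (auto intro!: derivative_eq_intros simp: has_real_derivative_iff_has_vector_derivative[symmetric])
    ultimately have "norm (integral {0..?s} (\<lambda>\<tau>. F u \<tau> - F v \<tau>)) \<le> exp (2 * L * ?s) * ?D / 2 - ?D / 2"
      using integral_norm_bound_integral[of "\<lambda>\<tau>. F u \<tau> - F v \<tau>" "{0..?s}" "\<lambda>\<tau>. L * (exp (2 * L * \<tau>) * ?D)"]
      by (auto simp: has_integral_iff intro: integrable_diff intF)
    then have *: "norm (integral {0..?s} (F u) - integral {0..?s} (F v)) \<le> exp (2 * L * ?s) * ?D / 2"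
      using zero_le_dist[of u v] by (simp only: integral_diff intF)
    have "dist (apply_bcontfun (T u) t) (apply_bcontfun (T v) t) =
        exp (- 2 * L * ?s) * norm (integral {0..?s} (F u) - integral {0..?s} (F v))"
      by (simp add: T G_def dist_norm scaleR_diff_right[symmetric])
    also have "\<dots> \<le> exp (- 2 * L * ?s) * (exp (2 * L * ?s) * ?D / 2)"
      using * by (rule mult_left_mono) simp
    also have "\<dots> = 1 / 2 * ?D"
      by (simp add: mult.assoc[symmetric] exp_add[symmetric])
    finally show "dist (apply_bcontfun (T u) t) (apply_bcontfun (T v) t) \<le> 1 / 2 * ?D" .
  qed
  obtain u where u: "T u = u"
    using banach_fix_type[of "1 / 2" T] contraction by auto
  define z where "z t = exp (2 * L * t) *\<^sub>R apply_bcontfun u t" for t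
  have z: "z t = x + integral {0..t} (F u)" if "t \<in> {0..1}" for t
  proof -
    have "apply_bcontfun u t = G u (c t)"
      using T[of u t] u by simp
    also have "c t = t"
      using that by (auto simp: c_def)
    finally show ?thesis
      by (simp add: z_def G_def exp_add[symmetric])
  qed
  have "(z has_vector_derivative W (z t)) (at t within {0..1})" if t: "t \<in> {0..1}" for t
  proof -
    have "((\<lambda>t. x + integral {0..t} (F u)) has_vector_derivative F u t) (at t within {0..1})"
      using integral_has_vector_derivative[OF contF t, of u] by (auto intro!: derivative_eq_intros)
    then have "(z has_vector_derivative F u t) (at t within {0..1})"
      by (rule has_vector_derivative_transform[OF t, rotated]) (simp add: z)
    then show ?thesis
      by (simp add: F_def z_def)
  qed
  moreover have "z 0 = x"
    using z[of 0] by simp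
  ultimately show ?thesis
    unfolding ode_solution_def by blast
qed

lemma vf_exp_solution:
  fixes W :: "real^'n \<Rightarrow> real^'n"
  assumes L: "\<And>x y. norm (W x - W y) \<le> L * norm (x - y)"
  obtains z where "ode_solution W z" "z 0 = x" "z 1 = vf_exp W x"
proof -
  \<comment> \<open>The existence lemma asks for a positive Lipschitz constant.\<close>
  have "norm (W x - W y) \<le> (max L 0 + 1) * norm (x - y)" for x y
  proof -
    have "L * norm (x - y) \<le> (max L 0 + 1) * norm (x - y)"
      by (intro mult_right_mono) auto
    with L[of x y] show ?thesis by linarith
  qed
  then obtain z where z: "z 0 = x" "ode_solution W z"
    using ode_solution_exists[of "max L 0 + 1" W x] by (auto simp: add_nonneg_pos)
  have "vf_exp W x = z 1"
    unfolding vf_exp_def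
  proof (rule the_equality)
    fix y
    assume "\<exists>z. z 0 = x \<and> z 1 = y \<and> (\<forall>t\<in>{0..1}. (z has_vector_derivative W (z t)) (at t within {0..1}))"
    then obtain z' where z': "z' 0 = x" "z' 1 = y" "ode_solution W z'"
      unfolding ode_solution_def by blast
    \<comment> \<open>For equal initial values stability is uniqueness, which makes the definite
      description in \<open>vf_exp\<close> meaningful.\<close>
    then show "y = z 1"
      using ode_solution_stability[OF L z(2) z'(3)] z(1) by simp
  qed (use z in \<open>auto simp: ode_solution_def\<close>)
  with z that show thesis
    by metis
qed

lemma vf_exp_lipschitz:
  fixes W :: "real^'n \<Rightarrow> real^'n"
  assumes L: "\<And>x y. norm (W x - W y) \<le> L * norm (x - y)"
  shows "norm (vf_exp W x - vf_exp W y) \<le> exp L * norm (x - y)"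
proof -
  obtain z z' where "ode_solution W z" "z 0 = x" "z 1 = vf_exp W x"
    "ode_solution W z'" "z' 0 = y" "z' 1 = vf_exp W y"
    using vf_exp_solution[OF L] by metis
  then show ?thesis
    using ode_solution_stability[OF L] by metis
qed

section \<open>Pointwise bounds on derivatives\<close>

text \<open>The bound concerns a single point x because the centred coordinates, its test functions,
  depend on x.\<close>

definition jet_bound ::
  "nat \<Rightarrow> ('a::real_normed_vector \<Rightarrow> 'b::real_normed_vector) \<Rightarrow> 'a \<Rightarrow> real \<Rightarrow> bool" where
  "jet_bound i h x b \<longleftrightarrow>
    (\<forall>Us. length Us \<le> i \<and> (\<forall>U\<in>set Us. norm U = 1) \<longrightarrow> norm (tdiff h Us x) \<le> b)"

lemma jet_bound_mono: "jet_bound i h x b \<Longrightarrow> j \<le> i \<Longrightarrow> b \<le> c \<Longrightarrow> jet_bound j h x c"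
  unfolding jet_bound_def by (meson order_trans)

lemma jet_bound_nonneg: "jet_bound i h x b \<Longrightarrow> 0 \<le> b"
proof -
  assume "jet_bound i h x b"
  then have "norm (tdiff h [] x) \<le> b"
    unfolding jet_bound_def by (metis empty_iff le0 list.set(1) list.size(3))
  then show ?thesis
    using norm_ge_zero order_trans by blast
qed

lemma jet_bound_add:
  assumes "smooth f" "smooth g" "jet_bound i f x a" "jet_bound i g x b"
  shows "jet_bound i (\<lambda>x. f x + g x) x (a + b)"
  using assms unfolding jet_bound_def
  by (auto simp: tdiff_add intro!: norm_triangle_mono)

lemma jet_bound_bounded_linear:
  fixes f :: "'a::real_normed_vector \<Rightarrow> 'b::real_normed_vector"
  assumes "bounded_linear L" "smooth f" "jet_bound i f x a" "\<And>v. norm (L v) \<le> c * norm v" "0 \<le> c"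
  shows "jet_bound i (\<lambda>x. L (f x)) x (c * a)"
  unfolding jet_bound_def tdiff_bounded_linear[OF assms(1,2)]
proof (intro allI impI)
  fix Us :: "'a list" assume "length Us \<le> i \<and> (\<forall>U\<in>set Us. norm U = 1)"
  then have "c * norm (tdiff f Us x) \<le> c * a"
    using assms(3,5) by (intro mult_left_mono) (auto simp: jet_bound_def)
  with assms(4) order_trans show "norm (L (tdiff f Us x)) \<le> c * a"
    by blast
qed

lemma jet_bound_scale:
  fixes f :: "'a::real_normed_vector \<Rightarrow> real"
  assumes "smooth f" "jet_bound i f x a"
  shows "jet_bound i (\<lambda>x. c * f x) x (\<bar>c\<bar> * a)"
  using assms by (intro jet_bound_bounded_linear bounded_linear_mult_right) (auto simp: abs_mult)

lemma jet_bound_component: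
  fixes W :: "'a::real_normed_vector \<Rightarrow> real^'n"
  assumes "smooth W" "jet_bound i W x a"
  shows "jet_bound i (\<lambda>x. W x $ j) x a"
proof -
  have "jet_bound i (\<lambda>x. W x $ j) x (1 * a)"
    by (rule jet_bound_bounded_linear[OF bounded_linear_vec_nth assms]) (simp_all add: component_le_norm_cart)
  then show ?thesis
    by simp
qed

lemma jet_bound_zero: "0 \<le> b \<Longrightarrow> jet_bound i (\<lambda>x. 0) x b"
proof -
  assume "0 \<le> b"
  have "tdiff (\<lambda>x::'a. 0::'b) Us = (\<lambda>x. 0)" for Us
    by (cases "Us = []") (simp_all add: tdiff_const)
  with \<open>0 \<le> b\<close> show ?thesis
    by (simp add: jet_bound_def)
qed

lemma jet_bound_sum:
  assumes "\<And>i. i \<in> I \<Longrightarrow> smooth (f i)" "\<And>i. i \<in> I \<Longrightarrow> jet_bound n (f i) x (a i)"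
  shows "jet_bound n (\<lambda>x. \<Sum>i\<in>I. f i x) x (\<Sum>i\<in>I. a i)"
  using assms
proof (induction I rule: infinite_finite_induct)
  case (insert i I)
  have "jet_bound n (\<lambda>x. f i x + (\<Sum>i\<in>I. f i x)) x (a i + (\<Sum>i\<in>I. a i))"
    using insert by (intro jet_bound_add smooth_sum) auto
  then show ?case
    using insert by simp
qed (auto intro: jet_bound_zero)

lemma jet_bound_tdiff:
  "jet_bound (Suc i) h x b \<Longrightarrow> norm U = 1 \<Longrightarrow> jet_bound i (tdiff h [U]) x b"
  unfolding jet_bound_def
proof (intro allI impI)
  fix Us :: "'a list"
  assume "\<forall>Us. length Us \<le> Suc i \<and> (\<forall>U\<in>set Us. norm U = 1) \<longrightarrow> norm (tdiff h Us x) \<le> b"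
    "norm U = 1" "length Us \<le> i \<and> (\<forall>U\<in>set Us. norm U = 1)"
  then have "norm (tdiff h (Us @ [U]) x) \<le> b"
    by (simp del: tdiff.simps)
  then show "norm (tdiff (tdiff h [U]) Us x) \<le> b"
    by (simp only: tdiff_append)
qed

text \<open>By the Leibniz rule each further derivative at most doubles the bound.\<close>

lemma jet_bound_mult:
  fixes f g :: "'a::real_normed_vector \<Rightarrow> real"
  assumes "smooth f" "smooth g" "jet_bound i f x a" "jet_bound i g x b"
  shows "jet_bound i (\<lambda>x. f x * g x) x (2 ^ i * (a * b))"
  using assms
proof (induction i arbitrary: f g)
  case 0
  then show ?case
    by (auto simp: jet_bound_def abs_mult intro!: mult_mono)
next
  case (Suc i)
  have nn: "0 \<le> a" "0 \<le> b"
    using Suc.prems jet_bound_nonneg by blast+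
  show ?case
    unfolding jet_bound_def
  proof (intro allI impI)
    fix Us :: "'a list" assume Us: "length Us \<le> Suc i \<and> (\<forall>U\<in>set Us. norm U = 1)"
    show "norm (tdiff (\<lambda>x. f x * g x) Us x) \<le> 2 ^ Suc i * (a * b)"
    proof (cases Us rule: rev_cases)
      case Nil
      have "norm (f x) \<le> a" "norm (g x) \<le> b"
        using Suc.prems(3,4) unfolding jet_bound_def by (metis empty_iff le0 list.set(1) list.size(3) tdiff.simps(1))+
      then have "norm (f x) * norm (g x) \<le> 1 * (a * b)"
        using mult_mono nn(1) norm_ge_zero by fastforce
      also have "\<dots> \<le> 2 ^ Suc i * (a * b)"
        using nn by (intro mult_right_mono) (auto intro: one_le_power simp del: power_Suc)
      finally show ?thesis
        by (simp add: Nil abs_mult)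
    next
      case (snoc Vs U)
      have U: "norm U = 1"
        using Us snoc by simp
      have "tdiff (\<lambda>x. f x * g x) [U] = (\<lambda>x. f x * tdiff g [U] x + tdiff f [U] x * g x)"
        using smooth_has_derivative Suc.prems(1,2) by (intro ext tdiff_mult_1) (auto simp: differentiable_def)
      then have "tdiff (\<lambda>x. f x * g x) Us = tdiff (\<lambda>x. f x * tdiff g [U] x + tdiff f [U] x * g x) Vs"
        by (simp only: snoc tdiff_append)
      moreover have "jet_bound i (\<lambda>x. f x * tdiff g [U] x + tdiff f [U] x * g x) x (2 ^ i * (a * b) + 2 ^ i * (a * b))"
        using jet_bound_mono[OF Suc.prems(3), of i a] jet_bound_mono[OF Suc.prems(4), of i b]
          jet_bound_tdiff[OF Suc.prems(3) U] jet_bound_tdiff[OF Suc.prems(4) U]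
        by (intro jet_bound_add Suc.IH smooth_mult smooth_tdiff Suc.prems(1,2)) auto
      moreover have "length Vs \<le> i" "\<forall>U\<in>set Vs. norm U = 1"
        using Us snoc by auto
      ultimately show ?thesis
        by (simp add: jet_bound_def algebra_simps del: tdiff.simps)
    qed
  qed
qed

lemma jet_bound_vf_apply:
  fixes W :: "real^'n \<Rightarrow> real^'n"
  assumes W: "smooth W" "jet_bound i W x a" and h: "smooth h" "jet_bound (Suc i) h x b"
  shows "jet_bound i (vf_apply W h) x (real CARD('n) * (2 ^ i * (a * b)))"
proof -
  have "jet_bound i (\<lambda>x. \<Sum>j\<in>UNIV. W x $ j * tdiff h [axis j 1] x) x (\<Sum>j\<in>(UNIV::'n set). 2 ^ i * (a * b))"
    by (intro jet_bound_sum smooth_mult jet_bound_mult smooth_component smooth_tdiff jet_bound_component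
        jet_bound_tdiff assms norm_axis_1)
  then show ?thesis
    by (simp add: vf_apply_alt)
qed

text \<open>At x the value is 0, the first differential has norm at most 1 and all later ones
  vanish. Without centring, no bound would be uniform in x.\<close>

lemma jet_bound_centred_coordinate: "jet_bound i (\<lambda>y::real^'n. y $ j + - (x $ j)) x 1"
  unfolding jet_bound_def
proof (intro allI impI)
  fix Us :: "(real^'n) list" assume Us: "length Us \<le> i \<and> (\<forall>U\<in>set Us. norm U = 1)"
  have *: "tdiff (\<lambda>y::real^'n. y $ j + - (x $ j)) Us = (\<lambda>y. tdiff (\<lambda>y. y $ j) Us y + tdiff (\<lambda>y. - (x $ j)) Us y)"
    by (rule tdiff_add[OF smooth_coordinate smooth_const])
  show "norm (tdiff (\<lambda>y::real^'n. y $ j + - (x $ j)) Us x) \<le> 1"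
  proof (cases Us rule: remdups_adj.cases)
    case (2 U)
    have "norm (U $ j) \<le> 1"
      using Us 2 component_le_norm_cart[of U j] by simp
    then show ?thesis
      unfolding * unfolding 2 tdiff_coordinate_1 by (simp add: tdiff_const del: tdiff.simps(2))
  next
    case (3 U T Ts)
    show ?thesis
      unfolding * unfolding 3 tdiff_coordinate_ge_2 by (simp add: tdiff_const del: tdiff.simps(2))
  qed simp
qed

section \<open>Weights\<close>

definition weight_part :: "nat \<Rightarrow> 'd series \<Rightarrow> 'd series" where
  "weight_part k P = (\<lambda>w. if wdeg w = k then P w else 0)"

lemma finite_support_trunc: "finite (support (trunc m P :: 'd::finite series))"
  by (rule finite_subset[OF _ finite_words_wdeg[of m]]) (auto simp: support_def trunc_def)

lemma finite_support_weight_part: "finite (support (weight_part k P :: 'd::finite series))"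
  by (rule finite_subset[OF _ finite_words_wdeg[of k]]) (auto simp: support_def weight_part_def)

lemma weight_part_mult:
  "weight_part l (s_mult P Q) = (\<lambda>w. \<Sum>k\<le>l. s_mult (weight_part k P) (weight_part (l - k) Q) w)"
proof
  fix w
  have *: "(\<Sum>k\<le>l. weight_part k P (take i w) * weight_part (l - k) Q (drop i w)) =
      (if wdeg w = l then P (take i w) * Q (drop i w) else 0)" for i
  proof -
    have "(\<Sum>k\<le>l. weight_part k P (take i w) * weight_part (l - k) Q (drop i w)) =
        (\<Sum>k\<le>l. if k = wdeg (take i w) then (if wdeg (drop i w) = l - k then P (take i w) * Q (drop i w) else 0) else 0)"
      by (intro sum.cong) (auto simp: weight_part_def)
    then show ?thesis
      using wdeg_take_drop[of i w] by (auto simp: sum.delta)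
  qed
  have "(\<Sum>k\<le>l. s_mult (weight_part k P) (weight_part (l - k) Q) w) =
      (\<Sum>i\<le>length w. \<Sum>k\<le>l. weight_part k P (take i w) * weight_part (l - k) Q (drop i w))"
    unfolding s_mult_def by (rule sum.swap)
  also have "\<dots> = weight_part l (s_mult P Q) w"
    by (simp only: *) (simp add: weight_part_def s_mult_def)
  finally show "weight_part l (s_mult P Q) w = (\<Sum>k\<le>l. s_mult (weight_part k P) (weight_part (l - k) Q) w)" ..
qed

lemma trunc_s_mult_cong:
  assumes "trunc m P = trunc m P'" "trunc m Q = trunc m Q'"
  shows "trunc m (s_mult P Q) = trunc m (s_mult P' Q')"
proof -
  have "P u = P' u" "Q u = Q' u" if "wdeg u \<le> m" for u
    using that assms unfolding trunc_def by metis+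
  moreover have "wdeg (take k w) \<le> m" "wdeg (drop k w) \<le> m" if "wdeg w \<le> m" for k and w :: "'a word"
    using wdeg_take_drop[of k w] that by linarith+
  ultimately show ?thesis
    by (simp add: trunc_def s_mult_def fun_eq_iff)
qed

lemma trunc_trunc [simp]: "trunc m (trunc m P) = trunc m P"
  by (simp add: trunc_def fun_eq_iff)

lemma trunc_s_exp_trunc:
  assumes "P [] = 0"
  shows "trunc m (s_exp (trunc m P)) = trunc m (s_exp P)"
proof -
  have "trunc m (s_power (trunc m P) k) = trunc m (s_power P k)" for k
  proof (induction k)
    case (Suc k)
    show ?case
      unfolding s_power.simps by (rule trunc_s_mult_cong) (simp_all add: Suc)
  qed simp
  then have "s_power (trunc m P) k w = s_power P k w" if "wdeg w \<le> m" for w k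
    using that unfolding trunc_def by metis
  moreover have "trunc m P [] = 0"
    using assms by (simp add: trunc_def)
  ultimately show ?thesis
    using assms by (simp add: s_exp_eq_s_subst) (simp add: trunc_def s_subst_def fun_eq_iff)
qed

lemma weight_part_add: "weight_part l (\<lambda>w. P w + Q w) = (\<lambda>w. weight_part l P w + weight_part l Q w)"
  and weight_part_scale: "weight_part l (\<lambda>w. c * P w) = (\<lambda>w. c * weight_part l P w)"
  and weight_part_sum: "weight_part l (\<lambda>w. \<Sum>i\<in>I. R i w) = (\<lambda>w. \<Sum>i\<in>I. weight_part l (R i) w)"
  by (auto simp: weight_part_def)

lemma rescale_eq_sum:
  assumes "P = trunc m P"
  shows "rescale s P = (\<lambda>w. \<Sum>k\<le>m. s powr (real k / 2) * weight_part k P w)"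
proof
  fix w
  have "(\<Sum>k\<le>m. s powr (real k / 2) * weight_part k P w) =
      (\<Sum>k\<le>m. if wdeg w = k then s powr (real k / 2) * P w else 0)"
    by (intro sum.cong) (auto simp: weight_part_def)
  also have "\<dots> = rescale s P w"
    by (subst (1 2) assms) (auto simp: trunc_def rescale_def)
  finally show "rescale s P w = (\<Sum>k\<le>m. s powr (real k / 2) * weight_part k P w)" ..
qed

section \<open>Series whose components are bounded differential operators\<close>

text \<open>A bound for the substitution of P into a power series with coefficients in [-1, 1], if B
  bounds the weight parts of P: up to weight m only powers k \<le> m matter, and each factor costs B
  times at most m + 1 ways to split the weight.\<close>

definition exp_bound :: "nat \<Rightarrow> real \<Rightarrow> real" where
  "exp_bound m B = (\<Sum>k\<le>m. (real (Suc m) * B) ^ k)"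

context
  fixes V :: "'d::finite letter \<Rightarrow> real^'n \<Rightarrow> real^'n" and m :: nat
begin

text \<open>The operator may lose l derivatives. The restriction on i + l keeps the requirements
  within the derivatives of the vector fields up to order m. It reads \<open>Suc m\<close>, not m,
  so that a function produced by an operator of weight m still has one controlled derivative, on
  which a further vector field can act.\<close>

definition op_bound :: "nat \<Rightarrow> real \<Rightarrow> 'd series \<Rightarrow> bool" where
  "op_bound l B P \<longleftrightarrow> finite (support P) \<and> 0 \<le> B \<and>
    (\<forall>h x i b. smooth h \<longrightarrow> i + l \<le> Suc m \<longrightarrow> jet_bound (i + l) h x b \<longrightarrow> jet_bound i (Phi_op V P h) x (B * b))"

definition parts_bound :: "real \<Rightarrow> 'd series \<Rightarrow> bool" where
  "parts_bound B P \<longleftrightarrow> (\<forall>l\<le>m. op_bound l B (weight_part l P))"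

lemma op_boundD:
  "op_bound l B P \<Longrightarrow> smooth h \<Longrightarrow> i + l \<le> Suc m \<Longrightarrow> jet_bound (i + l) h x b \<Longrightarrow>
    jet_bound i (Phi_op V P h) x (B * b)"
  by (simp add: op_bound_def)

context
  assumes V: "\<And>a. smooth (V a)"
begin

lemma op_bound_one: "op_bound 0 1 s_one"
proof -
  have "support (s_one :: 'd series) = {[]}"
    by (auto simp: support_def s_one_def monomial_def)
  then show ?thesis
    by (simp add: op_bound_def Phi_op_one)
qed

lemma op_bound_zero: "0 \<le> B \<Longrightarrow> op_bound l B (\<lambda>w. 0)"
  using jet_bound_nonneg by (auto simp: op_bound_def Phi_op_zero finite_support_zero intro!: jet_bound_zero mult_nonneg_nonneg)

lemma op_bound_mono:
  assumes "op_bound l B P" "l \<le> l'" "B \<le> B'"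
  shows "op_bound l' B' P"
  unfolding op_bound_def
proof (intro conjI allI impI)
  fix h :: "real^'n \<Rightarrow> real" and x i b assume h: "smooth h" "i + l' \<le> Suc m" "jet_bound (i + l') h x b"
  then have "jet_bound i (Phi_op V P h) x (B * b)"
    using assms jet_bound_mono[OF h(3), of "i + l" b] by (auto simp: op_bound_def)
  then show "jet_bound i (Phi_op V P h) x (B' * b)"
    using assms(3) jet_bound_nonneg[OF h(3)] by (auto elim!: jet_bound_mono intro: mult_right_mono)
qed (use assms in \<open>auto simp: op_bound_def\<close>)

lemma op_bound_mult:
  assumes P: "op_bound l B P" and Q: "op_bound l' B' Q"
  shows "op_bound (l + l') (B * B') (s_mult P Q)"
  unfolding op_bound_def
proof (intro conjI allI impI)
  fix h :: "real^'n \<Rightarrow> real" and x i b assume h: "smooth h" "i + (l + l') \<le> Suc m" "jet_bound (i + (l + l')) h x b"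
  have "jet_bound (i + l) (Phi_op V Q h) x (B' * b)"
    using Q h by (auto simp: op_bound_def add.assoc)
  then have "jet_bound i (Phi_op V P (Phi_op V Q h)) x (B * (B' * b))"
    using P h smooth_Phi_op[of V, OF V h(1)] by (auto simp: op_bound_def)
  then show "jet_bound i (Phi_op V (s_mult P Q) h) x (B * B' * b)"
    using P Q by (simp add: Phi_op_mult[of V, OF V h(1)] op_bound_def mult.assoc)
qed (use assms in \<open>auto simp: op_bound_def finite_support_s_mult\<close>)

lemma op_bound_add:
  assumes P: "op_bound l B P" and Q: "op_bound l B' Q"
  shows "op_bound l (B + B') (\<lambda>w. P w + Q w)"
  using assms unfolding op_bound_def
  by (auto simp: Phi_op_add distrib_right finite_support_add
      intro!: jet_bound_add smooth_Phi_op[of V, OF V])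

lemma op_bound_scale:
  assumes P: "op_bound l B P"
  shows "op_bound l (\<bar>c\<bar> * B) (\<lambda>w. c * P w)"
  using assms unfolding op_bound_def
  by (auto simp: Phi_op_scale mult.assoc finite_support_scale
      intro!: jet_bound_scale smooth_Phi_op[of V, OF V])

lemma op_bound_sum:
  "(\<And>i. i \<in> I \<Longrightarrow> op_bound l (B i) (P i)) \<Longrightarrow> op_bound l (\<Sum>i\<in>I. B i) (\<lambda>w. \<Sum>i\<in>I. P i w)"
  by (induction I rule: infinite_finite_induct) (auto intro: op_bound_zero op_bound_add)

text \<open>A Lie polynomial loses one derivative whatever its weight; the constant comes from
  \<open>jet_bound_vf_apply\<close> with i \<le> m.\<close>

lemma op_bound_vector_field:
  assumes P: "P \<in> lie_polynomials" and \<kappa>: "\<And>x. jet_bound m (Phi V P) x \<kappa>"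
  shows "op_bound 1 (real CARD('n) * 2 ^ m * \<kappa>) P"
  unfolding op_bound_def
proof (intro conjI allI impI)
  note Phi = Phi_lie_polynomial[of V, OF V P]
  have nn: "0 \<le> \<kappa>"
    using \<kappa> jet_bound_nonneg by blast
  then show "0 \<le> real CARD('n) * 2 ^ m * \<kappa>"
    by simp
  fix h :: "real^'n \<Rightarrow> real" and x i b assume h: "smooth h" "i + 1 \<le> Suc m" "jet_bound (i + 1) h x b"
  have "jet_bound i (vf_apply (Phi V P) h) x (real CARD('n) * (2 ^ i * (\<kappa> * b)))"
    using h jet_bound_mono[OF \<kappa>, of i \<kappa>] by (intro jet_bound_vf_apply Phi) auto
  moreover have "real CARD('n) * (2 ^ i * (\<kappa> * b)) \<le> real CARD('n) * 2 ^ m * \<kappa> * b"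
    unfolding mult.assoc using h nn jet_bound_nonneg[OF h(3)]
    by (intro mult_left_mono mult_right_mono power_increasing) auto
  ultimately show "jet_bound i (Phi_op V P h) x (real CARD('n) * 2 ^ m * \<kappa> * b)"
    by (auto simp: Phi(3)[OF h(1)] elim: jet_bound_mono)
qed (rule Phi_lie_polynomial(1)[of V, OF V P])

lemma parts_bound_nonneg: "parts_bound B P \<Longrightarrow> 0 \<le> B"
  by (auto simp: parts_bound_def op_bound_def)

lemma parts_bound_one: "parts_bound 1 s_one"
proof -
  have "weight_part l (s_one :: 'd series) = (if l = 0 then s_one else (\<lambda>w. 0))" for l
  proof
    fix w show "weight_part l (s_one :: 'd series) w = (if l = 0 then s_one else (\<lambda>w. 0)) w"
      by (cases w) (auto simp: weight_part_def)
  qed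
  then show ?thesis
    using op_bound_one op_bound_zero by (auto simp: parts_bound_def)
qed

lemma parts_bound_mono: "parts_bound B P \<Longrightarrow> B \<le> B' \<Longrightarrow> parts_bound B' P"
  by (auto simp: parts_bound_def intro: op_bound_mono)

lemma parts_bound_trunc: "parts_bound B (trunc m P) \<longleftrightarrow> parts_bound B P"
proof -
  have "weight_part l (trunc m P) = weight_part l P" if "l \<le> m" for l
    using that by (auto simp: weight_part_def trunc_def fun_eq_iff)
  then show ?thesis
    by (auto simp: parts_bound_def)
qed

lemma parts_bound_add: "parts_bound B P \<Longrightarrow> parts_bound B' Q \<Longrightarrow> parts_bound (B + B') (\<lambda>w. P w + Q w)"
  by (auto simp: parts_bound_def weight_part_add intro: op_bound_add)

lemma parts_bound_scale: "parts_bound B P \<Longrightarrow> parts_bound (\<bar>c\<bar> * B) (\<lambda>w. c * P w)"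
  by (auto simp: parts_bound_def weight_part_scale intro: op_bound_scale)

lemma parts_bound_sum:
  "(\<And>i. i \<in> I \<Longrightarrow> parts_bound (B i) (P i)) \<Longrightarrow> parts_bound (\<Sum>i\<in>I. B i) (\<lambda>w. \<Sum>i\<in>I. P i w)"
  by (auto simp: parts_bound_def weight_part_sum intro: op_bound_sum)

lemma parts_bound_mult:
  assumes P: "parts_bound B P" and Q: "parts_bound B' Q"
  shows "parts_bound (real (Suc m) * (B * B')) (s_mult P Q)"
  unfolding parts_bound_def
proof (intro allI impI)
  fix l assume l: "l \<le> m"
  have "op_bound l (B * B') (s_mult (weight_part k P) (weight_part (l - k) Q))" if "k \<le> l" for k
    using op_bound_mult[of k B "weight_part k P" "l - k" B' "weight_part (l - k) Q"] that l P Q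
    by (simp add: parts_bound_def)
  then have "op_bound l (\<Sum>k\<le>l. B * B') (weight_part l (s_mult P Q))"
    unfolding weight_part_mult by (intro op_bound_sum) auto
  \<comment> \<open>The weight l \<le> m splits between the two factors in at most m + 1
    ways.\<close>
  moreover have "(\<Sum>k\<le>l. B * B') \<le> real (Suc m) * (B * B')"
    unfolding sum_constant card_atMost
    using l P[THEN parts_bound_nonneg] Q[THEN parts_bound_nonneg] by (intro mult_right_mono) auto
  ultimately show "op_bound l (real (Suc m) * (B * B')) (weight_part l (s_mult P Q))"
    by (rule op_bound_mono[OF _ order_refl])
qed

lemma parts_bound_power:
  assumes "parts_bound B P"
  shows "parts_bound ((real (Suc m) * B) ^ k) (s_power P k)"
proof (induction k)
  case (Suc k)
  then show ?case
    using parts_bound_mult[OF assms Suc] by (simp add: mult.assoc)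
qed (simp add: parts_bound_one)

text \<open>A word of weight at most m has at most m letters, so truncation leaves only the powers
  up to m. The condition on the coefficients covers both the logarithm and exp(t P) for t in
  [0, 1].\<close>

lemma parts_bound_s_subst:
  assumes P: "parts_bound B P" "P [] = 0" and F: "\<And>k. \<bar>fps_nth F k\<bar> \<le> 1"
  shows "parts_bound (exp_bound m B) (s_subst F P)"
proof -
  have "parts_bound (\<Sum>k\<le>m. \<bar>fps_nth F k\<bar> * (real (Suc m) * B) ^ k) (\<lambda>w. \<Sum>k\<le>m. fps_nth F k * s_power P k w)"
    by (intro parts_bound_sum parts_bound_scale parts_bound_power P)
  moreover have "(\<Sum>k\<le>m. \<bar>fps_nth F k\<bar> * (real (Suc m) * B) ^ k) \<le> exp_bound m B"
    unfolding exp_bound_def using F parts_bound_nonneg[OF P(1)] by (intro sum_mono mult_left_le_one_le) auto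
  ultimately have "parts_bound (exp_bound m B) (trunc m (\<lambda>w. \<Sum>k\<le>m. fps_nth F k * s_power P k w))"
    unfolding parts_bound_trunc by (rule parts_bound_mono)
  also have "trunc m (\<lambda>w. \<Sum>k\<le>m. fps_nth F k * s_power P k w) = trunc m (s_subst F P)"
    using length_le_wdeg order_trans
    by (fastforce simp: trunc_def fun_eq_iff intro!: s_subst_eq[of P, OF P(2), symmetric])
  finally show ?thesis
    unfolding parts_bound_trunc .
qed

lemma Phi_op_shift:
  assumes f: "smooth f" and P: "finite (support P)"
  shows "Phi_op V P (\<lambda>x. f x + c) = (\<lambda>x. Phi_op V P f x + P [] * c)"
proof
  fix x
  have "P w * word_op V w (\<lambda>x. f x + c) x = P w * word_op V w f x + (if w = [] then P [] * c else 0)" for w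
    by (cases "w = []") (simp_all add: word_op_shift[of V, OF V f] distrib_left)
  then show "Phi_op V P (\<lambda>x. f x + c) x = Phi_op V P f x + P [] * c"
    using P by (simp add: Phi_op_def sum.distrib sum.delta) (simp add: support_def)
qed

end

end

section \<open>Expansion of flows\<close>

text \<open>The differential equation of exp(t P). At a fixed word the exponential is a polynomial
  in t, so it is differentiated term by term.\<close>

lemma s_subst_fps_exp_deriv:
  assumes "P [] = 0"
  shows "((\<lambda>\<tau>. s_subst (fps_exp \<tau>) P w) has_real_derivative s_mult P (s_subst (fps_exp \<tau>) P) w) (at \<tau>)"
proof -
  let ?n = "length w"
  have "s_mult P (s_subst (fps_exp \<tau>) P) w = s_mult P (\<lambda>v. \<Sum>k\<le>?n. (\<tau> ^ k / fact k) * s_power P k v) w"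
    unfolding s_mult_def using s_subst_eq[of P _ ?n, OF assms] by (intro sum.cong refl) simp
  also have "\<dots> = (\<Sum>k\<le>?n. (\<tau> ^ k / fact k) * s_power P (Suc k) w)"
    unfolding s_mult_sum_right s_mult_scale_right by simp
  also have "\<dots> = (\<Sum>k<?n. (\<tau> ^ k / fact k) * s_power P (Suc k) w)"
    using s_power_eq_0[of P w, OF assms] by (simp add: lessThan_Suc_atMost[symmetric] del: s_power.simps)
  finally have eq: "s_mult P (s_subst (fps_exp \<tau>) P) w = (\<Sum>k<?n. (\<tau> ^ k / fact k) * s_power P (Suc k) w)" .
  have "((\<lambda>\<tau>. \<Sum>k\<le>?n. (\<tau> ^ k / fact k) * s_power P k w) has_real_derivative
      (\<Sum>k\<le>?n. (real k * \<tau> ^ (k - 1) / fact k) * s_power P k w)) (at \<tau>)"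
    by (auto intro!: derivative_eq_intros)
  also have "(\<Sum>k\<le>?n. (real k * \<tau> ^ (k - 1) / fact k) * s_power P k w) =
      (\<Sum>k<?n. (\<tau> ^ k / fact k) * s_power P (Suc k) w)"
  proof (cases ?n)
    case (Suc n)
    show ?thesis
      unfolding Suc sum.atMost_Suc_shift lessThan_Suc_atMost
      by (simp del: s_power.simps of_nat_Suc)
  qed simp
  finally have "((\<lambda>\<tau>. \<Sum>k\<le>?n. (\<tau> ^ k / fact k) * s_power P k w) has_real_derivative
      (\<Sum>k<?n. (\<tau> ^ k / fact k) * s_power P (Suc k) w)) (at \<tau>)" .
  moreover have "(\<lambda>\<tau>. s_subst (fps_exp \<tau>) P w) = (\<lambda>\<tau>. \<Sum>k\<le>?n. (\<tau> ^ k / fact k) * s_power P k w)"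
    by (simp add: s_subst_def fun_eq_iff)
  ultimately show ?thesis
    by (simp only: eq)
qed

text \<open>The squared factor counts the pairs of weights up to m. N * B * B'' bounds each product
  of parts, with B'' = (m + 1) * exp_bound m B * B' the bound for exp(t P) G.\<close>

definition taylor_bound :: "nat \<Rightarrow> nat \<Rightarrow> real \<Rightarrow> real \<Rightarrow> real" where
  "taylor_bound N m B B' = (real (Suc m))\<^sup>2 * (real N * B * (real (Suc m) * (exp_bound m B * B')))"

lemma rescale_primitive_in_lie_polynomials:
  fixes P :: "'d::finite series"
  assumes "primitive P" "P = trunc m P"
  shows "weight_part k P \<in> lie_polynomials" "rescale s P \<in> lie_polynomials"
proof -
  show *: "weight_part k P \<in> lie_polynomials" for k
    using primitive_filter_wdeg[OF assms(1), of "\<lambda>n. n = k"] finite_support_weight_part[of k P]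
    by (intro primitive_in_lie_polynomials) (simp_all add: weight_part_def)
  show "rescale s P \<in> lie_polynomials"
    unfolding rescale_eq_sum[OF assms(2), of s]
    by (intro lie_polynomials_sum lie_polynomials.scale *) simp
qed

context
  fixes V :: "'d::finite letter \<Rightarrow> real^'n \<Rightarrow> real^'n" and m :: nat
  assumes V: "\<And>a. smooth (V a)"
begin

lemma Phi_op_rescale:
  "Phi_op V (rescale s (trunc m R)) f x = (\<Sum>k\<le>m. s powr (real k / 2) * Phi_op V (weight_part k R) f x)"
proof -
  have *: "weight_part k (trunc m R) = weight_part k R" if "k \<le> m" for k
    using that by (auto simp: weight_part_def trunc_def fun_eq_iff)
  have "Phi_op V (rescale s (trunc m R)) f x =
      (\<Sum>k\<le>m. s powr (real k / 2) * Phi_op V (weight_part k (trunc m R)) f x)"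
    by (subst rescale_eq_sum[of _ m])
      (simp_all add: Phi_op_sum Phi_op_scale finite_support_scale finite_support_weight_part)
  then show ?thesis
    by (simp add: *)
qed

text \<open>The sum k + l may exceed m + 1, so \<open>op_bound_mult\<close> does not apply. Instead,
  the weight part of P is a vector field, and only its value at x and the first derivatives of the
  inner function enter.\<close>

lemma Phi_op_product_bound:
  assumes P: "primitive P" "P = trunc m P" "parts_bound V m B P"
    and H: "parts_bound V m B' H" and k: "k \<le> m" and l: "l \<le> m"
  shows "\<bar>Phi_op V (weight_part k P) (Phi_op V (weight_part l H) (\<lambda>y. y $ j)) x\<bar> \<le> real CARD('n) * B * B'"
proof -
  note lie = rescale_primitive_in_lie_polynomials(1)[OF P(1,2), of k]
  note Phi = Phi_lie_polynomial[of V, OF V lie]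
  let ?X = "Phi V (weight_part k P)"
  let ?f = "\<lambda>i y. y $ i + - (x $ i)"
  have sm: "smooth (?f i)" for i
    by (intro smooth_add smooth_coordinate smooth_const)
  have P0: "weight_part k P [] = 0"
    using primitive_Nil[OF P(1)] by (simp add: weight_part_def)
  have shift: "Phi_op V R (?f i) = (\<lambda>y. Phi_op V R (\<lambda>y. y $ i) y + R [] * - (x $ i))"
    if "finite (support R)" for R i
    by (rule Phi_op_shift[of V, OF V smooth_coordinate that])
  \<comment> \<open>The components of the field at x are the operator applied to centred
    coordinates; its constant term is zero, so centring changes nothing.\<close>
  have X: "\<bar>?X x $ i\<bar> \<le> B" for i
  proof -
    have "jet_bound 0 (Phi_op V (weight_part k P) (?f i)) x (B * 1)"
      using P(3) k by (intro op_boundD[where l = k] sm jet_bound_centred_coordinate) (auto simp: parts_bound_def)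
    then have "jet_bound 0 (Phi_op V (weight_part k P) (\<lambda>y. y $ i)) x B"
      unfolding shift[OF Phi(1)] P0 by simp
    then show ?thesis
      unfolding jet_bound_def Phi(4) by simp
  qed
  define g where "g = Phi_op V (weight_part l H) (?f j)"
  have g: "smooth g"
    unfolding g_def by (rule smooth_Phi_op[of V, OF V sm])
  have "jet_bound 1 g x (B' * 1)"
    unfolding g_def using H l
    by (intro op_boundD[where l = l] sm jet_bound_centred_coordinate) (auto simp: parts_bound_def)
  then have dg: "\<bar>tdiff g [axis i 1] x\<bar> \<le> B'" for i
    unfolding jet_bound_def by (auto simp: norm_axis_1 simp del: tdiff.simps)
  have "vf_apply ?X g = Phi_op V (weight_part k P) (\<lambda>y. Phi_op V (weight_part l H) (\<lambda>y. y $ j) y + weight_part l H [] * - (x $ j))"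
    unfolding Phi(3)[OF g, symmetric] unfolding g_def shift[OF finite_support_weight_part] ..
  also have "\<dots> = Phi_op V (weight_part k P) (Phi_op V (weight_part l H) (\<lambda>y. y $ j))"
    by (subst Phi_op_shift[of V, OF V smooth_Phi_op[of V, OF V smooth_coordinate] Phi(1)]) (simp add: P0)
  finally have "\<bar>Phi_op V (weight_part k P) (Phi_op V (weight_part l H) (\<lambda>y. y $ j)) x\<bar> = \<bar>vf_apply ?X g x\<bar>"
    by simp
  also have "\<dots> \<le> (\<Sum>i\<in>UNIV. \<bar>?X x $ i * tdiff g [axis i 1] x\<bar>)"
    unfolding vf_apply_alt by (rule sum_abs)
  also have "\<dots> \<le> (\<Sum>i\<in>(UNIV :: 'n set). B * B')"
    unfolding abs_mult
    by (intro sum_mono mult_mono X dg) (use X[THEN order_trans[OF abs_ge_zero]] in auto)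
  finally show ?thesis
    by simp
qed

text \<open>Truncating the factors keeps the square of pairs of weights, truncating the product the
  triangle k + l \<le> m. Every pair in the difference carries s^((k+l)/2) with k + l > m, and s
  \<le> 1.\<close>

lemma truncation_error:
  assumes P: "primitive P" "P = trunc m P" "parts_bound V m B P"
    and H: "parts_bound V m B' H" and s: "0 < s" "s \<le> 1"
  shows "\<bar>Phi_op V (rescale s P) (Phi_op V (rescale s (trunc m H)) (\<lambda>y. y $ j)) x
      - Phi_op V (rescale s (trunc m (s_mult P H))) (\<lambda>y. y $ j) x\<bar>
    \<le> (real (Suc m))\<^sup>2 * (real CARD('n) * B * B') * s powr (real (m + 1) / 2)"
proof -
  let ?f = "\<lambda>y :: real^'n. y $ j"
  define a where "a k l = Phi_op V (weight_part k P) (Phi_op V (weight_part l H) ?f) x" for k l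
  define \<sigma> where "\<sigma> k = s powr (real k / 2)" for k
  have \<sigma>: "\<sigma> (k + l) = \<sigma> k * \<sigma> l" for k l
    by (simp add: \<sigma>_def powr_add[symmetric] add_divide_distrib)
  let ?T = "{(k, l). k + l \<le> m}" and ?Q = "{..m} \<times> {..m}"
  have lie: "weight_part k P \<in> lie_polynomials" for k
    using P(1,2) by (rule rescale_primitive_in_lie_polynomials)
  have "Phi_op V (weight_part k P) (Phi_op V (rescale s (trunc m H)) ?f) x = (\<Sum>l\<le>m. \<sigma> l * a k l)" for k
  proof -
    have eq: "Phi_op V (rescale s (trunc m H)) ?f = (\<lambda>x. \<Sum>l\<le>m. \<sigma> l * Phi_op V (weight_part l H) ?f x)"
      by (simp add: fun_eq_iff Phi_op_rescale \<sigma>_def)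
    have sm: "smooth (Phi_op V R ?f)" for R
      by (rule smooth_Phi_op[of V, OF V smooth_coordinate])
    show ?thesis
      unfolding eq a_def
      by (simp add: Phi_lie_polynomial(3)[of V, OF V lie] smooth_sum smooth_scale sm vf_apply_sum vf_apply_scale)
  qed
  then have "Phi_op V (rescale s P) (Phi_op V (rescale s (trunc m H)) ?f) x = (\<Sum>k\<le>m. \<sigma> k * (\<Sum>l\<le>m. \<sigma> l * a k l))"
    using Phi_op_rescale[of s P] P(2) by (simp add: \<sigma>_def)
  also have "\<dots> = (\<Sum>(k, l)\<in>?Q. \<sigma> (k + l) * a k l)"
    by (simp add: \<sigma> sum_distrib_left mult.assoc sum.cartesian_product)
  finally have 1: "Phi_op V (rescale s P) (Phi_op V (rescale s (trunc m H)) ?f) x = (\<Sum>(k, l)\<in>?Q. \<sigma> (k + l) * a k l)" .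
  have "Phi_op V (weight_part n (s_mult P H)) ?f x = (\<Sum>k\<le>n. a k (n - k))" for n
    unfolding weight_part_mult a_def
    by (simp add: Phi_op_sum finite_support_s_mult finite_support_weight_part
        Phi_op_mult[of V, OF V smooth_coordinate])
  then have 2: "Phi_op V (rescale s (trunc m (s_mult P H))) ?f x = (\<Sum>(k, l)\<in>?T. \<sigma> (k + l) * a k l)"
    unfolding sum.triangle_reindex_eq by (simp add: Phi_op_rescale \<sigma>_def[symmetric] sum_distrib_left)
  have "(\<Sum>(k, l)\<in>?Q. \<sigma> (k + l) * a k l) - (\<Sum>(k, l)\<in>?T. \<sigma> (k + l) * a k l) =
      (\<Sum>(k, l)\<in>?Q - ?T. \<sigma> (k + l) * a k l)"
    by (subst sum_diff) auto
  then have "\<bar>Phi_op V (rescale s P) (Phi_op V (rescale s (trunc m H)) ?f) x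
      - Phi_op V (rescale s (trunc m (s_mult P H))) ?f x\<bar> = \<bar>\<Sum>p\<in>?Q - ?T. \<sigma> (fst p + snd p) * a (fst p) (snd p)\<bar>"
    by (simp add: 1 2 case_prod_unfold)
  also have "\<dots> \<le> (\<Sum>p\<in>?Q - ?T. \<bar>\<sigma> (fst p + snd p) * a (fst p) (snd p)\<bar>)"
    by (rule sum_abs)
  also have "\<dots> \<le> (\<Sum>p\<in>?Q - ?T. \<sigma> (m + 1) * (real CARD('n) * B * B'))"
  proof (rule sum_mono)
    fix p assume p: "p \<in> ?Q - ?T"
    have "\<sigma> (fst p + snd p) \<le> \<sigma> (m + 1)"
      unfolding \<sigma>_def using p s by (intro powr_mono') auto
    moreover have "\<bar>a (fst p) (snd p)\<bar> \<le> real CARD('n) * B * B'"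
      unfolding a_def using p by (intro Phi_op_product_bound P H) auto
    ultimately show "\<bar>\<sigma> (fst p + snd p) * a (fst p) (snd p)\<bar> \<le> \<sigma> (m + 1) * (real CARD('n) * B * B')"
      unfolding abs_mult by (intro mult_mono) (auto simp: \<sigma>_def)
  qed
  also have "\<dots> = real (card (?Q - ?T)) * (\<sigma> (m + 1) * (real CARD('n) * B * B'))"
    by simp
  also have "\<dots> \<le> (real (Suc m))\<^sup>2 * (\<sigma> (m + 1) * (real CARD('n) * B * B'))"
  proof (rule mult_right_mono)
    have "card (?Q - ?T) \<le> card ?Q"
      by (intro card_mono) auto
    then have "real (card (?Q - ?T)) \<le> real (card ?Q)"
      by (rule of_nat_mono)
    then show "real (card (?Q - ?T)) \<le> (real (Suc m))\<^sup>2"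
      by (simp add: card_cartesian_product power2_eq_square algebra_simps)
  qed (use parts_bound_nonneg[of V, OF V P(3)] parts_bound_nonneg[of V, OF V H] in \<open>simp add: \<sigma>_def\<close>)
  finally show ?thesis
    by (simp add: \<sigma>_def mult_ac)
qed

text \<open>Along a solution \<open>z\<close> of \<open>z' = \<Phi>(\<Psi>\<^sub>s(P))(z)\<close>, the function \<open>\<Phi>(\<Psi>\<^sub>s(j\<^sub>m(exp((1 - t)P) G))) f (z t)\<close>
  interpolates between the two sides, and only terms of weight larger than \<open>m\<close> survive in its
  derivative.\<close>

lemma flow_expansion:
  assumes P: "primitive P" "P = trunc m P" "parts_bound V m B P"
    and G: "parts_bound V m B' G" and s: "0 < s" "s \<le> 1"
    and L: "\<And>x y. norm (Phi V (rescale s P) x - Phi V (rescale s P) y) \<le> L * norm (x - y)"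
  shows "\<bar>Phi_op V (rescale s (trunc m G)) (\<lambda>y. y $ j) (vf_exp (Phi V (rescale s P)) x)
      - Phi_op V (rescale s (trunc m (s_mult (s_exp P) G))) (\<lambda>y. y $ j) x\<bar>
    \<le> taylor_bound CARD('n) m B B' * s powr (real (m + 1) / 2)"
proof -
  let ?f = "\<lambda>y :: real^'n. y $ j" and ?W = "Phi V (rescale s P)"
  have P0: "P [] = 0"
    using P(1) by (rule primitive_Nil)
  note lie = rescale_primitive_in_lie_polynomials(2)[OF P(1,2), of s]
  define H where "H \<tau> = s_mult (s_subst (fps_exp \<tau>) P) G" for \<tau>
  obtain z where z: "ode_solution ?W z" "z 0 = x" "z 1 = vf_exp ?W x"
    using vf_exp_solution[OF L] by metis
  let ?S = "{w :: 'd word. wdeg w \<le> m}"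
  define r where "r w = s powr (real (wdeg w) / 2)" for w :: "'d word"
  have Phi_eq: "Phi_op V (rescale s (trunc m R)) g y = (\<Sum>w\<in>?S. r w * R w * word_op V w g y)" for R g y
  proof -
    have "Phi_op V (rescale s (trunc m R)) g y = (\<Sum>w\<in>?S. rescale s (trunc m R) w * word_op V w g y)"
      by (rule Phi_op_eq[OF finite_words_wdeg]) (auto simp: support_def rescale_def trunc_def)
    then show ?thesis
      by (simp add: rescale_def trunc_def r_def)
  qed
  have dH: "((\<lambda>\<tau>. H \<tau> w) has_real_derivative s_mult P (H \<tau>) w) (at \<tau>)" for \<tau> w
    unfolding H_def s_mult_assoc[symmetric] unfolding s_mult_def[of _ G]
    by (intro DERIV_sum DERIV_cmult_right s_subst_fps_exp_deriv P0)
  define \<phi> where "\<phi> t = Phi_op V (rescale s (trunc m (H (1 - t)))) ?f (z t)" for t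
  \<comment> \<open>The first term comes from the motion of \<open>z\<close>, the second from the
    derivative of \<open>H\<close>. Since left multiplication by P corresponds to applying the
    vector field, they differ only by truncation.\<close>
  define \<phi>' where "\<phi>' t = Phi_op V (rescale s P) (Phi_op V (rescale s (trunc m (H (1 - t)))) ?f) (z t)
      - Phi_op V (rescale s (trunc m (s_mult P (H (1 - t))))) ?f (z t)" for t
  have sm: "smooth (word_op V w ?f)" for w
    by (rule smooth_word_op[of V, OF V smooth_coordinate])
  have d\<phi>: "(\<phi> has_real_derivative \<phi>' t) (at t within {0..1})" if t: "t \<in> {0..1}" for t
  proof -
    have dz: "(z has_derivative (\<lambda>h. h *\<^sub>R ?W (z t))) (at t within {0..1})"
      using z(1) t by (simp add: ode_solution_def has_vector_derivative_def)
    have dword: "((\<lambda>t. word_op V w ?f (z t)) has_real_derivative vf_apply ?W (word_op V w ?f) (z t)) (at t within {0..1})" for w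
    proof -
      note hd = smooth_has_derivative[OF sm[of w], of "z t"]
      have "((\<lambda>t. word_op V w ?f (z t)) has_derivative
          (\<lambda>h. frechet_derivative (word_op V w ?f) (at (z t)) (h *\<^sub>R ?W (z t)))) (at t within {0..1})"
        by (rule has_derivative_compose[OF dz hd])
      then show ?thesis
        using has_derivative_linear[OF hd]
        by (simp add: has_field_derivative_def linear_cmul mult_commute_abs vf_apply_eq_derivative[OF sm])
    qed
    have dH': "((\<lambda>t. H (1 - t) w) has_real_derivative - s_mult P (H (1 - t)) w) (at t within {0..1})" for w
    proof -
      have "((\<lambda>t. H (1 - t) w) has_real_derivative s_mult P (H (1 - t)) w * (0 - 1)) (at t within {0..1})"
        by (rule DERIV_chain2[OF dH]) (auto intro!: derivative_eq_intros)
      then show ?thesis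
        by simp
    qed
    have "(\<phi> has_real_derivative (\<Sum>w\<in>?S. r w * (H (1 - t) w * vf_apply ?W (word_op V w ?f) (z t)
        + - s_mult P (H (1 - t)) w * word_op V w ?f (z t)))) (at t within {0..1})"
      unfolding \<phi>_def Phi_eq mult.assoc
      by (intro DERIV_sum DERIV_cmult DERIV_mult' dH' dword)
    also have "(\<Sum>w\<in>?S. r w * (H (1 - t) w * vf_apply ?W (word_op V w ?f) (z t)
        + - s_mult P (H (1 - t)) w * word_op V w ?f (z t))) = \<phi>' t"
    proof -
      have eq: "Phi_op V (rescale s (trunc m (H (1 - t)))) ?f =
          (\<lambda>y. \<Sum>w\<in>?S. r w * H (1 - t) w * word_op V w ?f y)"
        by (simp add: fun_eq_iff Phi_eq)
      have "Phi_op V (rescale s P) (Phi_op V (rescale s (trunc m (H (1 - t)))) ?f) (z t) =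
          (\<Sum>w\<in>?S. r w * H (1 - t) w * vf_apply ?W (word_op V w ?f) (z t))"
        unfolding eq
        by (simp add: Phi_lie_polynomial(3)[of V, OF V lie] smooth_sum smooth_scale sm vf_apply_sum vf_apply_scale)
      then show ?thesis
        unfolding \<phi>'_def by (simp add: Phi_eq sum_subtractf[symmetric] algebra_simps)
    qed
    finally show ?thesis .
  qed
  have bound: "norm (\<phi>' t) \<le> taylor_bound CARD('n) m B B' * s powr (real (m + 1) / 2)" if t: "t \<in> {0..1}" for t
  proof -
    \<comment> \<open>These coefficients are (1 - t)^k / k!, as \<open>parts_bound_s_subst\<close>
      requires.\<close>
    have "\<bar>fps_nth (fps_exp (1 - t)) k\<bar> \<le> 1" for k
    proof -
      have "(1 - t) ^ k \<le> 1"
        using t by (intro power_le_one) auto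
      also have "\<dots> \<le> fact k"
        by (rule fact_ge_1)
      finally show ?thesis
        using t by (simp add: abs_mult power_abs)
    qed
    then have "parts_bound V m (exp_bound m B) (s_subst (fps_exp (1 - t)) P)"
      by (intro parts_bound_s_subst[of V, OF V P(3) P0])
    then have "parts_bound V m (real (Suc m) * (exp_bound m B * B')) (H (1 - t))"
      unfolding H_def by (rule parts_bound_mult[of V, OF V _ G])
    from truncation_error[OF P this s, of j "z t"] show ?thesis
      by (simp only: \<phi>'_def taylor_bound_def real_norm_def)
  qed
  have "norm (\<phi> 1 - \<phi> 0) \<le> taylor_bound CARD('n) m B B' * s powr (real (m + 1) / 2) * norm (1 - 0 :: real)"
    by (rule field_differentiable_bound[of "{0..1}" \<phi> \<phi>']) (use d\<phi> bound in auto)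
  moreover have "H 0 = G"
  proof -
    have "s_subst (fps_exp 0) P = s_one"
      by simp
    then show ?thesis
      by (simp add: H_def)
  qed
  moreover have "H 1 = s_mult (s_exp P) G"
    by (simp add: H_def s_exp_eq_s_subst[of P, OF P0])
  ultimately show ?thesis
    by (simp add: \<phi>_def z)
qed

end

section \<open>The norms of vector fields\<close>

lemma unit_tuples_nonempty: "unit_tuples i \<noteq> ({} :: (real^'n) list set)"
proof -
  have "replicate i (axis undefined 1 :: real^'n) \<in> unit_tuples i"
    by (auto simp: unit_tuples_def norm_axis_1)
  then show ?thesis
    by blast
qed

lemma Cb_infinity_smooth: "W \<in> Cb_infinity \<Longrightarrow> smooth W"
  by (simp add: Cb_infinity_def)

lemma norm_tdiff_le_diff_norm:
  assumes "W \<in> Cb_infinity" "Us \<in> unit_tuples i"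
  shows "norm (tdiff W Us x) \<le> diff_norm i W"
proof -
  obtain b where b: "\<And>y Ts. Ts \<in> unit_tuples i \<Longrightarrow> norm (tdiff W Ts y) \<le> b"
    using assms(1) unfolding Cb_infinity_def bounded_iff by blast
  have "norm (tdiff W (snd (x, Us)) (fst (x, Us))) \<le> (SUP p \<in> UNIV \<times> unit_tuples i. norm (tdiff W (snd p) (fst p)))"
    using assms(2) b by (intro cSUP_upper bdd_aboveI2[of _ _ b]) auto
  then show ?thesis
    by (simp add: diff_norm_def case_prod_unfold)
qed

lemma diff_norm_le:
  fixes W :: "real^'n \<Rightarrow> real^'n"
  assumes "\<And>x Us. Us \<in> unit_tuples i \<Longrightarrow> norm (tdiff W Us x) \<le> b"
  shows "diff_norm i W \<le> b"
  unfolding diff_norm_def using unit_tuples_nonempty assms by (intro cSUP_least) auto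

lemma diff_norm_nonneg:
  fixes W :: "real^'n \<Rightarrow> real^'n"
  assumes "W \<in> Cb_infinity"
  shows "0 \<le> diff_norm i W"
proof -
  obtain Us :: "(real^'n) list" where "Us \<in> unit_tuples i"
    using unit_tuples_nonempty by blast
  from norm_tdiff_le_diff_norm[OF assms this] show ?thesis
    using norm_ge_zero order_trans by blast
qed

lemma C_norm_nonneg: "W \<in> Cb_infinity \<Longrightarrow> 0 \<le> C_norm n W"
  unfolding C_norm_def by (intro sum_nonneg diff_norm_nonneg)

lemma jet_bound_C_norm:
  assumes W: "W \<in> Cb_infinity" and "i \<le> n"
  shows "jet_bound i W x (C_norm n W)"
  unfolding jet_bound_def
proof (intro allI impI)
  fix Us :: "(real^'a) list" assume Us: "length Us \<le> i \<and> (\<forall>U\<in>set Us. norm U = 1)"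
  have "norm (tdiff W Us x) \<le> diff_norm (length Us) W"
    using Us by (intro norm_tdiff_le_diff_norm W) (simp add: unit_tuples_def)
  also have "\<dots> \<le> C_norm n W"
    unfolding C_norm_def using Us \<open>i \<le> n\<close> diff_norm_nonneg[OF W]
    by (intro member_le_sum) auto
  finally show "norm (tdiff W Us x) \<le> C_norm n W" .
qed

lemma C_norm_sum_le:
  fixes W :: "'i \<Rightarrow> real^'n \<Rightarrow> real^'n"
  assumes I: "finite I" and W: "\<And>i. i \<in> I \<Longrightarrow> W i \<in> Cb_infinity"
  shows "C_norm n (\<lambda>x. \<Sum>i\<in>I. c i *\<^sub>R W i x) \<le> (\<Sum>i\<in>I. \<bar>c i\<bar> * C_norm n (W i))"
proof -
  have "diff_norm l (\<lambda>x. \<Sum>i\<in>I. c i *\<^sub>R W i x) \<le> (\<Sum>i\<in>I. \<bar>c i\<bar> * diff_norm l (W i))" for l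
  proof (rule diff_norm_le)
    fix x and Us :: "(real^'n) list" assume Us: "Us \<in> unit_tuples l"
    have "tdiff (\<lambda>x. \<Sum>i\<in>I. c i *\<^sub>R W i x) Us = (\<lambda>x. \<Sum>i\<in>I. tdiff (\<lambda>x. c i *\<^sub>R W i x) Us x)"
      using I W by (intro tdiff_sum smooth_bounded_linear[OF bounded_linear_scaleR_right] Cb_infinity_smooth) auto
    also have "\<dots> = (\<lambda>x. \<Sum>i\<in>I. c i *\<^sub>R tdiff (W i) Us x)"
      using W by (auto intro!: sum.cong simp: tdiff_bounded_linear[OF bounded_linear_scaleR_right] Cb_infinity_smooth)
    finally have "norm (tdiff (\<lambda>x. \<Sum>i\<in>I. c i *\<^sub>R W i x) Us x) \<le> (\<Sum>i\<in>I. norm (c i *\<^sub>R tdiff (W i) Us x))"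
      by (simp only: norm_sum)
    also have "\<dots> \<le> (\<Sum>i\<in>I. \<bar>c i\<bar> * diff_norm l (W i))"
      using W Us by (auto intro!: sum_mono mult_left_mono norm_tdiff_le_diff_norm)
    finally show "norm (tdiff (\<lambda>x. \<Sum>i\<in>I. c i *\<^sub>R W i x) Us x) \<le> (\<Sum>i\<in>I. \<bar>c i\<bar> * diff_norm l (W i))" .
  qed
  then have "C_norm n (\<lambda>x. \<Sum>i\<in>I. c i *\<^sub>R W i x) \<le> (\<Sum>l\<le>n. \<Sum>i\<in>I. \<bar>c i\<bar> * diff_norm l (W i))"
    unfolding C_norm_def by (intro sum_mono)
  also have "\<dots> = (\<Sum>i\<in>I. \<bar>c i\<bar> * C_norm n (W i))"
    unfolding C_norm_def sum_distrib_left by (rule sum.swap)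
  finally show ?thesis .
qed

lemma Cb_infinity_lipschitz:
  fixes W :: "real^'n \<Rightarrow> real^'n"
  assumes W: "W \<in> Cb_infinity" and n: "1 \<le> n"
  shows "norm (W x - W y) \<le> C_norm n W * norm (x - y)"
proof (rule differentiable_bound[of UNIV W "\<lambda>x. frechet_derivative W (at x)"])
  fix x
  show hd: "(W has_derivative frechet_derivative W (at x)) (at x within UNIV)"
    using smooth_has_derivative[OF Cb_infinity_smooth[OF W]] by simp
  show "onorm (frechet_derivative W (at x)) \<le> C_norm n W"
  proof (rule onorm_le)
    fix v
    show "norm (frechet_derivative W (at x) v) \<le> C_norm n W * norm v"
    proof (cases "v = 0")
      case True
      then show ?thesis
        using linear_0[OF has_derivative_linear[OF hd]] by simp
    next
      case False
      define u where "u = (1 / norm v) *\<^sub>R v"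
      have u: "norm u = 1" "v = norm v *\<^sub>R u"
        using False by (simp_all add: u_def)
      have "norm (tdiff W [u] x) \<le> C_norm n W"
        using jet_bound_C_norm[OF W n, of x] u(1) unfolding jet_bound_def by (auto simp del: tdiff.simps)
      then have "norm v * norm (frechet_derivative W (at x) u) \<le> norm v * C_norm n W"
        by (intro mult_left_mono) auto
      moreover have "frechet_derivative W (at x) v = norm v *\<^sub>R frechet_derivative W (at x) u"
        by (subst u(2)) (rule linear_cmul[OF has_derivative_linear[OF hd]])
      ultimately show ?thesis
        by (simp add: mult.commute)
    qed
  qed
qed auto

text \<open>A qualitative bound for membership in \<open>Cb_infinity\<close>: it may depend on i and
  w, but not on the point.\<close>

lemma word_op_jet_bound:
  fixes V :: "'d letter \<Rightarrow> real^'n \<Rightarrow> real^'n"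
  assumes V: "\<And>a. V a \<in> Cb_infinity"
  shows "\<exists>B\<ge>0. \<forall>h x b. smooth h \<longrightarrow> jet_bound (i + length w) h x b \<longrightarrow> jet_bound i (word_op V w h) x (B * b)"
proof (induction w arbitrary: i)
  case Nil
  then show ?case
    by (intro exI[of _ 1]) simp
next
  case (Cons a w)
  obtain B where B: "B \<ge> 0" "\<And>h x b. smooth h \<Longrightarrow> jet_bound (Suc i + length w) h x b \<Longrightarrow>
      jet_bound (Suc i) (word_op V w h) x (B * b)"
    using Cons[of "Suc i"] by blast
  let ?A = "C_norm i (V a)"
  have "jet_bound i (vf_apply (V a) (word_op V w h)) x (real CARD('n) * 2 ^ i * ?A * B * b)"
    if "smooth h" "jet_bound (i + length (a # w)) h x b" for h x b
  proof -
    have "jet_bound i (vf_apply (V a) (word_op V w h)) x (real CARD('n) * (2 ^ i * (?A * (B * b))))"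
      using that by (intro jet_bound_vf_apply jet_bound_C_norm B smooth_word_op Cb_infinity_smooth V) auto
    then show ?thesis
      by (simp only: mult.assoc)
  qed
  then show ?case
    using B(1) C_norm_nonneg[OF V] by (intro exI[of _ "real CARD('n) * 2 ^ i * ?A * B"]) auto
qed

text \<open>Integration schemes and norms are controlled on \<open>Cb_infinity\<close> only. As P
  has no constant term, the components of the field can be read off from centred coordinates, with
  bounds uniform in x.\<close>

lemma Phi_in_Cb_infinity:
  fixes V :: "'d letter \<Rightarrow> real^'n \<Rightarrow> real^'n"
  assumes V: "\<And>a. V a \<in> Cb_infinity" and P: "P \<in> lie_polynomials"
  shows "Phi V P \<in> Cb_infinity"
proof -
  have sV: "smooth (V a)" for a
    using V by (rule Cb_infinity_smooth)
  note Phi = Phi_lie_polynomial[of V, OF sV P]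
  have P0: "P [] = 0"
    using P by (intro primitive_Nil primitive_lie_polynomials)
  have "\<exists>b. \<forall>x. \<forall>Us\<in>unit_tuples i. norm (tdiff (Phi V P) Us x) \<le> b" for i
  proof -
    obtain B where B: "\<And>w h x b. smooth h \<Longrightarrow> jet_bound (i + length w) h x b \<Longrightarrow> jet_bound i (word_op V w h) x (B w * b)"
      using word_op_jet_bound[of V, OF V, of i] by metis
    have "norm (tdiff (Phi V P) Us x) \<le> (\<Sum>j\<in>(UNIV :: 'n set). \<Sum>w\<in>support P. \<bar>P w\<bar> * B w)"
      if Us: "Us \<in> unit_tuples i" for Us x
    proof -
      have "\<bar>tdiff (Phi V P) Us x $ j\<bar> \<le> (\<Sum>w\<in>support P. \<bar>P w\<bar> * B w)" for j
      proof -
        let ?f = "\<lambda>y. y $ j + - (x $ j)"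
        have sm: "smooth ?f"
          by (intro smooth_add smooth_coordinate smooth_const)
        have "jet_bound i (\<lambda>y. \<Sum>w\<in>support P. P w * word_op V w ?f y) x (\<Sum>w\<in>support P. \<bar>P w\<bar> * (B w * 1))"
          by (intro jet_bound_sum jet_bound_scale smooth_scale smooth_word_op sV sm B jet_bound_centred_coordinate)
        moreover have "(\<lambda>y. \<Sum>w\<in>support P. P w * word_op V w ?f y) = (\<lambda>y. Phi V P y $ j)"
        proof -
          have "word_op V w ?f = word_op V w (\<lambda>y. y $ j)" if "w \<in> support P" for w
            using that P0 by (intro word_op_shift sV smooth_coordinate) (auto simp: support_def)
          then show ?thesis
            by (simp add: fun_eq_iff Phi(4) Phi_op_def)
        qed
        ultimately have "jet_bound i (\<lambda>y. Phi V P y $ j) x (\<Sum>w\<in>support P. \<bar>P w\<bar> * B w)"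
          by simp
        then have "\<bar>tdiff (\<lambda>y. Phi V P y $ j) Us x\<bar> \<le> (\<Sum>w\<in>support P. \<bar>P w\<bar> * B w)"
          using Us by (auto simp: jet_bound_def unit_tuples_def)
        then show ?thesis
          by (simp add: tdiff_component[OF Phi(2)])
      qed
      then show ?thesis
        by (intro order_trans[OF norm_le_l1_cart] sum_mono)
    qed
    then show ?thesis
      by blast
  qed
  then show ?thesis
    using Phi(2) unfolding Cb_infinity_def bounded_iff by fastforce
qed

lemma Phi_sum:
  fixes V :: "'d letter \<Rightarrow> real^'n \<Rightarrow> real^'n"
  assumes V: "\<And>a. smooth (V a)" and I: "finite I" and P: "\<And>i. i \<in> I \<Longrightarrow> P i \<in> lie_polynomials"
  shows "Phi V (\<lambda>w. \<Sum>i\<in>I. c i * P i w) = (\<lambda>x. \<Sum>i\<in>I. c i *\<^sub>R Phi V (P i) x)"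
proof -
  have lie: "(\<lambda>w. \<Sum>i\<in>I. c i * P i w) \<in> lie_polynomials"
    using I P by (intro lie_polynomials_sum lie_polynomials.scale)
  have fin: "finite (support (P i))" if "i \<in> I" for i
    using Phi_lie_polynomial(1)[of V, OF V P[OF that]] .
  show ?thesis
    using fin by (simp add: fun_eq_iff vec_eq_iff Phi_lie_polynomial(4)[of V, OF V lie]
        Phi_lie_polynomial(4)[of V, OF V P] Phi_op_sum Phi_op_scale finite_support_scale)
qed

section \<open>The pathwise estimate\<close>

primrec product_bound :: "nat \<Rightarrow> real \<Rightarrow> nat \<Rightarrow> real" where
  "product_bound m B 0 = 1"
| "product_bound m B (Suc k) = real (Suc m) * (exp_bound m B * product_bound m B k)"

text \<open>N passes from components to the norm. The sum over i collects the M flows, with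
  \<open>product_bound\<close> for the factors already treated. The last term belongs to the flow of
  the logarithm: the + 1 comes from subtracting the unit series, and the final 1 bounds G =
  \<open>s_one\<close>.\<close>

definition flow_error :: "nat \<Rightarrow> nat \<Rightarrow> nat \<Rightarrow> real \<Rightarrow> real" where
  "flow_error N m M B = real N * ((\<Sum>i<M. taylor_bound N m B (product_bound m B i))
    + taylor_bound N m (exp_bound m (product_bound m B M + 1)) 1)"

lemma composition_lipschitz:
  assumes F: "\<And>i x y. i \<in> {1..k} \<Longrightarrow> norm (F i x - F i y) \<le> \<Lambda> * norm (x - y)" and \<Lambda>: "1 \<le> \<Lambda>"
  shows "norm (composition F k x - composition F k y) \<le> \<Lambda> ^ k * norm (x - y)"
  using F
proof (induction k arbitrary: x y)
  case (Suc k)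
  have "norm (composition F (Suc k) x - composition F (Suc k) y) \<le> \<Lambda> ^ k * norm (F (Suc k) x - F (Suc k) y)"
    using Suc by simp
  also have "\<dots> \<le> \<Lambda> ^ k * (\<Lambda> * norm (x - y))"
    using Suc.prems \<Lambda> by (intro mult_left_mono) auto
  finally show ?case
    by (simp add: mult_ac)
qed simp

text \<open>Only the exact flows F are Lipschitz; the schemes G may even be discontinuous. Hence the
  outer compositions are compared at the common point \<open>G (Suc k) x\<close> and the inner error
  is propagated through F.\<close>

lemma composition_perturbation:
  assumes F: "\<And>i x y. i \<in> {1..k} \<Longrightarrow> norm (F i x - F i y) \<le> \<Lambda> * norm (x - y)" and \<Lambda>: "1 \<le> \<Lambda>"
    and G: "\<And>i x. i \<in> {1..k} \<Longrightarrow> norm (G i x - F i x) \<le> d" and d: "0 \<le> d"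
  shows "norm (composition G k x - composition F k x) \<le> real k * \<Lambda> ^ k * d"
  using F G
proof (induction k arbitrary: x)
  case (Suc k)
  have "norm (composition G (Suc k) x - composition F (Suc k) x) \<le>
      norm (composition G k (G (Suc k) x) - composition F k (G (Suc k) x)) +
      norm (composition F k (G (Suc k) x) - composition F k (F (Suc k) x))"
    using norm_triangle_ineq[of "composition G k (G (Suc k) x) - composition F k (G (Suc k) x)"
        "composition F k (G (Suc k) x) - composition F k (F (Suc k) x)"] by simp
  also have "\<dots> \<le> real k * \<Lambda> ^ k * d + \<Lambda> ^ k * d"
  proof (rule add_mono)
    show "norm (composition G k (G (Suc k) x) - composition F k (G (Suc k) x)) \<le> real k * \<Lambda> ^ k * d"
      using Suc by simp
    have "norm (composition F k (G (Suc k) x) - composition F k (F (Suc k) x)) \<le> \<Lambda> ^ k * norm (G (Suc k) x - F (Suc k) x)"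
      using Suc.prems(1) by (intro composition_lipschitz \<Lambda>) auto
    also have "\<dots> \<le> \<Lambda> ^ k * d"
      using Suc.prems(2) \<Lambda> by (intro mult_left_mono) auto
    finally show "norm (composition F k (G (Suc k) x) - composition F k (F (Suc k) x)) \<le> \<Lambda> ^ k * d" .
  qed
  also have "\<dots> = real (Suc k) * d * \<Lambda> ^ k"
    by (simp add: algebra_simps)
  also have "\<dots> \<le> real (Suc k) * d * \<Lambda> ^ Suc k"
    using \<Lambda> d by (intro mult_left_mono power_increasing) auto
  finally show ?case
    by (simp add: mult_ac)
qed simp

text \<open>One sample of the random series. The bound \<kappa> concerns the unscaled weight parts,
  so it is free of s.\<close>

context
  fixes V :: "'d::finite letter \<Rightarrow> real^'n \<Rightarrow> real^'n" and m M :: nat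
    and Z :: "nat \<Rightarrow> 'd series" and \<kappa> s B :: real
  assumes V: "\<And>a. V a \<in> Cb_infinity"
    and prim: "\<And>i. i \<in> {1..M} \<Longrightarrow> primitive (Z i)"
    and trunc_Z: "\<And>i. i \<in> {1..M} \<Longrightarrow> Z i = trunc m (Z i)"
    and \<kappa>: "\<And>i k. i \<in> {1..M} \<Longrightarrow> k \<in> {1..m} \<Longrightarrow> C_norm (m + 1) (Phi V (weight_part k (Z i))) \<le> \<kappa>"
    and \<kappa>0: "0 \<le> \<kappa>"
    and s: "0 < s" "s \<le> 1"
    and B: "B = real CARD('n) * 2 ^ m * \<kappa>"
begin

lemma smooth_V: "smooth (V a)"
  using V by (rule Cb_infinity_smooth)

lemma weight_part_0: "i \<in> {1..M} \<Longrightarrow> weight_part 0 (Z i) = (\<lambda>w. 0)"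
proof
  fix w assume "i \<in> {1..M}"
  then show "weight_part 0 (Z i) w = 0"
    using primitive_Nil[OF prim] length_le_wdeg[of w] by (auto simp: weight_part_def)
qed

lemma parts_bound_Z:
  assumes i: "i \<in> {1..M}"
  shows "parts_bound V m B (Z i)"
  unfolding parts_bound_def
proof (intro allI impI)
  fix k assume k: "k \<le> m"
  show "op_bound V m k B (weight_part k (Z i))"
  proof (cases "k = 0")
    case True
    then show ?thesis
      using weight_part_0[OF i] \<kappa>0 by (simp add: op_bound_zero[of V, OF smooth_V] B)
  next
    case False
    note lie = rescale_primitive_in_lie_polynomials(1)[OF prim[OF i] trunc_Z[OF i], of k]
    have "jet_bound m (Phi V (weight_part k (Z i))) x \<kappa>" for x
      using \<kappa>[OF i, of k] False k
      by (intro jet_bound_mono[OF jet_bound_C_norm[OF Phi_in_Cb_infinity[of V, OF V lie], of m "m + 1"] order_refl]) auto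
    then have "op_bound V m 1 B (weight_part k (Z i))"
      unfolding B by (intro op_bound_vector_field[of V, OF smooth_V] lie)
    then show ?thesis
      by (rule op_bound_mono[of V, OF smooth_V]) (use False in auto)
  qed
qed

text \<open>There is no part of weight 0, so s^(k/2) \<le> s^(1/2) for every remaining weight. The
  power m + 1 in the scheme estimate turns this square root into the required rate.\<close>

lemma C_norm_rescale:
  assumes i: "i \<in> {1..M}"
  shows "Phi V (rescale s (Z i)) \<in> Cb_infinity"
    "C_norm (m + 1) (Phi V (rescale s (Z i))) \<le> real m * \<kappa> * s powr (1 / 2)"
proof -
  note lie = rescale_primitive_in_lie_polynomials[OF prim[OF i] trunc_Z[OF i]]
  show "Phi V (rescale s (Z i)) \<in> Cb_infinity"
    by (rule Phi_in_Cb_infinity[of V, OF V lie(2)])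
  have "{..m} = insert 0 {1..m}"
    by auto
  then have "rescale s (Z i) = (\<lambda>w. \<Sum>k\<in>{1..m}. s powr (real k / 2) * weight_part k (Z i) w)"
    unfolding rescale_eq_sum[OF trunc_Z[OF i], of s] using weight_part_0[OF i] by simp
  then have eq: "Phi V (rescale s (Z i)) = (\<lambda>x. \<Sum>k\<in>{1..m}. s powr (real k / 2) *\<^sub>R Phi V (weight_part k (Z i)) x)"
    using lie by (simp add: Phi_sum[of V, OF smooth_V])
  have "C_norm (m + 1) (Phi V (rescale s (Z i))) \<le>
      (\<Sum>k\<in>{1..m}. \<bar>s powr (real k / 2)\<bar> * C_norm (m + 1) (Phi V (weight_part k (Z i))))"
    unfolding eq by (intro C_norm_sum_le Phi_in_Cb_infinity[of V, OF V lie(1)]) simp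
  also have "\<dots> \<le> (\<Sum>k\<in>{1..m}. s powr (1 / 2) * \<kappa>)"
  proof (rule sum_mono)
    fix k assume k: "k \<in> {1..m}"
    have "s powr (real k / 2) \<le> s powr (1 / 2)"
      using k s by (intro powr_mono') auto
    then show "\<bar>s powr (real k / 2)\<bar> * C_norm (m + 1) (Phi V (weight_part k (Z i))) \<le> s powr (1 / 2) * \<kappa>"
      using \<kappa>[OF i k] C_norm_nonneg[OF Phi_in_Cb_infinity[of V, OF V lie(1)]] by (intro mult_mono) auto
  qed
  finally show "C_norm (m + 1) (Phi V (rescale s (Z i))) \<le> real m * \<kappa> * s powr (1 / 2)"
    by (simp add: mult_ac)
qed

lemma parts_bound_exp_product:
  "k \<le> M \<Longrightarrow> parts_bound V m (product_bound m B k) (exp_product Z k)"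
proof (induction k)
  case 0
  then show ?case
    by (simp add: parts_bound_one[of V, OF smooth_V])
next
  case (Suc k)
  then have i: "Suc k \<in> {1..M}"
    by simp
  have Z0: "Z (Suc k) [] = 0"
    using prim[OF i] by (rule primitive_Nil)
  have "\<bar>fps_nth (fps_exp (1::real)) k\<bar> \<le> 1" for k
    using fact_ge_1[of k, where ?'a = real] by simp
  then have "parts_bound V m (exp_bound m B) (s_exp (Z (Suc k)))"
    unfolding s_exp_eq_s_subst[of "Z (Suc k)", OF Z0]
    by (intro parts_bound_s_subst[of V, OF smooth_V] parts_bound_Z i Z0)
  then show ?case
    using Suc by (simp del: of_nat_Suc add: parts_bound_mult[of V, OF smooth_V])
qed

text \<open>The induction hypothesis is used at the image of x under the innermost flow.
  \<open>flow_expansion\<close> with G = \<open>exp_product Z k\<close> then puts the new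
  exponential on the left.\<close>

lemma composition_expansion:
  assumes "1 \<le> m" "k \<le> M"
  shows "\<bar>composition (\<lambda>i. vf_exp (Phi V (rescale s (Z i)))) k x $ j
      - Phi_op V (rescale s (trunc m (exp_product Z k))) (\<lambda>y. y $ j) x\<bar>
    \<le> (\<Sum>i<k. taylor_bound CARD('n) m B (product_bound m B i)) * s powr (real (m + 1) / 2)"
  using assms(2)
proof (induction k arbitrary: x)
  case 0
  have "rescale s (trunc m s_one) = (s_one :: 'd series)"
  proof
    fix w show "rescale s (trunc m s_one) w = (s_one :: 'd series) w"
      using s by (cases w) (simp_all add: rescale_def trunc_def)
  qed
  then show ?case
    by (simp add: Phi_op_one)
next
  case (Suc k)
  then have i: "Suc k \<in> {1..M}"
    by simp
  let ?y = "vf_exp (Phi V (rescale s (Z (Suc k)))) x"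
  have "\<bar>Phi_op V (rescale s (trunc m (exp_product Z k))) (\<lambda>y. y $ j) ?y
      - Phi_op V (rescale s (trunc m (exp_product Z (Suc k)))) (\<lambda>y. y $ j) x\<bar>
    \<le> taylor_bound CARD('n) m B (product_bound m B k) * s powr (real (m + 1) / 2)"
    unfolding exp_product.simps
    by (rule flow_expansion[of V, OF smooth_V prim[OF i] trunc_Z[OF i] parts_bound_Z[OF i]
          parts_bound_exp_product s Cb_infinity_lipschitz[OF C_norm_rescale(1)[OF i]]])
      (use Suc assms in auto)
  with Suc.IH[of ?y] Suc.prems show ?case
    by (simp add: distrib_right)
qed

text \<open>Both points are compared with the operator of the truncated product, applied to the
  coordinates at x.\<close>

lemma flow_error_bound:
  assumes m: "1 \<le> m"
  shows "norm (composition (\<lambda>i. vf_exp (Phi V (rescale s (Z i)))) M x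
      - vf_exp (Phi V (rescale s (trunc m (s_log (exp_product Z M))))) x)
    \<le> flow_error CARD('n) m M B * s powr (real (m + 1) / 2)"
proof -
  define Y where "Y = s_log (exp_product Z M)"
  have G: "grouplike (exp_product Z M)"
    using prim by (rule grouplike_exp_product)
  then have G1: "exp_product Z M [] = 1"
    by (simp add: grouplike_def)
  have Y0: "Y [] = 0"
    unfolding Y_def using G1 by (rule s_log_Nil)
  have prim_Y: "primitive (trunc m Y)"
    using primitive_filter_wdeg[OF primitive_log[OF G], of "\<lambda>n. n \<le> m"] by (simp add: Y_def trunc_def)
  have tY: "trunc m Y = trunc m (trunc m Y)"
    by simp
  have "parts_bound V m (product_bound m B M + \<bar>-1\<bar> * 1) (\<lambda>w. exp_product Z M w + (-1) * s_one w)"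
    by (intro parts_bound_add[of V, OF smooth_V] parts_bound_scale[of V, OF smooth_V]
        parts_bound_exp_product parts_bound_one[of V, OF smooth_V] order_refl)
  then have "parts_bound V m (product_bound m B M + 1) (\<lambda>w. exp_product Z M w - s_one w)"
    by simp
  then have BY: "parts_bound V m (exp_bound m (product_bound m B M + 1)) (trunc m Y)"
    unfolding parts_bound_trunc[of V, OF smooth_V] Y_def s_log_eq_s_subst[of "exp_product Z M", OF G1]
    by (rule parts_bound_s_subst[of V, OF smooth_V]) (simp_all add: G1 fps_ln_nth)
  \<comment> \<open>Truncating the logarithm changes its exponential only in weights above
    m.\<close>
  have exp_Y: "trunc m (s_mult (s_exp (trunc m Y)) s_one) = trunc m (exp_product Z M)"
    using trunc_s_exp_trunc[of Y m, OF Y0] s_exp_s_log[of "exp_product Z M", OF G1] by (simp add: Y_def)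
  have Cb: "Phi V (rescale s (trunc m Y)) \<in> Cb_infinity"
    by (rule Phi_in_Cb_infinity[of V, OF V rescale_primitive_in_lie_polynomials(2)[OF prim_Y tY]])
  let ?F = "composition (\<lambda>i. vf_exp (Phi V (rescale s (Z i)))) M x"
    and ?U = "vf_exp (Phi V (rescale s (trunc m Y))) x"
  have "\<bar>?F $ j - ?U $ j\<bar> \<le> ((\<Sum>i<M. taylor_bound CARD('n) m B (product_bound m B i))
      + taylor_bound CARD('n) m (exp_bound m (product_bound m B M + 1)) 1) * s powr (real (m + 1) / 2)" for j
  proof -
    \<comment> \<open>With G = \<open>s_one\<close> the expansion concerns a single flow, that of
      the truncated logarithm.\<close>
    have "\<bar>Phi_op V (rescale s (trunc m s_one)) (\<lambda>y. y $ j) ?U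
        - Phi_op V (rescale s (trunc m (s_mult (s_exp (trunc m Y)) s_one))) (\<lambda>y. y $ j) x\<bar>
      \<le> taylor_bound CARD('n) m (exp_bound m (product_bound m B M + 1)) 1 * s powr (real (m + 1) / 2)"
      by (rule flow_expansion[of V, OF smooth_V prim_Y tY BY parts_bound_one[of V, OF smooth_V] s
            Cb_infinity_lipschitz[OF Cb]]) (use m in auto)
    moreover have "Phi_op V (rescale s (trunc m s_one)) (\<lambda>y. y $ j) ?U = ?U $ j"
    proof -
      have "rescale s (trunc m s_one) = (s_one :: 'd series)"
      proof
        fix w show "rescale s (trunc m s_one) w = (s_one :: 'd series) w"
          using s by (cases w) (simp_all add: rescale_def trunc_def)
      qed
      then show ?thesis
        by (simp add: Phi_op_one)
    qed
    ultimately show ?thesis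
      using composition_expansion[OF m order_refl, of x j] unfolding exp_Y by (simp add: distrib_right)
  qed
  then have "norm (?F - ?U) \<le> (\<Sum>j\<in>(UNIV :: 'n set). ((\<Sum>i<M. taylor_bound CARD('n) m B (product_bound m B i))
      + taylor_bound CARD('n) m (exp_bound m (product_bound m B M + 1)) 1) * s powr (real (m + 1) / 2))"
    by (intro order_trans[OF norm_le_l1_cart] sum_mono) simp
  then show ?thesis
    by (simp add: Y_def flow_error_def mult_ac)
qed

lemma scheme_error_bound:
  assumes m: "1 \<le> m" and C: "0 \<le> C"
    and g: "\<And>i W x. i \<in> {1..M} \<Longrightarrow> W \<in> Cb_infinity \<Longrightarrow> norm (g i W x - vf_exp W x) \<le> C * C_norm (m + 1) W ^ (m + 1)"
  shows "norm (composition (\<lambda>i. g i (Phi V (rescale s (Z i)))) M x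
      - vf_exp (Phi V (rescale s (trunc m (s_log (exp_product Z M))))) x)
    \<le> (real M * exp (real m * \<kappa>) ^ M * (C * (real m * \<kappa>) ^ (m + 1)) + flow_error CARD('n) m M B)
      * s powr (real (m + 1) / 2)"
proof -
  let ?W = "\<lambda>i. Phi V (rescale s (Z i))" and ?\<sigma> = "s powr (real (m + 1) / 2)"
  have pow: "(s powr (1 / 2)) ^ (m + 1) = ?\<sigma>"
  proof -
    have "(s powr (1 / 2)) ^ (m + 1) = (s powr (1 / 2)) powr real (m + 1)"
      using s by (subst powr_realpow) auto
    then show ?thesis
      by (simp add: powr_powr)
  qed
  have "norm (composition (\<lambda>i. g i (?W i)) M x - composition (\<lambda>i. vf_exp (?W i)) M x)
      \<le> real M * exp (real m * \<kappa>) ^ M * (C * (real m * \<kappa>) ^ (m + 1) * ?\<sigma>)"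
  proof (rule composition_perturbation)
    fix i x assume i: "i \<in> {1..M}"
    note CW = C_norm_rescale[OF i]
    have "norm (g i (?W i) x - vf_exp (?W i) x) \<le> C * C_norm (m + 1) (?W i) ^ (m + 1)"
      by (rule g[OF i CW(1)])
    also have "\<dots> \<le> C * (real m * \<kappa> * s powr (1 / 2)) ^ (m + 1)"
      using C CW C_norm_nonneg by (intro mult_left_mono power_mono) auto
    also have "\<dots> = C * (real m * \<kappa>) ^ (m + 1) * ?\<sigma>"
      by (simp only: power_mult_distrib pow mult.assoc)
    finally show "norm (g i (?W i) x - vf_exp (?W i) x) \<le> C * (real m * \<kappa>) ^ (m + 1) * ?\<sigma>" .
  next
    fix i x y assume i: "i \<in> {1..M}"
    note CW = C_norm_rescale[OF i]
    have "s powr (1 / 2) \<le> 1"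
      using s by (simp add: powr_le1)
    then have "C_norm (m + 1) (?W i) \<le> real m * \<kappa>"
      using CW(2) \<kappa>0 mult_left_mono[of "s powr (1 / 2)" 1 "real m * \<kappa>"] by simp
    then have "norm (?W i x - ?W i y) \<le> real m * \<kappa> * norm (x - y)" for x y
      using Cb_infinity_lipschitz[OF CW(1), of "m + 1" x y] mult_right_mono[OF _ norm_ge_zero] order_trans by fastforce
    then show "norm (vf_exp (?W i) x - vf_exp (?W i) y) \<le> exp (real m * \<kappa>) * norm (x - y)"
      by (rule vf_exp_lipschitz)
  qed (use \<kappa>0 C in auto)
  with flow_error_bound[OF m, of x] show ?thesis
    using norm_triangle_ineq[of "composition (\<lambda>i. g i (?W i)) M x - composition (\<lambda>i. vf_exp (?W i)) M x"
        "composition (\<lambda>i. vf_exp (?W i)) M x - vf_exp (Phi V (rescale s (trunc m (s_log (exp_product Z M))))) x"]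
    by (simp add: algebra_simps)
qed

end

section \<open>Exponential growth and exponential moments\<close>

text \<open>Polynomials in \<kappa> and the Lipschitz factors exp(m \<kappa>) belong to this class,
  which is closed under sums and products. It reduces moments of the pathwise constant to
  exponential moments.\<close>

definition exp_growth :: "(real \<Rightarrow> real) \<Rightarrow> bool" where
  "exp_growth F \<longleftrightarrow> (\<exists>C>0. \<exists>a>0. \<forall>\<kappa>\<ge>0. 0 \<le> F \<kappa> \<and> F \<kappa> \<le> C * exp (a * \<kappa>))"

lemma exp_growthI:
  "0 < C \<Longrightarrow> 0 < a \<Longrightarrow> (\<And>\<kappa>. 0 \<le> \<kappa> \<Longrightarrow> 0 \<le> F \<kappa> \<and> F \<kappa> \<le> C * exp (a * \<kappa>)) \<Longrightarrow> exp_growth F"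
  unfolding exp_growth_def by blast

lemma exp_growth_const: "0 \<le> c \<Longrightarrow> exp_growth (\<lambda>\<kappa>. c)"
proof (rule exp_growthI[of "c + 1" 1])
  fix \<kappa> :: real assume "0 \<le> c" "0 \<le> \<kappa>"
  have "c \<le> (c + 1) * 1"
    by simp
  also have "\<dots> \<le> (c + 1) * exp (1 * \<kappa>)"
    using \<open>0 \<le> c\<close> \<open>0 \<le> \<kappa>\<close> by (intro mult_left_mono) auto
  finally show "0 \<le> c \<and> c \<le> (c + 1) * exp (1 * \<kappa>)"
    using \<open>0 \<le> c\<close> by (rule conjI[rotated])
qed auto

lemma exp_growth_id: "exp_growth (\<lambda>\<kappa>. \<kappa>)"
proof (rule exp_growthI[of 1 1])
  fix \<kappa> :: real assume "0 \<le> \<kappa>"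
  moreover have "\<kappa> \<le> exp \<kappa>"
    using exp_ge_add_one_self[of \<kappa>] by linarith
  ultimately show "0 \<le> \<kappa> \<and> \<kappa> \<le> 1 * exp (1 * \<kappa>)"
    by simp
qed auto

lemma exp_growth_add:
  assumes "exp_growth F" "exp_growth H"
  shows "exp_growth (\<lambda>\<kappa>. F \<kappa> + H \<kappa>)"
proof -
  obtain C a where F: "C > 0" "a > 0" "\<forall>\<kappa>\<ge>0. 0 \<le> F \<kappa> \<and> F \<kappa> \<le> C * exp (a * \<kappa>)"
    using assms(1) unfolding exp_growth_def by blast
  obtain C' a' where H: "C' > 0" "a' > 0" "\<forall>\<kappa>\<ge>0. 0 \<le> H \<kappa> \<and> H \<kappa> \<le> C' * exp (a' * \<kappa>)"
    using assms(2) unfolding exp_growth_def by blast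
  note * = F(1,2) H(1,2) F(3)[rule_format] H(3)[rule_format]
  have "F \<kappa> + H \<kappa> \<le> (C + C') * exp ((a + a') * \<kappa>)" if "\<kappa> \<ge> 0" for \<kappa>
  proof -
    have "C * exp (a * \<kappa>) \<le> C * exp ((a + a') * \<kappa>)" "C' * exp (a' * \<kappa>) \<le> C' * exp ((a + a') * \<kappa>)"
      using *(1-4) that by (auto intro!: mult_right_mono)
    then show ?thesis
      using *(5,6)[OF that] by (simp add: distrib_right)
  qed
  then show ?thesis
    using *(1-4) *(5,6)[THEN conjunct1] by (intro exp_growthI[of "C + C'" "a + a'"] conjI add_nonneg_nonneg) simp_all
qed

lemma exp_growth_mult:
  assumes "exp_growth F" "exp_growth H"
  shows "exp_growth (\<lambda>\<kappa>. F \<kappa> * H \<kappa>)"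
proof -
  obtain C a where F: "C > 0" "a > 0" "\<forall>\<kappa>\<ge>0. 0 \<le> F \<kappa> \<and> F \<kappa> \<le> C * exp (a * \<kappa>)"
    using assms(1) unfolding exp_growth_def by blast
  obtain C' a' where H: "C' > 0" "a' > 0" "\<forall>\<kappa>\<ge>0. 0 \<le> H \<kappa> \<and> H \<kappa> \<le> C' * exp (a' * \<kappa>)"
    using assms(2) unfolding exp_growth_def by blast
  note * = F(1,2) H(1,2) F(3)[rule_format] H(3)[rule_format]
  have "F \<kappa> * H \<kappa> \<le> (C * C') * exp ((a + a') * \<kappa>)" if "\<kappa> \<ge> 0" for \<kappa>
  proof -
    have "F \<kappa> * H \<kappa> \<le> (C * exp (a * \<kappa>)) * (C' * exp (a' * \<kappa>))"
      using *(1,5,6) that by (intro mult_mono) auto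
    moreover have "exp ((a + a') * \<kappa>) = exp (a * \<kappa>) * exp (a' * \<kappa>)"
      by (simp add: distrib_right exp_add)
    ultimately show ?thesis
      by (simp add: mult_ac)
  qed
  then show ?thesis
    using *(1-4) *(5,6)[THEN conjunct1] by (intro exp_growthI[of "C * C'" "a + a'"] conjI mult_nonneg_nonneg) simp_all
qed

lemma exp_growth_power: "exp_growth F \<Longrightarrow> exp_growth (\<lambda>\<kappa>. F \<kappa> ^ n)"
  by (induction n) (auto intro: exp_growth_const exp_growth_mult)

lemma exp_growth_sum: "(\<And>i. i \<in> I \<Longrightarrow> exp_growth (F i)) \<Longrightarrow> exp_growth (\<lambda>\<kappa>. \<Sum>i\<in>I. F i \<kappa>)"
  by (induction I rule: infinite_finite_induct) (auto intro: exp_growth_const exp_growth_add)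

lemma exp_growth_exp: "0 \<le> c \<Longrightarrow> exp_growth (\<lambda>\<kappa>. exp (c * \<kappa>))"
  by (rule exp_growthI[of 1 "c + 1"]) (auto intro: mult_right_mono)

lemma exp_growth_exp_bound: "exp_growth F \<Longrightarrow> exp_growth (\<lambda>\<kappa>. exp_bound m (F \<kappa>))"
  unfolding exp_bound_def
  by (intro exp_growth_sum exp_growth_power exp_growth_mult exp_growth_const) auto

lemma exp_growth_taylor_bound:
  "exp_growth F \<Longrightarrow> exp_growth H \<Longrightarrow> exp_growth (\<lambda>\<kappa>. taylor_bound N m (F \<kappa>) (H \<kappa>))"
  unfolding taylor_bound_def
  by (intro exp_growth_mult exp_growth_exp_bound exp_growth_const) auto

lemma exp_growth_product_bound: "exp_growth F \<Longrightarrow> exp_growth (\<lambda>\<kappa>. product_bound m (F \<kappa>) k)"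
proof (induction k)
  case (Suc k)
  have "exp_growth (\<lambda>\<kappa>. real (Suc m) * (exp_bound m (F \<kappa>) * product_bound m (F \<kappa>) k))"
    by (intro exp_growth_mult exp_growth_exp_bound exp_growth_const Suc) auto
  then show ?case
    by simp
qed (simp add: exp_growth_const)

lemma exp_growth_flow_error: "exp_growth F \<Longrightarrow> exp_growth (\<lambda>\<kappa>. flow_error N m M (F \<kappa>))"
  unfolding flow_error_def
  by (intro exp_growth_mult exp_growth_add exp_growth_sum exp_growth_taylor_bound
      exp_growth_exp_bound exp_growth_product_bound exp_growth_const) auto

section \<open>Random variables with all exponential moments\<close>

definition exp_moments :: "'w measure \<Rightarrow> ('w \<Rightarrow> real) \<Rightarrow> bool" where
  "exp_moments Q h \<longleftrightarrow> h \<in> borel_measurable Q \<and> (\<forall>\<omega>\<in>space Q. 0 \<le> h \<omega>) \<and>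
    (\<forall>a>0. integrable Q (\<lambda>\<omega>. exp (a * h \<omega>)))"

lemma exp_moments_zero: "finite_measure Q \<Longrightarrow> exp_moments Q (\<lambda>\<omega>. 0)"
  by (simp add: exp_moments_def finite_measure.integrable_const)

text \<open>A sum is at most twice the maximum, and the exponential of a maximum is at most the sum
  of the exponentials; the joint law of the two variables does not matter.\<close>

lemma exp_moments_add:
  assumes "exp_moments Q h" "exp_moments Q h'"
  shows "exp_moments Q (\<lambda>\<omega>. h \<omega> + h' \<omega>)"
proof -
  have [measurable]: "h \<in> borel_measurable Q" "h' \<in> borel_measurable Q"
    using assms by (auto simp: exp_moments_def)
  have "integrable Q (\<lambda>\<omega>. exp (a * (h \<omega> + h' \<omega>)))" if a: "a > 0" for a
  proof (rule Bochner_Integration.integrable_bound)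
    have "0 < 2 * a"
      using a by simp
    then show "integrable Q (\<lambda>\<omega>. exp (2 * a * h \<omega>) + exp (2 * a * h' \<omega>))"
      using assms unfolding exp_moments_def by (intro Bochner_Integration.integrable_add) blast+
    have "exp (a * (h \<omega> + h' \<omega>)) \<le> exp (2 * a * h \<omega>) + exp (2 * a * h' \<omega>)" for \<omega>
    proof -
      have "exp (a * (h \<omega> + h' \<omega>)) \<le> exp (2 * a * max (h \<omega>) (h' \<omega>))"
        using a by (simp add: max_def)
      also have "\<dots> \<le> exp (2 * a * h \<omega>) + exp (2 * a * h' \<omega>)"
        by (simp add: max_def)
      finally show ?thesis .
    qed
    then show "AE \<omega> in Q. norm (exp (a * (h \<omega> + h' \<omega>))) \<le> norm (exp (2 * a * h \<omega>) + exp (2 * a * h' \<omega>))"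
      by (simp add: add_nonneg_nonneg)
  qed measurable
  then show ?thesis
    using assms by (auto simp: exp_moments_def)
qed

lemma exp_moments_scale:
  assumes "exp_moments Q h" "0 < c"
  shows "exp_moments Q (\<lambda>\<omega>. c * h \<omega>)"
proof -
  have "integrable Q (\<lambda>\<omega>. exp (a * (c * h \<omega>)))" if "a > 0" for a
  proof -
    have "0 < a * c"
      using that assms by simp
    then have "integrable Q (\<lambda>\<omega>. exp (a * c * h \<omega>))"
      using assms(1) by (simp add: exp_moments_def)
    then show ?thesis
      by (simp only: mult.assoc)
  qed
  then show ?thesis
    using assms by (auto simp: exp_moments_def)
qed

lemma exp_moments_sum:
  "finite_measure Q \<Longrightarrow> (\<And>i. i \<in> I \<Longrightarrow> exp_moments Q (h i)) \<Longrightarrow> exp_moments Q (\<lambda>\<omega>. \<Sum>i\<in>I. h i \<omega>)"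
  by (induction I rule: infinite_finite_induct) (auto intro: exp_moments_zero exp_moments_add)

context
  fixes V :: "'d::finite letter \<Rightarrow> real^'n \<Rightarrow> real^'n" and Q :: "'w measure" and n :: nat
  assumes V: "\<And>a. V a \<in> Cb_infinity" and Q: "finite_measure Q"
begin

text \<open>A majorant of the norm suffices, so measurability of the norms of linear combinations
  never has to be shown.\<close>

definition exp_moment_field :: "('w \<Rightarrow> 'd series) \<Rightarrow> bool" where
  "exp_moment_field T \<longleftrightarrow> (\<forall>\<omega>\<in>space Q. T \<omega> \<in> lie_polynomials) \<and>
    (\<exists>h. exp_moments Q h \<and> (\<forall>\<omega>\<in>space Q. C_norm n (Phi V (T \<omega>)) \<le> h \<omega>))"

lemma exp_moment_field_cong:
  "exp_moment_field T \<Longrightarrow> (\<And>\<omega>. \<omega> \<in> space Q \<Longrightarrow> T \<omega> = T' \<omega>) \<Longrightarrow> exp_moment_field T'"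
  by (simp add: exp_moment_field_def)

lemma exp_moment_field_sum:
  assumes I: "finite I" and T: "\<And>i. i \<in> I \<Longrightarrow> exp_moment_field (T i)"
  shows "exp_moment_field (\<lambda>\<omega> w. \<Sum>i\<in>I. c i * T i \<omega> w)"
proof -
  obtain h where h: "\<And>i. i \<in> I \<Longrightarrow> exp_moments Q (h i)"
    "\<And>i \<omega>. i \<in> I \<Longrightarrow> \<omega> \<in> space Q \<Longrightarrow> C_norm n (Phi V (T i \<omega>)) \<le> h i \<omega>"
    using T unfolding exp_moment_field_def by metis
  have lie: "T i \<omega> \<in> lie_polynomials" if "i \<in> I" "\<omega> \<in> space Q" for i \<omega>
    using T that by (simp add: exp_moment_field_def)
  have "exp_moments Q (\<lambda>\<omega>. \<Sum>i\<in>I. (\<bar>c i\<bar> + 1) * h i \<omega>)"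
    by (intro exp_moments_sum Q exp_moments_scale h) auto
  moreover have "C_norm n (Phi V (\<lambda>w. \<Sum>i\<in>I. c i * T i \<omega> w)) \<le> (\<Sum>i\<in>I. (\<bar>c i\<bar> + 1) * h i \<omega>)"
    if \<omega>: "\<omega> \<in> space Q" for \<omega>
  proof -
    have "Phi V (\<lambda>w. \<Sum>i\<in>I. c i * T i \<omega> w) = (\<lambda>x. \<Sum>i\<in>I. c i *\<^sub>R Phi V (T i \<omega>) x)"
      by (rule Phi_sum[of V, OF Cb_infinity_smooth[OF V] I lie[OF _ \<omega>]])
    then have "C_norm n (Phi V (\<lambda>w. \<Sum>i\<in>I. c i * T i \<omega> w)) \<le> (\<Sum>i\<in>I. \<bar>c i\<bar> * C_norm n (Phi V (T i \<omega>)))"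
      using C_norm_sum_le[OF I, of "\<lambda>i. Phi V (T i \<omega>)" n c] Phi_in_Cb_infinity[of V, OF V lie[OF _ \<omega>]] by simp
    also have "\<dots> \<le> (\<Sum>i\<in>I. (\<bar>c i\<bar> + 1) * h i \<omega>)"
      using h \<omega> C_norm_nonneg[OF Phi_in_Cb_infinity[of V, OF V lie[OF _ \<omega>]]]
      by (intro sum_mono mult_mono) auto
    finally show ?thesis .
  qed
  moreover have "(\<lambda>w. \<Sum>i\<in>I. c i * T i \<omega> w) \<in> lie_polynomials" if "\<omega> \<in> space Q" for \<omega>
    by (intro lie_polynomials_sum lie_polynomials.scale lie I that)
  ultimately show ?thesis
    unfolding exp_moment_field_def by blast
qed

lemma exp_moment_field_scale: "exp_moment_field T \<Longrightarrow> exp_moment_field (\<lambda>\<omega> w. c * T \<omega> w)"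
  using exp_moment_field_sum[of "{()}" "\<lambda>_. T" "\<lambda>_. c"] by simp

lemma exp_moment_field_diff:
  assumes "exp_moment_field T" "exp_moment_field T'"
  shows "exp_moment_field (\<lambda>\<omega> w. c * T \<omega> w - T' \<omega> w)"
proof -
  have "exp_moment_field (\<lambda>\<omega> w. \<Sum>b\<in>UNIV. (if b then c else - 1) * (if b then T else T') \<omega> w)"
    by (rule exp_moment_field_sum) (use assms in auto)
  then show ?thesis
    by (simp add: UNIV_bool)
qed

text \<open>The combination \<open>2\<^sup>N f(\<sigma>/2) - f(\<sigma>)\<close> eliminates the term of top degree \<open>N\<close>.\<close>

lemma exp_moment_field_coefficients:
  assumes "\<And>\<sigma>. 0 < \<sigma> \<Longrightarrow> \<sigma> \<le> 1 \<Longrightarrow> exp_moment_field (\<lambda>\<omega> w. \<Sum>k\<in>{1..N}. \<sigma> ^ k * T k \<omega> w)"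
    and "k \<in> {1..N}"
  shows "exp_moment_field (T k)"
  using assms
proof (induction N arbitrary: T k)
  case (Suc N)
  let ?f = "\<lambda>\<sigma> \<omega> w. \<Sum>k\<in>{1..Suc N}. \<sigma> ^ k * T k \<omega> w"
  define T' where "T' k \<omega> w = (2 ^ (Suc N - k) - 1) * T k \<omega> w" for k \<omega> w
  have T': "exp_moment_field (T' k)" if k: "k \<in> {1..N}" for k
  proof (rule Suc.IH[OF _ k])
    fix \<sigma> :: real assume \<sigma>: "0 < \<sigma>" "\<sigma> \<le> 1"
    have "exp_moment_field (\<lambda>\<omega> w. 2 ^ Suc N * ?f (\<sigma> / 2) \<omega> w - ?f \<sigma> \<omega> w)"
      using \<sigma> by (intro exp_moment_field_diff Suc.prems(1)) auto
    moreover have "2 ^ Suc N * ?f (\<sigma> / 2) \<omega> w - ?f \<sigma> \<omega> w = (\<Sum>k\<in>{1..N}. \<sigma> ^ k * T' k \<omega> w)" for \<omega> w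
    proof -
      have "2 ^ Suc N * ?f (\<sigma> / 2) \<omega> w - ?f \<sigma> \<omega> w =
          (\<Sum>k\<in>{1..Suc N}. \<sigma> ^ k * ((2 ^ (Suc N - k) - 1) * T k \<omega> w))"
        unfolding sum_distrib_left sum_subtractf[symmetric]
      proof (intro sum.cong refl)
        fix k assume "k \<in> {1..Suc N}"
        then have "2 ^ Suc N = (2::real) ^ k * 2 ^ (Suc N - k)"
          by (subst power_add[symmetric]) auto
        then show "2 ^ Suc N * ((\<sigma> / 2) ^ k * T k \<omega> w) - \<sigma> ^ k * T k \<omega> w =
            \<sigma> ^ k * ((2 ^ (Suc N - k) - 1) * T k \<omega> w)"
          by (simp add: power_divide field_simps del: power_Suc)
      qed
      then show ?thesis
        by (simp add: T'_def)
    qed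
    ultimately show "exp_moment_field (\<lambda>\<omega> w. \<Sum>k\<in>{1..N}. \<sigma> ^ k * T' k \<omega> w)"
      by simp
  qed
  have low: "exp_moment_field (T k)" if k: "k \<in> {1..N}" for k
  proof -
    \<comment> \<open>The factor left by the elimination is at least 1 below the top degree and can
      be divided out.\<close>
    have "(2::real) ^ 1 \<le> 2 ^ (Suc N - k)"
      using k by (intro power_increasing) auto
    then have "(\<lambda>\<omega> w. 1 / (2 ^ (Suc N - k) - 1) * T' k \<omega> w) = T k"
      by (simp add: T'_def fun_eq_iff)
    then show ?thesis
      using exp_moment_field_scale[OF T'[OF k], of "1 / (2 ^ (Suc N - k) - 1)"] by simp
  qed
  \<comment> \<open>The top coefficient is f(1) minus all lower coefficients.\<close>
  have "exp_moment_field (\<lambda>\<omega> w. 1 * ?f 1 \<omega> w - (\<Sum>k\<in>{1..N}. 1 * T k \<omega> w))"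
    by (intro exp_moment_field_diff Suc.prems(1) exp_moment_field_sum low) auto
  then have "exp_moment_field (T (Suc N))"
    by simp
  with low Suc.prems(2) show ?case
    by (cases "k = Suc N") auto
qed simp

end

lemma ennreal_powr_ennreal: "0 \<le> x \<Longrightarrow> ennreal_powr (ennreal x) p = ennreal (x powr p)"
  by (simp add: ennreal_powr_def)

text \<open>D is fixed before \<sigma> and f, which makes the final constant uniform in s. The
  explicit majorant is measurable and hence admissible in the infimum, whatever f is.\<close>

lemma Lp_norm_le_exp_moment:
  assumes Q: "prob_space Q" and K: "exp_moments Q K" and C: "0 < C" and a: "0 < a" and p: "1 \<le> p"
  shows "\<exists>D>0. \<forall>\<sigma>>0. \<forall>f. (\<forall>\<omega>\<in>space Q. f \<omega> \<le> ennreal (C * exp (a * K \<omega>) * \<sigma>)) \<longrightarrow>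
    Lp_norm Q p f \<le> ennreal (D * \<sigma>)"
proof -
  interpret prob_space Q by fact
  define J where "J = (\<integral>\<omega>. exp (p * a * K \<omega>) \<partial>Q)"
  have [measurable]: "K \<in> borel_measurable Q"
    using K by (simp add: exp_moments_def)
  have int: "integrable Q (\<lambda>\<omega>. exp (p * a * K \<omega>))"
    using K a p by (simp add: exp_moments_def)
  have J0: "0 \<le> J"
    unfolding J_def by (rule integral_nonneg_AE) simp
  have main: "Lp_norm Q p f \<le> ennreal ((C * J powr (1 / p)) * \<sigma>)"
    if \<sigma>: "0 < \<sigma>" and f: "\<And>\<omega>. \<omega> \<in> space Q \<Longrightarrow> f \<omega> \<le> ennreal (C * exp (a * K \<omega>) * \<sigma>)" for \<sigma> f
  proof -
    let ?h = "\<lambda>\<omega>. ennreal (C * exp (a * K \<omega>) * \<sigma>)"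
    have "Lp_norm Q p f \<le> ennreal_powr (\<integral>\<^sup>+\<omega>. ennreal_powr (?h \<omega>) p \<partial>Q) (1 / p)"
      unfolding Lp_norm_def by (rule INF_lower) (use f in auto)
    also have "(\<integral>\<^sup>+\<omega>. ennreal_powr (?h \<omega>) p \<partial>Q) = (\<integral>\<^sup>+\<omega>. ennreal ((C * \<sigma>) powr p * exp (p * a * K \<omega>)) \<partial>Q)"
    proof (rule nn_integral_cong)
      fix \<omega>
      have "(C * exp (a * K \<omega>) * \<sigma>) powr p = (C * \<sigma>) powr p * exp (p * a * K \<omega>)"
        using C \<sigma> by (simp add: powr_mult exp_powr_real mult_ac)
      then show "ennreal_powr (?h \<omega>) p = ennreal ((C * \<sigma>) powr p * exp (p * a * K \<omega>))"
        using C \<sigma> by (simp add: ennreal_powr_ennreal)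
    qed
    also have "\<dots> = ennreal ((C * \<sigma>) powr p * J)"
      using int by (simp add: nn_integral_eq_integral J_def)
    also have "ennreal_powr \<dots> (1 / p) = ennreal (((C * \<sigma>) powr p * J) powr (1 / p))"
      using J0 by (intro ennreal_powr_ennreal) simp
    also have "((C * \<sigma>) powr p * J) powr (1 / p) = (C * J powr (1 / p)) * \<sigma>"
      using C \<sigma> p J0 by (simp add: powr_mult powr_powr)
    finally show ?thesis .
  qed
  show ?thesis
  \<comment> \<open>Adding 1 makes the constant positive from J \<ge> 0 alone.\<close>
  proof (intro exI[of _ "C * J powr (1 / p) + 1"] conjI allI impI)
    show "0 < C * J powr (1 / p) + 1"
      using C by (simp add: add_nonneg_pos)
    fix \<sigma> :: real and f
    assume *: "0 < \<sigma>" "\<forall>\<omega>\<in>space Q. f \<omega> \<le> ennreal (C * exp (a * K \<omega>) * \<sigma>)"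
    have "ennreal ((C * J powr (1 / p)) * \<sigma>) \<le> ennreal ((C * J powr (1 / p) + 1) * \<sigma>)"
      using *(1) by (intro ennreal_leI mult_right_mono) auto
    with main[OF *(1) bspec[OF *(2)]] show "Lp_norm Q p f \<le> ennreal ((C * J powr (1 / p) + 1) * \<sigma>)"
      by (rule order_trans)
  qed
qed

section \<open>The error of compositions of integration schemes\<close>

lemma integration_schemes_bound:
  fixes g :: "nat \<Rightarrow> (real^'n \<Rightarrow> real^'n) \<Rightarrow> real^'n \<Rightarrow> real^'n"
  assumes g: "\<And>i. i \<in> {1..M} \<Longrightarrow> g i \<in> integration_schemes m"
  shows "\<exists>C\<ge>0. \<forall>i\<in>{1..M}. \<forall>W\<in>Cb_infinity. \<forall>x.
    norm (g i W x - vf_exp W x) \<le> C * C_norm (m + 1) W ^ (m + 1)"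
proof -
  have "\<forall>i\<in>{1..M}. \<exists>C>0. \<forall>W\<in>Cb_infinity.
      (SUP x. ennreal (norm (g i W x - vf_exp W x))) \<le> ennreal (C * C_norm (m + 1) W ^ (m + 1))"
    using g by (simp add: integration_schemes_def)
  from bchoice[OF this] obtain c where *: "\<forall>i\<in>{1..M}. c i > 0 \<and> (\<forall>W\<in>Cb_infinity.
      (SUP x. ennreal (norm (g i W x - vf_exp W x))) \<le> ennreal (c i * C_norm (m + 1) W ^ (m + 1)))"
    by (elim exE)
  have c: "c i > 0" if "i \<in> {1..M}" for i
    using * that by blast
  \<comment> \<open>The sum serves as a common constant for all M schemes.\<close>
  define C where "C = (\<Sum>i\<in>{1..M}. c i)"
  show ?thesis
  proof (intro exI[of _ C] conjI ballI allI)
    show "0 \<le> C"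
      unfolding C_def using c by (intro sum_nonneg) (simp add: less_imp_le)
    fix i x and W :: "real^'n \<Rightarrow> real^'n" assume i: "i \<in> {1..M}" and W: "W \<in> Cb_infinity"
    have pos: "0 \<le> C_norm (m + 1) W ^ (m + 1)"
      using C_norm_nonneg[OF W] by simp
    have "ennreal (norm (g i W x - vf_exp W x)) \<le> ennreal (c i * C_norm (m + 1) W ^ (m + 1))"
      by (rule order_trans[OF SUP_upper bspec[OF conjunct2[OF bspec[OF * i]] W]]) simp
    then have "norm (g i W x - vf_exp W x) \<le> c i * C_norm (m + 1) W ^ (m + 1)"
      using c[OF i] pos by (subst (asm) ennreal_le_iff) auto
    also have "\<dots> \<le> C * C_norm (m + 1) W ^ (m + 1)"
      unfolding C_def using c i pos by (intro mult_right_mono member_le_sum) (auto intro: less_imp_le)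
    finally show "norm (g i W x - vf_exp W x) \<le> C * C_norm (m + 1) W ^ (m + 1)" .
  qed
qed

theorem theorem1p3:
  fixes V :: "'d::finite letter \<Rightarrow> real^'n \<Rightarrow> real^'n"
    and Q :: "'w measure"
    and Z :: "nat \<Rightarrow> 'w \<Rightarrow> 'd series"
    and m M :: nat
  assumes V: "\<forall>a. V a \<in> Cb_infinity"
    and Q: "prob_space Q"
    and m: "m \<ge> 1" and M: "M \<ge> 2"
    and Z: "\<forall>i\<in>{1..M}. Z i \<in> measurable Q (restrict_space borel lie_series)"
    and Z_trunc: "\<forall>i\<in>{1..M}. \<forall>\<omega>\<in>space Q. Z i \<omega> = trunc m (Z i \<omega>)"
    and Z_int: "\<forall>i\<in>{1..M}. integrable Q (\<lambda>\<omega>. norm2 (trunc m (Z i \<omega>)))"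
    and Z_exp_int: "\<forall>s\<in>{0<..1}. \<forall>a>0.
      integrable Q (\<lambda>\<omega>. exp (a * (\<Sum>j=1..M. C_norm (m + 1) (Phi V (rescale s (Z j \<omega>))))))"
  shows "\<forall>p\<ge>1. \<forall>g. (\<forall>i\<in>{1..M}. g i \<in> integration_schemes m) \<longrightarrow>
    (\<exists>C>0. \<forall>s\<in>{0<..1}.
      Lp_norm Q p (\<lambda>\<omega>. SUP x. ennreal (norm
        (composition (\<lambda>i. g i (Phi V (rescale s (Z i \<omega>)))) M x
         - vf_exp (Phi V (rescale s (trunc m (s_log (exp_product (\<lambda>i. Z i \<omega>) M))))) x)))
      \<le> ennreal (C * s powr (real (m + 1) / 2)))"
proof (intro allI impI)
  fix p :: real and g :: "nat \<Rightarrow> (real^'n \<Rightarrow> real^'n) \<Rightarrow> real^'n \<Rightarrow> real^'n"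
  assume p: "1 \<le> p" and g: "\<forall>i\<in>{1..M}. g i \<in> integration_schemes m"
  have VC: "V a \<in> Cb_infinity" for a
    using V by blast
  have fQ: "finite_measure Q"
    using Q by (simp add: prob_space.axioms(1) prob_space_def)
  have tZ: "Z i \<omega> = trunc m (Z i \<omega>)" if "i \<in> {1..M}" "\<omega> \<in> space Q" for i \<omega>
    using Z_trunc that by blast
  have pZ: "primitive (Z i \<omega>)" if i: "i \<in> {1..M}" "\<omega> \<in> space Q" for i \<omega>
  proof (rule primitive_lie_series)
    show "Z i \<omega> \<in> lie_series"
      using measurable_space[OF Z[rule_format, OF i(1)] i(2)] by (simp add: space_restrict_space)
    show "finite (support (Z i \<omega>))"
      by (subst tZ[OF i]) (rule finite_support_trunc)
  qed
  have lie: "rescale s (Z i \<omega>) \<in> lie_polynomials" if "i \<in> {1..M}" "\<omega> \<in> space Q" for i \<omega> s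
    by (rule rescale_primitive_in_lie_polynomials(2)[OF pZ[OF that] tZ[OF that]])
  have field: "exp_moment_field V Q (m + 1) (\<lambda>\<omega>. rescale s (Z i \<omega>))" if s: "s \<in> {0<..1}" and i: "i \<in> {1..M}" for s i
  proof -
    define h where "h \<omega> = (\<Sum>j=1..M. C_norm (m + 1) (Phi V (rescale s (Z j \<omega>))))" for \<omega>
    have int: "integrable Q (\<lambda>\<omega>. exp (a * h \<omega>))" if "a > 0" for a
      using Z_exp_int s that by (simp add: h_def)
    have C0: "0 \<le> C_norm (m + 1) (Phi V (rescale s (Z j \<omega>)))" if "j \<in> {1..M}" "\<omega> \<in> space Q" for j \<omega>
      by (intro C_norm_nonneg Phi_in_Cb_infinity[of V, OF VC] lie that)
    \<comment> \<open>Integrability of exp(h) gives measurability of h through the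
      logarithm.\<close>
    have "(\<lambda>\<omega>. ln (exp (1 * h \<omega>))) \<in> borel_measurable Q"
      by (intro borel_measurable_ln borel_measurable_integrable int) simp
    then have "h \<in> borel_measurable Q"
      by simp
    moreover have "0 \<le> h \<omega>" if "\<omega> \<in> space Q" for \<omega>
      unfolding h_def using C0 that by (intro sum_nonneg) auto
    ultimately have "exp_moments Q h"
      using int unfolding exp_moments_def by blast
    moreover have "C_norm (m + 1) (Phi V (rescale s (Z i \<omega>))) \<le> h \<omega>" if "\<omega> \<in> space Q" for \<omega>
      unfolding h_def using i C0 that by (intro member_le_sum) auto
    ultimately show ?thesis
      using lie[OF i] unfolding exp_moment_field_def[of V, OF VC fQ] by blast
  qed
  have part: "exp_moment_field V Q (m + 1) (\<lambda>\<omega>. weight_part k (Z i \<omega>))" if i: "i \<in> {1..M}" and k: "k \<in> {1..m}" for i k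
  proof (rule exp_moment_field_coefficients[of V, OF VC fQ _ k])
    fix \<sigma> :: real assume \<sigma>: "0 < \<sigma>" "\<sigma> \<le> 1"
    \<comment> \<open>The choice s = \<sigma>^2 turns the factors s^(k/2) into powers of \<sigma>,
      as the elimination needs.\<close>
    have "exp_moment_field V Q (m + 1) (\<lambda>\<omega>. rescale (\<sigma>\<^sup>2) (Z i \<omega>))"
      using \<sigma> by (intro field i) (simp add: power_le_one)
    moreover have "rescale (\<sigma>\<^sup>2) (Z i \<omega>) = (\<lambda>w. \<Sum>k\<in>{1..m}. \<sigma> ^ k * weight_part k (Z i \<omega>) w)" if \<omega>: "\<omega> \<in> space Q" for \<omega>
    proof -
      have "\<sigma>\<^sup>2 powr (real k / 2) = \<sigma> ^ k" for k
      proof -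
        have "\<sigma>\<^sup>2 = \<sigma> powr 2"
          using \<sigma> by simp
        then have "\<sigma>\<^sup>2 powr (real k / 2) = \<sigma> powr real k"
          by (simp only: powr_powr) simp
        also have "\<dots> = \<sigma> ^ k"
          using \<sigma>(1) by (rule powr_realpow)
        finally show ?thesis .
      qed
      moreover have "weight_part 0 (Z i \<omega>) w = 0" for w
        using primitive_Nil[OF pZ[OF i \<omega>]] length_le_wdeg[of w] by (auto simp: weight_part_def)
      moreover have "{..m} = insert 0 {1..m}"
        by auto
      ultimately show ?thesis
        unfolding rescale_eq_sum[OF tZ[OF i \<omega>], of "\<sigma>\<^sup>2"] by simp
    qed
    ultimately show "exp_moment_field V Q (m + 1) (\<lambda>\<omega> w. \<Sum>k\<in>{1..m}. \<sigma> ^ k * weight_part k (Z i \<omega>) w)"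
      by (rule exp_moment_field_cong[of V, OF VC fQ])
  qed
  define h where "h i k = (SOME h. exp_moments Q h \<and>
    (\<forall>\<omega>\<in>space Q. C_norm (m + 1) (Phi V (weight_part k (Z i \<omega>))) \<le> h \<omega>))" for i k
  have h: "exp_moments Q (h i k)"
    "\<And>\<omega>. \<omega> \<in> space Q \<Longrightarrow> C_norm (m + 1) (Phi V (weight_part k (Z i \<omega>))) \<le> h i k \<omega>"
    if "i \<in> {1..M}" "k \<in> {1..m}" for i k
    using someI_ex[OF conjunct2[OF part[OF that, unfolded exp_moment_field_def[of V, OF VC fQ]]], folded h_def]
    by blast+
  \<comment> \<open>One variable dominates the norms of all weight parts of all Z_i; it does not
    involve s.\<close>
  define K where "K \<omega> = (\<Sum>i\<in>{1..M}. \<Sum>k\<in>{1..m}. h i k \<omega>)" for \<omega>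
  have K: "exp_moments Q K"
    unfolding K_def by (intro exp_moments_sum fQ h)
  then have K0: "0 \<le> K \<omega>" if "\<omega> \<in> space Q" for \<omega>
    using that by (simp add: exp_moments_def)
  have h0: "0 \<le> h i k \<omega>" if "i \<in> {1..M}" "k \<in> {1..m}" "\<omega> \<in> space Q" for i k \<omega>
    using h(1) that by (simp add: exp_moments_def)
  have hK: "h i k \<omega> \<le> K \<omega>" if "i \<in> {1..M}" "k \<in> {1..m}" "\<omega> \<in> space Q" for i k \<omega>
  proof -
    have "h i k \<omega> \<le> (\<Sum>k\<in>{1..m}. h i k \<omega>)"
      using that h0 by (intro member_le_sum) auto
    also have "\<dots> \<le> K \<omega>"
      unfolding K_def using that h0 by (intro member_le_sum[of i "{1..M}" "\<lambda>i. \<Sum>k\<in>{1..m}. h i k \<omega>"] sum_nonneg) auto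
    finally show ?thesis .
  qed
  obtain C where C: "0 \<le> C" "\<forall>i\<in>{1..M}. \<forall>W\<in>Cb_infinity. \<forall>x.
      norm (g i W x - vf_exp W x) \<le> C * C_norm (m + 1) W ^ (m + 1)"
    using integration_schemes_bound[of M g m] g by blast
  \<comment> \<open>The constant of \<open>scheme_error_bound\<close> as a function of \<kappa>
    alone, with its B inserted.\<close>
  define F where "F \<kappa> = real M * exp (real m * \<kappa>) ^ M * (C * (real m * \<kappa>) ^ (m + 1))
      + flow_error CARD('n) m M (real CARD('n) * 2 ^ m * \<kappa>)" for \<kappa>
  have "exp_growth F"
    unfolding F_def using C(1)
    by (intro exp_growth_add exp_growth_mult exp_growth_power exp_growth_exp exp_growth_flow_error
        exp_growth_id exp_growth_const) auto
  then obtain E a where E: "E > 0" "a > 0" "\<forall>\<kappa>\<ge>0. 0 \<le> F \<kappa> \<and> F \<kappa> \<le> E * exp (a * \<kappa>)"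
    unfolding exp_growth_def by blast
  obtain D where D: "D > 0" "\<forall>\<sigma>>0. \<forall>f. (\<forall>\<omega>\<in>space Q. f \<omega> \<le> ennreal (E * exp (a * K \<omega>) * \<sigma>)) \<longrightarrow>
      Lp_norm Q p f \<le> ennreal (D * \<sigma>)"
    using Lp_norm_le_exp_moment[OF Q K E(1,2) p] by blast
  show "\<exists>C>0. \<forall>s\<in>{0<..1}.
      Lp_norm Q p (\<lambda>\<omega>. SUP x. ennreal (norm
        (composition (\<lambda>i. g i (Phi V (rescale s (Z i \<omega>)))) M x
         - vf_exp (Phi V (rescale s (trunc m (s_log (exp_product (\<lambda>i. Z i \<omega>) M))))) x)))
      \<le> ennreal (C * s powr (real (m + 1) / 2))"
  proof (intro exI[of _ D] conjI ballI D(1) D(2)[rule_format])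
    fix s :: real assume "s \<in> {0<..1}"
    then have s: "0 < s" "s \<le> 1"
      by auto
    then show "0 < s powr (real (m + 1) / 2)"
      by simp
    fix \<omega> assume \<omega>: "\<omega> \<in> space Q"
    show "(SUP x. ennreal (norm (composition (\<lambda>i. g i (Phi V (rescale s (Z i \<omega>)))) M x
         - vf_exp (Phi V (rescale s (trunc m (s_log (exp_product (\<lambda>i. Z i \<omega>) M))))) x)))
      \<le> ennreal (E * exp (a * K \<omega>) * s powr (real (m + 1) / 2))"
    proof (intro SUP_least ennreal_leI)
      fix x
      have "norm (composition (\<lambda>i. g i (Phi V (rescale s (Z i \<omega>)))) M x
          - vf_exp (Phi V (rescale s (trunc m (s_log (exp_product (\<lambda>i. Z i \<omega>) M))))) x)
        \<le> F (K \<omega>) * s powr (real (m + 1) / 2)"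
        unfolding F_def
        by (rule scheme_error_bound[of V M "\<lambda>i. Z i \<omega>" m "K \<omega>" s, OF VC pZ[OF _ \<omega>] tZ[OF _ \<omega>] order_trans[OF h(2) hK] K0[OF \<omega>] s refl m C(1)])
          (use \<omega> C(2) in auto)
      also have "\<dots> \<le> E * exp (a * K \<omega>) * s powr (real (m + 1) / 2)"
        using E(3) K0[OF \<omega>] by (intro mult_right_mono) auto
      finally show "norm (composition (\<lambda>i. g i (Phi V (rescale s (Z i \<omega>)))) M x
          - vf_exp (Phi V (rescale s (trunc m (s_log (exp_product (\<lambda>i. Z i \<omega>) M))))) x)
        \<le> E * exp (a * K \<omega>) * s powr (real (m + 1) / 2)" .
    qed
  qed
qed

end
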